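(* Let $k$ be a commutative unital ring, $m\ge2$, $n=m+1$, $A$ a unital associative $k$-algebra, $c\in A^\times$, and $\sigma\in\mathrm{Aut}_k(A)$ with $\sigma(c)=c$ and $\sigma^m(a)=cac^{-1}$ for all $a\in A$. If $c=1$, then $\sigma^m=1$ and there is an isomorphism of $k$-algebras $$\mathsf U^{\mathrm{an}}(A,\sigma,n):=\mathsf U^{\mathrm{an}}_1(A,\sigma,n)\cong A^e\rtimes_{\sigma^e}C_m,$$ where $A^e=A\otimes_kA^{\mathrm{op}}$, $\sigma^e=\sigma\otimes\sigma^{\mathrm{op}}$, and $A^e\rtimes_{\sigma^e}C_m$ is the skew group algebra in which a generator of the cyclic group $C_m$ of order $m$ acts on $A^e$ by $\sigma^e$. The regular slot module $A$ (with all slot operations given by the $n$-ary product) is endpoint-anchored, and its remaining unit contexts (one-vertex contexts with all ordinary entries equal to $1$ and the hole in another position) act on $A$ as the powers of $\sigma$.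
   Context: The $n$-ary algebra $T(A,\sigma,c)$ is $A$ with the totally associative product $\mu_{\sigma,c}(a_0,\ldots,a_m)=a_0\sigma(a_1)\cdots\sigma^{m-1}(a_{m-1})ca_m$. Slot modules: a slot module over $T(A,\sigma,c)$ is a $k$-module $M$ with multilinear maps $\lambda_i:A^{\otimes i}\otimes M\otimes A^{\otimes(m-i)}\to M$, $0\le i\le m$, such that all evaluations of a planar $n$-ary word containing exactly one entry of $M$ agree under total-associativity moves. It is endpoint-anchored if $\lambda_0(x,1,\ldots,1,c^{-1})=x$ and $\lambda_m(c^{-1},1,\ldots,1,x)=x$ for all $x\in M$. Envelope: a one-hole context is a finite planar rooted full $n$-ary tree (every internal vertex has exactly $n$ ordered inputs) with one distinguished leaf labelled $\star$ (the hole) and all other (ordinary) leaves labelled by elements of $A$. Take the free $k$-module on one-hole contexts modulo: multilinearity in the ordinary leaf labels; scalar contraction (a vertex all of whose inputs are ordinary leaves $a_0,\ldots,a_m$ may be replaced by one ordinary leaf labelled $\mu_{\sigma,c}(a_0,\ldots,a_m)$); and total associativity (rebracketing of two adjacent vertices). Grafting makes this an associative unital algebra: $CD$ is obtained by grafting $D$ into the hole of $C$, and the unit is the trivial tree $\star$. Imposing moreover (as algebra relations) that the one-vertex contexts with inputs $(\star,1,\ldots,1,c^{-1})$ and $(c^{-1},1,\ldots,1,\star)$ both equal the unit gives $\mathsf U^{\mathrm{an}}_c(A,\sigma,n)$. *)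

theory Defs
  imports "HOL-Algebra.QuotRing" "HOL-Algebra.Module" "HOL-Algebra.Elementary_Groups"
begin

section \<open>Unital associative algebras over a commutative ring\<close>

text \<open>The library locale \<open>algebra\<close> only covers commutative algebras.\<close>

locale k_algebra = module k A + A: ring A
  for k :: "('k, 'x) ring_scheme" (structure) and A :: "('k, 'a, 'y) module_scheme" (structure) +
  assumes smult_mult_left:
      "\<lbrakk>r \<in> carrier k; a \<in> carrier A; b \<in> carrier A\<rbrakk>
        \<Longrightarrow> r \<odot>\<^bsub>A\<^esub> (a \<otimes>\<^bsub>A\<^esub> b) = (r \<odot>\<^bsub>A\<^esub> a) \<otimes>\<^bsub>A\<^esub> b"
    and smult_mult_right:
      "\<lbrakk>r \<in> carrier k; a \<in> carrier A; b \<in> carrier A\<rbrakk>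
        \<Longrightarrow> r \<odot>\<^bsub>A\<^esub> (a \<otimes>\<^bsub>A\<^esub> b) = a \<otimes>\<^bsub>A\<^esub> (r \<odot>\<^bsub>A\<^esub> b)"

definition alg_iso ::
  "('k, 'x) ring_scheme \<Rightarrow> ('k, 'a, 'y) module_scheme \<Rightarrow> ('k, 'b, 'z) module_scheme \<Rightarrow> ('a \<Rightarrow> 'b) set"
  where "alg_iso k A B =
    {h \<in> ring_iso A B. \<forall>r\<in>carrier k. \<forall>a\<in>carrier A. h (r \<odot>\<^bsub>A\<^esub> a) = r \<odot>\<^bsub>B\<^esub> h a}"

definition alg_isomorphic ::
  "('k, 'x) ring_scheme \<Rightarrow> ('k, 'a, 'y) module_scheme \<Rightarrow> ('k, 'b, 'z) module_scheme \<Rightarrow> bool"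
  where "alg_isomorphic k A B \<longleftrightarrow> k_algebra k A \<and> k_algebra k B \<and> alg_iso k A B \<noteq> {}"

abbreviation alg_aut ::
  "('k, 'x) ring_scheme \<Rightarrow> ('k, 'a, 'y) module_scheme \<Rightarrow> ('a \<Rightarrow> 'a) set"
  where "alg_aut k A \<equiv> alg_iso k A A"

definition op_algebra :: "('k, 'a, 'y) module_scheme \<Rightarrow> ('k, 'a, 'y) module_scheme"
  where "op_algebra A = A\<lparr>mult := \<lambda>x y. y \<otimes>\<^bsub>A\<^esub> x\<rparr>"

definition module_span ::
  "('k, 'x) ring_scheme \<Rightarrow> ('k, 'a, 'y) module_scheme \<Rightarrow> 'a set \<Rightarrow> 'a set"
  where "module_span k M S = \<Inter>{N. submodule N k M \<and> S \<subseteq> N}"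

definition quotient_algebra ::
  "('k, 'a, 'y) module_scheme \<Rightarrow> 'a set \<Rightarrow> ('k, 'a set) module"
  where "quotient_algebra F N =
    \<lparr>carrier = carrier (F Quot N), mult = mult (F Quot N), one = one (F Quot N),
     zero = zero (F Quot N), add = add (F Quot N),
     smult = (\<lambda>r Y. \<Union>x\<in>Y. N +>\<^bsub>F\<^esub> (r \<odot>\<^bsub>F\<^esub> x))\<rparr>"


section \<open>Skew group algebras and monoid algebras\<close>

text \<open>
  The function \<open>f\<close> stands for the finite formal sum of the terms \<open>f g \<cdot> g\<close>, and
  \<open>(b \<cdot> g) (b' \<cdot> g') = (b \<cdot> act g b') \<cdot> (g g')\<close>.  Functions vanish outside \<open>carrier G\<close>.
\<close>

definition skew_algebra ::
  "('k, 'b, 'y) module_scheme \<Rightarrow> ('g, 'z) monoid_scheme \<Rightarrow> ('g \<Rightarrow> 'b \<Rightarrow> 'b) \<Rightarrow> ('k, 'g \<Rightarrow> 'b) module"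
  where "skew_algebra B G act =
    \<lparr>carrier = {f. (\<forall>x. f x \<in> carrier B) \<and> (\<forall>x. x \<notin> carrier G \<longrightarrow> f x = \<zero>\<^bsub>B\<^esub>)
                  \<and> finite {x. f x \<noteq> \<zero>\<^bsub>B\<^esub>}},
     mult = (\<lambda>f g z. \<Oplus>\<^bsub>B\<^esub>p\<in>{p \<in> {x. f x \<noteq> \<zero>\<^bsub>B\<^esub>} \<times> {y. g y \<noteq> \<zero>\<^bsub>B\<^esub>}. fst p \<otimes>\<^bsub>G\<^esub> snd p = z}.
               f (fst p) \<otimes>\<^bsub>B\<^esub> act (fst p) (g (snd p))),
     one = (\<lambda>x. if x = \<one>\<^bsub>G\<^esub> then \<one>\<^bsub>B\<^esub> else \<zero>\<^bsub>B\<^esub>),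
     zero = (\<lambda>x. \<zero>\<^bsub>B\<^esub>),
     add = (\<lambda>f g x. f x \<oplus>\<^bsub>B\<^esub> g x),
     smult = (\<lambda>r f x. r \<odot>\<^bsub>B\<^esub> f x)\<rparr>"

definition self_algebra :: "('k, 'x) ring_scheme \<Rightarrow> ('k, 'k) module"
  where "self_algebra k =
    \<lparr>carrier = carrier k, mult = mult k, one = one k,
     zero = zero k, add = add k, smult = mult k\<rparr>"

text \<open>As a module, this is the free module on \<open>carrier G\<close>, with basis \<open>basis_elem k g\<close>.\<close>

definition monoid_algebra ::
  "('k, 'x) ring_scheme \<Rightarrow> ('g, 'z) monoid_scheme \<Rightarrow> ('k, 'g \<Rightarrow> 'k) module"
  where "monoid_algebra k G = skew_algebra (self_algebra k) G (\<lambda>_ b. b)"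

definition basis_elem :: "('k, 'x) ring_scheme \<Rightarrow> 'g \<Rightarrow> 'g \<Rightarrow> 'k"
  where "basis_elem k g = (\<lambda>x. if x = g then \<one>\<^bsub>k\<^esub> else \<zero>\<^bsub>k\<^esub>)"

definition cyclic_skew_algebra ::
  "('k, 'b, 'y) module_scheme \<Rightarrow> ('b \<Rightarrow> 'b) \<Rightarrow> nat \<Rightarrow> ('k, int \<Rightarrow> 'b) module"
  where "cyclic_skew_algebra B \<tau> m = skew_algebra B (integer_mod_group m) (\<lambda>i. \<tau> ^^ nat i)"


section \<open>Tensor products of algebras\<close>

text \<open>
  The free module on \<open>carrier A \<times> carrier B\<close> modulo the bilinearity relations.  Taking the monoid
  algebra of the product of the multiplicative monoids as the free module yields
  \<open>(a \<otimes> b) (a' \<otimes> b') = a a' \<otimes> b b'\<close>.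
\<close>

definition tensor_rels ::
  "('k, 'x) ring_scheme \<Rightarrow> ('k, 'a, 'y) module_scheme \<Rightarrow> ('k, 'b, 'z) module_scheme
    \<Rightarrow> ('a \<times> 'b \<Rightarrow> 'k) set"
  where "tensor_rels k A B =
    (let F = monoid_algebra k (A \<times>\<times> B); e = basis_elem k in
      {e (a \<oplus>\<^bsub>A\<^esub> a', b) \<ominus>\<^bsub>F\<^esub> (e (a, b) \<oplus>\<^bsub>F\<^esub> e (a', b)) | a a' b.
          a \<in> carrier A \<and> a' \<in> carrier A \<and> b \<in> carrier B}
    \<union> {e (a, b \<oplus>\<^bsub>B\<^esub> b') \<ominus>\<^bsub>F\<^esub> (e (a, b) \<oplus>\<^bsub>F\<^esub> e (a, b')) | a b b'.
          a \<in> carrier A \<and> b \<in> carrier B \<and> b' \<in> carrier B}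
    \<union> {e (r \<odot>\<^bsub>A\<^esub> a, b) \<ominus>\<^bsub>F\<^esub> r \<odot>\<^bsub>F\<^esub> e (a, b) | r a b.
          r \<in> carrier k \<and> a \<in> carrier A \<and> b \<in> carrier B}
    \<union> {e (a, r \<odot>\<^bsub>B\<^esub> b) \<ominus>\<^bsub>F\<^esub> r \<odot>\<^bsub>F\<^esub> e (a, b) | r a b.
          r \<in> carrier k \<and> a \<in> carrier A \<and> b \<in> carrier B})"

definition tensor_ker ::
  "('k, 'x) ring_scheme \<Rightarrow> ('k, 'a, 'y) module_scheme \<Rightarrow> ('k, 'b, 'z) module_scheme
    \<Rightarrow> ('a \<times> 'b \<Rightarrow> 'k) set"
  where "tensor_ker k A B = module_span k (monoid_algebra k (A \<times>\<times> B)) (tensor_rels k A B)"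

definition tensor_algebra ::
  "('k, 'x) ring_scheme \<Rightarrow> ('k, 'a, 'y) module_scheme \<Rightarrow> ('k, 'b, 'z) module_scheme
    \<Rightarrow> ('k, ('a \<times> 'b \<Rightarrow> 'k) set) module"
  where "tensor_algebra k A B =
    quotient_algebra (monoid_algebra k (A \<times>\<times> B)) (tensor_ker k A B)"

definition pure_tensor ::
  "('k, 'x) ring_scheme \<Rightarrow> ('k, 'a, 'y) module_scheme \<Rightarrow> ('k, 'b, 'z) module_scheme
    \<Rightarrow> 'a \<Rightarrow> 'b \<Rightarrow> ('a \<times> 'b \<Rightarrow> 'k) set"
  where "pure_tensor k A B a b =
    tensor_ker k A B +>\<^bsub>monoid_algebra k (A \<times>\<times> B)\<^esub> basis_elem k (a, b)"

text \<open>
  The endomorphism \<open>f \<otimes> g\<close> of \<open>A \<otimes> B\<close>: the value on a class \<open>Y\<close> is that of the linear extension of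
  \<open>(a, b) \<mapsto> f a \<otimes> g b\<close> at any representative \<open>u\<close> of \<open>Y\<close>.
\<close>

definition tensor_map ::
  "('k, 'x) ring_scheme \<Rightarrow> ('k, 'a, 'y) module_scheme \<Rightarrow> ('k, 'b, 'z) module_scheme
    \<Rightarrow> ('a \<Rightarrow> 'a) \<Rightarrow> ('b \<Rightarrow> 'b) \<Rightarrow> ('a \<times> 'b \<Rightarrow> 'k) set \<Rightarrow> ('a \<times> 'b \<Rightarrow> 'k) set"
  where "tensor_map k A B f g Y =
    (let T = tensor_algebra k A B in
      the_elem ((\<lambda>u. \<Oplus>\<^bsub>T\<^esub>p\<in>{p. u p \<noteq> \<zero>\<^bsub>k\<^esub>}.
        u p \<odot>\<^bsub>T\<^esub> pure_tensor k A B (f (fst p)) (g (snd p))) ` Y))"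

definition enveloping_algebra ::
  "('k, 'x) ring_scheme \<Rightarrow> ('k, 'a, 'y) module_scheme \<Rightarrow> ('k, ('a \<times> 'a \<Rightarrow> 'k) set) module"
  where "enveloping_algebra k A = tensor_algebra k A (op_algebra A)"

definition enveloping_map ::
  "('k, 'x) ring_scheme \<Rightarrow> ('k, 'a, 'y) module_scheme \<Rightarrow> ('a \<Rightarrow> 'a)
    \<Rightarrow> ('a \<times> 'a \<Rightarrow> 'k) set \<Rightarrow> ('a \<times> 'a \<Rightarrow> 'k) set"
  where "enveloping_map k A \<sigma> = tensor_map k A (op_algebra A) \<sigma> \<sigma>"


section \<open>The \<open>n\<close>-ary product and one-hole contexts\<close>

text \<open>Throughout, the arity is \<open>n = Suc m\<close>.\<close>

definition nary_mult ::
  "('a, 'y) ring_scheme \<Rightarrow> nat \<Rightarrow> ('a \<Rightarrow> 'a) \<Rightarrow> 'a \<Rightarrow> 'a list \<Rightarrow> 'a"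
  where "nary_mult A m \<sigma> c as =
    foldr (mult A) (map (\<lambda>i. (\<sigma> ^^ i) (as ! i)) [0..<m]) (c \<otimes>\<^bsub>A\<^esub> (as ! m))"

datatype 'a ptree = Hole | Leaf 'a | Node "'a ptree list"

primrec holes :: "'a ptree \<Rightarrow> nat" where
  "holes Hole = 1"
| "holes (Leaf a) = 0"
| "holes (Node ts) = sum_list (map holes ts)"

primrec full_ptree :: "'a set \<Rightarrow> nat \<Rightarrow> 'a ptree \<Rightarrow> bool" where
  "full_ptree S n Hole \<longleftrightarrow> True"
| "full_ptree S n (Leaf a) \<longleftrightarrow> a \<in> S"
| "full_ptree S n (Node ts) \<longleftrightarrow> length ts = n \<and> list_all id (map (full_ptree S n) ts)"

definition one_hole_contexts :: "'a set \<Rightarrow> nat \<Rightarrow> 'a ptree set"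
  where "one_hole_contexts S n = {t. full_ptree S n t \<and> holes t = 1}"

primrec graft :: "'a ptree \<Rightarrow> 'a ptree \<Rightarrow> 'a ptree" where
  "graft Hole t = t"
| "graft (Leaf a) t = Leaf a"
| "graft (Node ts) t = Node (map (\<lambda>s. graft s t) ts)"

definition context_monoid :: "'a set \<Rightarrow> nat \<Rightarrow> 'a ptree monoid"
  where "context_monoid S n = \<lparr>carrier = one_hole_contexts S n, mult = graft, one = Hole\<rparr>"

text \<open>
  A frame is a tree with one marked position, given as the function inserting a subtree there.
  The marked position is unrelated to the hole, which may lie in the frame or in the inserted tree.
\<close>

inductive tree_frame :: "('a ptree \<Rightarrow> 'a ptree) \<Rightarrow> bool" where
  here: "tree_frame (\<lambda>t. t)"
| below: "tree_frame P \<Longrightarrow> tree_frame (\<lambda>t. Node (us @ P t # ws))"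

text \<open>Rebracketing of two adjacent vertices, anywhere in a tree.\<close>

inductive rebracket :: "nat \<Rightarrow> 'a ptree \<Rightarrow> 'a ptree \<Rightarrow> bool" for n where
  "\<lbrakk>tree_frame P; length vs = n; length vs' = n;
    length (us @ Node vs # ws) = n; length (us' @ Node vs' # ws') = n;
    us @ vs @ ws = us' @ vs' @ ws'\<rbrakk>
    \<Longrightarrow> rebracket n (P (Node (us @ Node vs # ws))) (P (Node (us' @ Node vs' # ws')))"


section \<open>Slot modules\<close>

text \<open>
  The family of slot operations is a single function \<open>lam\<close>: for lists \<open>us\<close> and \<open>ws\<close> of lengths \<open>i\<close>
  and \<open>m - i\<close>, \<open>lam us x ws\<close> is the value of the operation with index \<open>i\<close>, whose entry from the
  module is \<open>x\<close>.

  In \<open>slot_eval\<close>, a subtree without hole evaluates to \<open>Inl\<close> of an element of the algebra, and one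
  with a single hole, filled with \<open>x\<close>, to \<open>Inr\<close> of an element of the module.
\<close>

definition vertex_eval ::
  "('a list \<Rightarrow> 'a) \<Rightarrow> ('a list \<Rightarrow> 'b \<Rightarrow> 'a list \<Rightarrow> 'b) \<Rightarrow> ('a + 'b) list \<Rightarrow> 'a + 'b"
  where "vertex_eval \<mu> lam vs =
    (case dropWhile isl vs of
      [] \<Rightarrow> Inl (\<mu> (map projl vs))
    | y # ws \<Rightarrow> Inr (lam (map projl (takeWhile isl vs)) (projr y) (map projl ws)))"

primrec slot_eval ::
  "('a list \<Rightarrow> 'a) \<Rightarrow> ('a list \<Rightarrow> 'b \<Rightarrow> 'a list \<Rightarrow> 'b) \<Rightarrow> 'b \<Rightarrow> 'a ptree \<Rightarrow> 'a + 'b" where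
  "slot_eval \<mu> lam x Hole = Inr x"
| "slot_eval \<mu> lam x (Leaf a) = Inl a"
| "slot_eval \<mu> lam x (Node ts) = vertex_eval \<mu> lam (map (slot_eval \<mu> lam x) ts)"

definition context_action ::
  "('a list \<Rightarrow> 'a) \<Rightarrow> ('a list \<Rightarrow> 'b \<Rightarrow> 'a list \<Rightarrow> 'b) \<Rightarrow> 'a ptree \<Rightarrow> 'b \<Rightarrow> 'b"
  where "context_action \<mu> lam t x = projr (slot_eval \<mu> lam x t)"

locale slot_module = k_algebra k A + M: module k M
  for k :: "('k, 'x) ring_scheme" (structure) and A :: "('k, 'a, 'y) module_scheme" (structure)
    and m :: nat and \<sigma> :: "'a \<Rightarrow> 'a" and c :: 'a
    and M :: "('k, 'b, 'z) module_scheme" (structure)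
    and lam :: "'a list \<Rightarrow> 'b \<Rightarrow> 'a list \<Rightarrow> 'b" +
  assumes slot_closed:
      "\<lbrakk>set us \<subseteq> carrier A; set ws \<subseteq> carrier A; length us + length ws = m; x \<in> carrier M\<rbrakk>
        \<Longrightarrow> lam us x ws \<in> carrier M"
    and slot_add:
      "\<lbrakk>set us \<subseteq> carrier A; set ws \<subseteq> carrier A; length us + length ws = m;
        x \<in> carrier M; y \<in> carrier M\<rbrakk>
        \<Longrightarrow> lam us (x \<oplus>\<^bsub>M\<^esub> y) ws = lam us x ws \<oplus>\<^bsub>M\<^esub> lam us y ws"
    and slot_smult:
      "\<lbrakk>set us \<subseteq> carrier A; set ws \<subseteq> carrier A; length us + length ws = m;
        x \<in> carrier M; r \<in> carrier k\<rbrakk>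
        \<Longrightarrow> lam us (r \<odot>\<^bsub>M\<^esub> x) ws = r \<odot>\<^bsub>M\<^esub> lam us x ws"
    and left_add:
      "\<lbrakk>set us \<subseteq> carrier A; set vs \<subseteq> carrier A; set ws \<subseteq> carrier A;
        length us + 1 + length vs + length ws = m;
        x \<in> carrier M; a \<in> carrier A; b \<in> carrier A\<rbrakk>
        \<Longrightarrow> lam (us @ (a \<oplus>\<^bsub>A\<^esub> b) # vs) x ws = lam (us @ a # vs) x ws \<oplus>\<^bsub>M\<^esub> lam (us @ b # vs) x ws"
    and left_smult:
      "\<lbrakk>set us \<subseteq> carrier A; set vs \<subseteq> carrier A; set ws \<subseteq> carrier A;
        length us + 1 + length vs + length ws = m;
        x \<in> carrier M; a \<in> carrier A; r \<in> carrier k\<rbrakk>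
        \<Longrightarrow> lam (us @ (r \<odot>\<^bsub>A\<^esub> a) # vs) x ws = r \<odot>\<^bsub>M\<^esub> lam (us @ a # vs) x ws"
    and right_add:
      "\<lbrakk>set us \<subseteq> carrier A; set vs \<subseteq> carrier A; set ws \<subseteq> carrier A;
        length us + length vs + 1 + length ws = m;
        x \<in> carrier M; a \<in> carrier A; b \<in> carrier A\<rbrakk>
        \<Longrightarrow> lam us x (vs @ (a \<oplus>\<^bsub>A\<^esub> b) # ws) = lam us x (vs @ a # ws) \<oplus>\<^bsub>M\<^esub> lam us x (vs @ b # ws)"
    and right_smult:
      "\<lbrakk>set us \<subseteq> carrier A; set vs \<subseteq> carrier A; set ws \<subseteq> carrier A;
        length us + length vs + 1 + length ws = m;
        x \<in> carrier M; a \<in> carrier A; r \<in> carrier k\<rbrakk>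
        \<Longrightarrow> lam us x (vs @ (r \<odot>\<^bsub>A\<^esub> a) # ws) = r \<odot>\<^bsub>M\<^esub> lam us x (vs @ a # ws)"
    and slot_assoc:
      "\<lbrakk>t \<in> one_hole_contexts (carrier A) (Suc m); rebracket (Suc m) t t'; x \<in> carrier M\<rbrakk>
        \<Longrightarrow> context_action (nary_mult A m \<sigma> c) lam t x = context_action (nary_mult A m \<sigma> c) lam t' x"

definition endpoint_anchored ::
  "('a, 'y) ring_scheme \<Rightarrow> nat \<Rightarrow> 'a \<Rightarrow> ('b, 'z) ring_scheme
    \<Rightarrow> ('a list \<Rightarrow> 'b \<Rightarrow> 'a list \<Rightarrow> 'b) \<Rightarrow> bool"
  where "endpoint_anchored A m c M lam \<longleftrightarrow>
    (\<forall>x\<in>carrier M.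
      lam [] x (replicate (m - 1) \<one>\<^bsub>A\<^esub> @ [inv\<^bsub>A\<^esub> c]) = x \<and>
      lam (inv\<^bsub>A\<^esub> c # replicate (m - 1) \<one>\<^bsub>A\<^esub>) x [] = x)"

definition regular_slot ::
  "('a, 'y) ring_scheme \<Rightarrow> nat \<Rightarrow> ('a \<Rightarrow> 'a) \<Rightarrow> 'a \<Rightarrow> 'a list \<Rightarrow> 'a \<Rightarrow> 'a list \<Rightarrow> 'a"
  where "regular_slot A m \<sigma> c us x ws = nary_mult A m \<sigma> c (us @ x # ws)"

definition unit_context :: "('a, 'y) ring_scheme \<Rightarrow> nat \<Rightarrow> nat \<Rightarrow> 'a ptree"
  where "unit_context A m i =
    Node (replicate i (Leaf \<one>\<^bsub>A\<^esub>) @ Hole # replicate (m - i) (Leaf \<one>\<^bsub>A\<^esub>))"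


section \<open>The anchored envelope\<close>

definition context_algebra ::
  "('k, 'x) ring_scheme \<Rightarrow> ('k, 'a, 'y) module_scheme \<Rightarrow> nat \<Rightarrow> ('k, 'a ptree \<Rightarrow> 'k) module"
  where "context_algebra k A m = monoid_algebra k (context_monoid (carrier A) (Suc m))"

text \<open>In order: multilinearity in the leaf labels, scalar contraction, total associativity.\<close>

definition envelope_rels ::
  "('k, 'x) ring_scheme \<Rightarrow> ('k, 'a, 'y) module_scheme \<Rightarrow> nat \<Rightarrow> ('a \<Rightarrow> 'a) \<Rightarrow> 'a
    \<Rightarrow> ('a ptree \<Rightarrow> 'k) set"
  where "envelope_rels k A m \<sigma> c =
    (let F = context_algebra k A m; e = basis_elem k;
         T = one_hole_contexts (carrier A) (Suc m) in
      {e (P (Leaf (a \<oplus>\<^bsub>A\<^esub> b))) \<ominus>\<^bsub>F\<^esub> (e (P (Leaf a)) \<oplus>\<^bsub>F\<^esub> e (P (Leaf b))) | P a b.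
          tree_frame P \<and> a \<in> carrier A \<and> b \<in> carrier A \<and> P (Leaf a) \<in> T}
    \<union> {e (P (Leaf (r \<odot>\<^bsub>A\<^esub> a))) \<ominus>\<^bsub>F\<^esub> r \<odot>\<^bsub>F\<^esub> e (P (Leaf a)) | P r a.
          tree_frame P \<and> r \<in> carrier k \<and> a \<in> carrier A \<and> P (Leaf a) \<in> T}
    \<union> {e (P (Node (map Leaf as))) \<ominus>\<^bsub>F\<^esub> e (P (Leaf (nary_mult A m \<sigma> c as))) | P as.
          tree_frame P \<and> P (Node (map Leaf as)) \<in> T}
    \<union> {e t \<ominus>\<^bsub>F\<^esub> e t' | t t'. t \<in> T \<and> rebracket (Suc m) t t'})"

text \<open>
  The relations are stable under grafting on either side, so their linear span is a two-sided ideal.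
\<close>

definition envelope_ker ::
  "('k, 'x) ring_scheme \<Rightarrow> ('k, 'a, 'y) module_scheme \<Rightarrow> nat \<Rightarrow> ('a \<Rightarrow> 'a) \<Rightarrow> 'a
    \<Rightarrow> ('a ptree \<Rightarrow> 'k) set"
  where "envelope_ker k A m \<sigma> c = module_span k (context_algebra k A m) (envelope_rels k A m \<sigma> c)"

definition slot_envelope ::
  "('k, 'x) ring_scheme \<Rightarrow> ('k, 'a, 'y) module_scheme \<Rightarrow> nat \<Rightarrow> ('a \<Rightarrow> 'a) \<Rightarrow> 'a
    \<Rightarrow> ('k, ('a ptree \<Rightarrow> 'k) set) module"
  where "slot_envelope k A m \<sigma> c =
    quotient_algebra (context_algebra k A m) (envelope_ker k A m \<sigma> c)"

definition context_class ::
  "('k, 'x) ring_scheme \<Rightarrow> ('k, 'a, 'y) module_scheme \<Rightarrow> nat \<Rightarrow> ('a \<Rightarrow> 'a) \<Rightarrow> 'a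
    \<Rightarrow> 'a ptree \<Rightarrow> ('a ptree \<Rightarrow> 'k) set"
  where "context_class k A m \<sigma> c t =
    envelope_ker k A m \<sigma> c +>\<^bsub>context_algebra k A m\<^esub> basis_elem k t"

definition anchor_rels ::
  "('k, 'x) ring_scheme \<Rightarrow> ('k, 'a, 'y) module_scheme \<Rightarrow> nat \<Rightarrow> ('a \<Rightarrow> 'a) \<Rightarrow> 'a
    \<Rightarrow> ('a ptree \<Rightarrow> 'k) set set"
  where "anchor_rels k A m \<sigma> c =
    (let U = slot_envelope k A m \<sigma> c; cls = context_class k A m \<sigma> c;
         us = replicate (m - 1) (Leaf \<one>\<^bsub>A\<^esub>) in
      {cls (Node (Hole # us @ [Leaf (inv\<^bsub>A\<^esub> c)])) \<ominus>\<^bsub>U\<^esub> \<one>\<^bsub>U\<^esub>,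
       cls (Node (Leaf (inv\<^bsub>A\<^esub> c) # us @ [Hole])) \<ominus>\<^bsub>U\<^esub> \<one>\<^bsub>U\<^esub>})"

definition anchored_envelope ::
  "('k, 'x) ring_scheme \<Rightarrow> ('k, 'a, 'y) module_scheme \<Rightarrow> nat \<Rightarrow> ('a \<Rightarrow> 'a) \<Rightarrow> 'a
    \<Rightarrow> ('k, ('a ptree \<Rightarrow> 'k) set set) module"
  where "anchored_envelope k A m \<sigma> c =
    quotient_algebra (slot_envelope k A m \<sigma> c)
      (genideal (slot_envelope k A m \<sigma> c) (anchor_rels k A m \<sigma> c))"

end

theory Submission
  imports Defs
begin


text \<open>
  Write \<open>sp\<close> for the twisted product \<open>sp [x\<^sub>0, x\<^sub>1, \<dots>] = x\<^sub>0 \<cdot> \<sigma> x\<^sub>1 \<cdot> \<sigma>\<^sup>2 x\<^sub>2 \<cdots>\<close>.  As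
  \<open>c a = \<sigma>\<^sup>m(a) c\<close>, the \<open>n\<close>-ary product is \<open>\<mu> as = sp as \<cdot> c\<close>, and a full tree with leaves \<open>xs\<close> and \<open>v\<close> vertices
  evaluates to \<open>sp xs \<cdot> c\<^sup>v\<close>.  Rebracketing keeps the leaves in order and keeps the number of vertices, so \<open>A\<close>
  is a slot module over itself; the anchors and the unit contexts are special cases of the formula.

  Now let \<open>c = 1\<close>.  Then \<open>\<sigma>\<^sup>m = 1\<close>, and a context with leaf labels \<open>us\<close> before and \<open>ws\<close> after the hole acts
  on \<open>A\<close> by \<open>x \<mapsto> sp us \<cdot> \<sigma>\<^sup>i(x) \<cdot> \<sigma>\<^sup>i\<^sup>+\<^sup>1(sp ws)\<close> with \<open>i = length us\<close>.  This suggests the element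
  \<open>(sp us \<otimes> \<sigma>\<^sup>i\<^sup>+\<^sup>1(sp ws)) g\<^sup>i\<close> of the skew group algebra.  The number of leaves of a context is \<open>1\<close> modulo \<open>m\<close>,
  and \<open>\<sigma>\<^sup>m = 1\<close>; therefore grafting becomes multiplication, and contracting \<open>m + 1\<close> leaves changes
  nothing.  So the assignment satisfies all relations of the anchored envelope (\<open>skew_rep\<close>), and by
  the universal property of the envelope (\<open>anchored_envelope_universal\<close>) it induces an algebra
  homomorphism \<open>\<Phi>\<close>.

  The inverse is constructed only as a linear map.  Let \<open>L a\<close> and \<open>B b\<close> be the classes of the one-vertex contexts
  \<open>(a, 1, \<dots>, 1, \<star>)\<close> and \<open>(\<star>, 1, \<dots>, 1, b)\<close>, and \<open>Sh i\<close> that of the unit context with the hole in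
  position \<open>i\<close>.  The anchors say that \<open>L 1 = B 1 = 1\<close>.  A product of two one-vertex contexts can be rebracketed
  at will, which yields all the relations of the skew group algebra between the \<open>L a\<close>, \<open>B b\<close> and \<open>Sh i\<close>, and
  shows that the class of every context is \<open>L (sp us) \<cdot> B (\<sigma>\<^sup>i\<^sup>+\<^sup>1(sp ws)) \<cdot> Sh (i mod m)\<close>
  (\<open>rho_eq_normal\<close>).  Now \<open>\<Psi>\<close> sends \<open>(a \<otimes> b) g\<^sup>i\<close> to \<open>L a \<cdot> B b \<cdot> Sh i\<close>; it is inverse to \<open>\<Phi>\<close>, since
  \<open>\<Psi> \<circ> \<Phi>\<close> fixes the class of every context by the normal form, and \<open>\<Phi> \<circ> \<Psi>\<close> fixes the elements
  \<open>(a \<otimes> b) g\<^sup>i\<close> by computation (\<open>envelope_iso\<close>).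
\<close>

section \<open>Linear maps and homomorphisms of algebras\<close>

lemma (in abelian_group) eq_if_minus_zero:
  "\<lbrakk>x \<ominus> y = \<zero>; x \<in> carrier G; y \<in> carrier G\<rbrakk> \<Longrightarrow> x = y"
  by (metis a_inv_closed a_minus_def minus_equality minus_minus)

locale linear_map = M: module k M + N: module k N
  for k :: "('k, 'x) ring_scheme" (structure)
    and M :: "('k, 'a, 'y) module_scheme" and N :: "('k, 'b, 'z) module_scheme"
    and h :: "'a \<Rightarrow> 'b" +
  assumes hom_closed: "x \<in> carrier M \<Longrightarrow> h x \<in> carrier N"
    and hom_add: "\<lbrakk>x \<in> carrier M; y \<in> carrier M\<rbrakk> \<Longrightarrow> h (x \<oplus>\<^bsub>M\<^esub> y) = h x \<oplus>\<^bsub>N\<^esub> h y"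
    and hom_smult: "\<lbrakk>r \<in> carrier k; x \<in> carrier M\<rbrakk> \<Longrightarrow> h (r \<odot>\<^bsub>M\<^esub> x) = r \<odot>\<^bsub>N\<^esub> h x"
begin

lemma hom_zero: "h \<zero>\<^bsub>M\<^esub> = \<zero>\<^bsub>N\<^esub>"
proof -
  have "h \<zero>\<^bsub>M\<^esub> = h (\<zero>\<^bsub>k\<^esub> \<odot>\<^bsub>M\<^esub> \<zero>\<^bsub>M\<^esub>)" by simp
  also have "\<dots> = \<zero>\<^bsub>N\<^esub>"
    by (subst hom_smult) (auto simp: hom_closed)
  finally show ?thesis .
qed

lemma hom_uminus: "x \<in> carrier M \<Longrightarrow> h (\<ominus>\<^bsub>M\<^esub> x) = \<ominus>\<^bsub>N\<^esub> h x"
  by (metis M.M.a_inv_closed M.M.l_neg N.M.minus_equality hom_add hom_closed hom_zero)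

lemma hom_minus:
  "\<lbrakk>x \<in> carrier M; y \<in> carrier M\<rbrakk> \<Longrightarrow> h (x \<ominus>\<^bsub>M\<^esub> y) = h x \<ominus>\<^bsub>N\<^esub> h y"
  by (simp add: a_minus_def hom_add hom_uminus)

lemma kernel_submodule: "submodule {x \<in> carrier M. h x = \<zero>\<^bsub>N\<^esub>} k M"
  by (rule M.submoduleI)
    (auto simp: hom_zero hom_uminus hom_add hom_smult)

end

context module
begin

lemma span_submodule:
  assumes "S \<subseteq> carrier M"
  shows "submodule (module_span R M S) R M"
proof (rule submoduleI)
  show "module_span R M S \<subseteq> carrier M"
    unfolding module_span_def using carrier_is_submodule assms by blast
  have z: "\<zero>\<^bsub>M\<^esub> \<in> N" if "submodule N R M" for N
    using submoduleE(2,3,5)[OF that] submoduleE(1)[OF that] 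
    by (metis M.r_neg ex_in_conv subsetD)
  show "\<zero>\<^bsub>M\<^esub> \<in> module_span R M S"
    unfolding module_span_def using z by blast
qed (auto simp: module_span_def intro: submoduleE(3,4,5))

lemma span_superset: "S \<subseteq> module_span R M S"
  unfolding module_span_def by blast

lemma span_minimal: "\<lbrakk>submodule N R M; S \<subseteq> N\<rbrakk> \<Longrightarrow> module_span R M S \<subseteq> N"
  unfolding module_span_def by blast

end

lemma (in linear_map) vanishes_on_span:
  assumes "S \<subseteq> carrier M" "\<And>s. s \<in> S \<Longrightarrow> h s = \<zero>\<^bsub>N\<^esub>" "x \<in> module_span k M S"
  shows "h x = \<zero>\<^bsub>N\<^esub>"
  using M.span_minimal[OF kernel_submodule, of S] assms by blast

lemma (in linear_map) maps_span:
  assumes S: "S \<subseteq> carrier M" and N': "submodule N' k N"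
    and "\<And>s. s \<in> S \<Longrightarrow> h s \<in> N'" and x: "x \<in> module_span k M S"
  shows "h x \<in> N'"
proof -
  have z: "\<zero>\<^bsub>N\<^esub> \<in> N'"
    using N.submoduleE(2,3,5)[OF N'] N.submoduleE(1)[OF N']
    by (metis N.M.r_neg ex_in_conv subsetD)
  have "submodule {x \<in> carrier M. h x \<in> N'} k M"
    by (rule M.submoduleI)
      (auto simp: hom_zero hom_uminus hom_add hom_smult z
         intro: N.submoduleE(3)[OF N'] N.submoduleE(4)[OF N'] N.submoduleE(5)[OF N'])
  from M.span_minimal[OF this, of S] show ?thesis using assms by blast
qed

lemma linear_map_compose:
  assumes "linear_map k A B f" "linear_map k B C g"
  shows "linear_map k A C (\<lambda>x. g (f x))"
proof -
  interpret f: linear_map k A B f by fact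
  interpret g: linear_map k B C g by fact
  show ?thesis
    by unfold_locales
      (simp_all add: f.hom_closed g.hom_closed f.hom_add g.hom_add f.hom_smult g.hom_smult)
qed

lemma (in k_algebra) left_mult_linear:
  "x \<in> carrier A \<Longrightarrow> linear_map k A A (\<lambda>y. x \<otimes>\<^bsub>A\<^esub> y)"
  by unfold_locales (simp_all add: A.r_distr smult_mult_right)

lemma (in k_algebra) right_mult_linear:
  "x \<in> carrier A \<Longrightarrow> linear_map k A A (\<lambda>y. y \<otimes>\<^bsub>A\<^esub> x)"
  by unfold_locales (simp_all add: A.l_distr smult_mult_left)

locale k_algebra_hom = linear_map k A B h + A: k_algebra k A + B: k_algebra k B
  for k :: "('k, 'x) ring_scheme" (structure)
    and A :: "('k, 'a, 'y) module_scheme" and B :: "('k, 'b, 'z) module_scheme"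
    and h :: "'a \<Rightarrow> 'b" +
  assumes hom_mult: "\<lbrakk>x \<in> carrier A; y \<in> carrier A\<rbrakk> \<Longrightarrow> h (x \<otimes>\<^bsub>A\<^esub> y) = h x \<otimes>\<^bsub>B\<^esub> h y"
    and hom_one: "h \<one>\<^bsub>A\<^esub> = \<one>\<^bsub>B\<^esub>"

lemma (in k_algebra_hom) ring_hom: "h \<in> ring_hom A B"
  by (rule ring_hom_memI) (auto simp: hom_closed hom_mult hom_add hom_one)

lemma (in k_algebra) id_hom: "k_algebra_hom k A A (\<lambda>x. x)"
  by unfold_locales auto

lemma alg_iso_hom:
  assumes "k_algebra k A" "k_algebra k B" "h \<in> alg_iso k A B"
  shows "k_algebra_hom k A B h"
proof -
  interpret A: k_algebra k A by fact
  interpret B: k_algebra k B by fact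
  show ?thesis
    using assms(3)
    by unfold_locales (auto simp: alg_iso_def ring_iso_def
        ring_hom_add ring_hom_mult ring_hom_one dest: ring_hom_closed)
qed

lemma k_algebra_hom_compose:
  assumes "k_algebra_hom k A B f" "k_algebra_hom k B C g"
  shows "k_algebra_hom k A C (\<lambda>x. g (f x))"
proof -
  interpret f: k_algebra_hom k A B f by fact
  interpret g: k_algebra_hom k B C g by fact
  interpret linear_map k A C "\<lambda>x. g (f x)"
    by (rule linear_map_compose[OF f.linear_map_axioms g.linear_map_axioms])
  show ?thesis
    by unfold_locales
      (simp_all add: f.hom_closed f.hom_mult g.hom_mult f.hom_one g.hom_one)
qed

lemma k_algebra_hom_funpow:
  assumes "k_algebra_hom k A A f"
  shows "k_algebra_hom k A A (f ^^ n)"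
proof (induction n)
  case 0
  interpret k_algebra_hom k A A f by fact
  show ?case using A.id_hom by (simp add: id_def)
next
  case (Suc n)
  from k_algebra_hom_compose[OF Suc assms] show ?case by (simp add: o_def)
qed

section \<open>Quotient algebras\<close>

lemma ring_cong:
  fixes R :: "('a, 'x) ring_scheme" and S :: "('a, 'y) ring_scheme"
  assumes "ring R" "carrier S = carrier R" "mult S = mult R" "one S = one R"
    "zero S = zero R" "add S = add R"
  shows "ring S"
proof -
  interpret R: ring R by fact
  have "abelian_group S"
  proof (rule abelian_groupI)
    fix x assume x: "x \<in> carrier S"
    then have "\<ominus>\<^bsub>R\<^esub> x \<in> carrier S" "\<ominus>\<^bsub>R\<^esub> x \<oplus>\<^bsub>S\<^esub> x = \<zero>\<^bsub>S\<^esub>"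
      using assms(2-) by (simp_all add: R.l_neg)
    then show "\<exists>y\<in>carrier S. y \<oplus>\<^bsub>S\<^esub> x = \<zero>\<^bsub>S\<^esub>" by blast
  qed (use assms(2-) in \<open>simp_all add: R.a_ac\<close>)
  moreover have "Group.monoid S"
    by (rule monoidI) (use assms(2-) in \<open>simp_all add: R.m_assoc\<close>)
  ultimately show ?thesis
    by (rule ringI) (use assms(2-) in \<open>simp_all add: R.l_distr R.r_distr\<close>)
qed

text \<open>
  A two-sided ideal of a unital algebra is stable under scalars, because a scalar \<open>r\<close> acts as
  multiplication by \<open>r \<cdot> 1\<close>.  So ring ideals are enough to form quotient algebras.
\<close>

locale algebra_ideal = k_algebra k F + ideal N F
  for k :: "('k, 'x) ring_scheme" (structure) and F :: "('k, 'a, 'y) module_scheme" and N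
begin

abbreviation "Q \<equiv> quotient_algebra F N"
abbreviation "proj \<equiv> (\<lambda>x. N +>\<^bsub>F\<^esub> x)"

lemma quotient_carrier: "carrier Q = proj ` carrier F"
  by (auto simp: quotient_algebra_def FactRing_def A_RCOSETS_def RCOSETS_def a_r_coset_def)

lemma ideal_smult: "\<lbrakk>r \<in> carrier k; x \<in> N\<rbrakk> \<Longrightarrow> r \<odot>\<^bsub>F\<^esub> x \<in> N"
  using I_l_closed[of x "r \<odot>\<^bsub>F\<^esub> \<one>\<^bsub>F\<^esub>"] a_subset
  by (metis A.l_one A.one_closed a_Hcarr smult_closed smult_mult_left)

lemma proj_smult:
  assumes "r \<in> carrier k" "x \<in> carrier F"
  shows "proj (r \<odot>\<^bsub>F\<^esub> x) = r \<odot>\<^bsub>Q\<^esub> proj x"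
proof -
  have "proj (r \<odot>\<^bsub>F\<^esub> y) = proj (r \<odot>\<^bsub>F\<^esub> x)" if "y \<in> proj x" for y
  proof -
    from that obtain n where n: "n \<in> N" "y = n \<oplus>\<^bsub>F\<^esub> x"
      by (auto simp: a_r_coset_def')
    have nc: "n \<in> carrier F" using n a_Hcarr by blast
    have "r \<odot>\<^bsub>F\<^esub> y = r \<odot>\<^bsub>F\<^esub> n \<oplus>\<^bsub>F\<^esub> r \<odot>\<^bsub>F\<^esub> x"
      using n nc assms by (simp add: smult_r_distr)
    then have "r \<odot>\<^bsub>F\<^esub> y \<in> proj (r \<odot>\<^bsub>F\<^esub> x)"
      using ideal_smult[OF assms(1) n(1)] by (auto simp: a_r_coset_def')
    then show ?thesis
      using a_repr_independence'[OF _ smult_closed[OF assms], symmetric] by blast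
  qed
  moreover have "x \<in> proj x" using assms(2) by (rule a_rcos_self)
  ultimately have "(\<Union>y\<in>proj x. proj (r \<odot>\<^bsub>F\<^esub> y)) = proj (r \<odot>\<^bsub>F\<^esub> x)" by blast
  then show ?thesis by (simp add: quotient_algebra_def)
qed

lemma quotient_ring: "ring Q"
  by (rule ring_cong[OF quotient_is_ring]) (simp_all add: quotient_algebra_def)

lemma proj_closed: "x \<in> carrier F \<Longrightarrow> proj x \<in> carrier Q"
  by (simp add: quotient_carrier)

lemma proj_add:
  "\<lbrakk>x \<in> carrier F; y \<in> carrier F\<rbrakk> \<Longrightarrow> proj (x \<oplus>\<^bsub>F\<^esub> y) = proj x \<oplus>\<^bsub>Q\<^esub> proj y"
  using ring_hom_add[OF rcos_ring_hom, of x y] by (simp add: quotient_algebra_def)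

lemma proj_mult:
  "\<lbrakk>x \<in> carrier F; y \<in> carrier F\<rbrakk> \<Longrightarrow> proj (x \<otimes>\<^bsub>F\<^esub> y) = proj x \<otimes>\<^bsub>Q\<^esub> proj y"
  using ring_hom_mult[OF rcos_ring_hom, of x y] by (simp add: quotient_algebra_def)

lemma proj_one: "proj \<one>\<^bsub>F\<^esub> = \<one>\<^bsub>Q\<^esub>"
  using ring_hom_one[OF rcos_ring_hom] by (simp add: quotient_algebra_def)

lemma quotient_zero: "\<zero>\<^bsub>Q\<^esub> = N"
  by (simp add: quotient_algebra_def FactRing_def)

lemma proj_eq_zero: "x \<in> N \<Longrightarrow> proj x = \<zero>\<^bsub>Q\<^esub>"
  by (simp add: quotient_zero a_rcos_const)

lemma quotient_k_algebra: "k_algebra k Q"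
proof -
  interpret Q: ring Q by (rule quotient_ring)
  show ?thesis
  proof (intro k_algebra.intro k_algebra_axioms.intro moduleI quotient_ring)
    show "cring k" ..
    show "abelian_group Q" ..
  qed (auto simp: quotient_carrier smult_mult_left proj_smult[symmetric] proj_add[symmetric]
      proj_mult[symmetric] smult_l_distr smult_r_distr smult_assoc1 simp flip: smult_mult_right)
qed

lemma proj_hom: "k_algebra_hom k F Q proj"
proof -
  interpret Q: k_algebra k Q by (rule quotient_k_algebra)
  show ?thesis
    by unfold_locales (simp_all add: proj_closed proj_add proj_mult proj_one proj_smult)
qed

text \<open>
  A map that vanishes on the ideal is constant on each coset; \<open>the_elem\<close> extracts the constant.  This
  is the form in which \<open>tensor_map\<close> is defined.
\<close>

lemma lift_proj:
  assumes "linear_map k F M h" "\<And>x. x \<in> N \<Longrightarrow> h x = \<zero>\<^bsub>M\<^esub>" "x \<in> carrier F"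
  shows "the_elem (h ` proj x) = h x"
proof -
  interpret h: linear_map k F M h by fact
  have "h y = h x" if "y \<in> proj x" for y
  proof -
    from that obtain n where n: "n \<in> N" "y = n \<oplus>\<^bsub>F\<^esub> x"
      by (auto simp: a_r_coset_def')
    then show ?thesis using assms(2)[of n] assms(3) a_Hcarr[of n]
      by (simp add: h.hom_add h.hom_closed)
  qed
  moreover have "x \<in> proj x" using assms(3) by (rule a_rcos_self)
  ultimately have "h ` proj x = {h x}" by blast
  then show ?thesis by simp
qed

lemma lift_linear:
  assumes h: "linear_map k F M h" "\<And>x. x \<in> N \<Longrightarrow> h x = \<zero>\<^bsub>M\<^esub>"
  shows "linear_map k Q M (\<lambda>Y. the_elem (h ` Y))"
proof -
  interpret h: linear_map k F M h by fact
  interpret Q: k_algebra k Q by (rule quotient_k_algebra)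
  show ?thesis
  proof unfold_locales
    fix X Y assume "X \<in> carrier Q" "Y \<in> carrier Q"
    then obtain x y where xy: "X = proj x" "x \<in> carrier F" "Y = proj y" "y \<in> carrier F"
      by (auto simp: quotient_carrier)
    show "the_elem (h ` (X \<oplus>\<^bsub>Q\<^esub> Y)) = the_elem (h ` X) \<oplus>\<^bsub>M\<^esub> the_elem (h ` Y)"
      using lift_proj[OF h, of x] lift_proj[OF h, of y] lift_proj[OF h, of "x \<oplus>\<^bsub>F\<^esub> y"] xy
      by (simp add: proj_add h.hom_add)
  next
    fix X assume "X \<in> carrier Q"
    then obtain x where x: "X = proj x" "x \<in> carrier F"
      by (auto simp: quotient_carrier)
    show "the_elem (h ` X) \<in> carrier M"
      using lift_proj[OF h, of x] x by (simp add: h.hom_closed)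
    show "the_elem (h ` (r \<odot>\<^bsub>Q\<^esub> X)) = r \<odot>\<^bsub>M\<^esub> the_elem (h ` X)" if "r \<in> carrier k" for r
      using lift_proj[OF h, of x] lift_proj[OF h, of "r \<odot>\<^bsub>F\<^esub> x"] x that
      by (simp add: proj_smult h.hom_smult)
  qed
qed

lemma lift_hom:
  assumes h: "k_algebra_hom k F B h" "\<And>x. x \<in> N \<Longrightarrow> h x = \<zero>\<^bsub>B\<^esub>"
  shows "k_algebra_hom k Q B (\<lambda>Y. the_elem (h ` Y))"
proof -
  interpret h: k_algebra_hom k F B h by fact
  interpret Q: k_algebra k Q by (rule quotient_k_algebra)
  note lift = lift_proj[OF h.linear_map_axioms h(2)]
  interpret l: linear_map k Q B "\<lambda>Y. the_elem (h ` Y)"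
    by (rule lift_linear[OF h.linear_map_axioms h(2)])
  show ?thesis
  proof unfold_locales
    show "the_elem (h ` (x \<otimes>\<^bsub>Q\<^esub> y)) = the_elem (h ` x) \<otimes>\<^bsub>B\<^esub> the_elem (h ` y)"
      if "x \<in> carrier Q" "y \<in> carrier Q" for x y
    proof -
      from that obtain a b where ab: "x = proj a" "a \<in> carrier F" "y = proj b" "b \<in> carrier F"
        by (auto simp: quotient_carrier)
      show ?thesis
        using lift[of a] lift[of b] lift[of "a \<otimes>\<^bsub>F\<^esub> b"] ab by (simp add: proj_mult h.hom_mult)
    qed
    show "the_elem (h ` \<one>\<^bsub>Q\<^esub>) = \<one>\<^bsub>B\<^esub>"
      using lift[of "\<one>\<^bsub>F\<^esub>"] by (simp add: proj_one h.hom_one)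
  qed
qed

end

section \<open>Skew group algebras\<close>

text \<open>The formal sum with the one term \<open>b \<cdot> g\<close>.\<close>

definition single :: "('k, 'b, 'y) module_scheme \<Rightarrow> 'g \<Rightarrow> 'b \<Rightarrow> 'g \<Rightarrow> 'b"
  where "single B g b = (\<lambda>x. if x = g then b else \<zero>\<^bsub>B\<^esub>)"

text \<open>
  A monoid acting by algebra endomorphisms.  With the trivial action on the ground ring this covers
  monoid algebras, with a cyclic group it covers the skew group algebra of the theorem.
\<close>

locale skew_action = B: k_algebra k B + G: Group.monoid G
  for k :: "('k, 'x) ring_scheme" (structure) and B :: "('k, 'b, 'y) module_scheme"
    and G :: "('g, 'z) monoid_scheme" and act :: "'g \<Rightarrow> 'b \<Rightarrow> 'b" +
  assumes act_hom: "g \<in> carrier G \<Longrightarrow> k_algebra_hom k B B (act g)"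
    and act_one: "b \<in> carrier B \<Longrightarrow> act \<one>\<^bsub>G\<^esub> b = b"
    and act_mult: "\<lbrakk>g \<in> carrier G; h \<in> carrier G; b \<in> carrier B\<rbrakk>
      \<Longrightarrow> act (g \<otimes>\<^bsub>G\<^esub> h) b = act g (act h b)"
begin

abbreviation "S \<equiv> skew_algebra B G act"
abbreviation "supp f \<equiv> {x. f x \<noteq> \<zero>\<^bsub>B\<^esub>}"

lemma act_simps:
  assumes "g \<in> carrier G"
  shows "b \<in> carrier B \<Longrightarrow> act g b \<in> carrier B"
    and "\<lbrakk>b \<in> carrier B; b' \<in> carrier B\<rbrakk> \<Longrightarrow> act g (b \<oplus>\<^bsub>B\<^esub> b') = act g b \<oplus>\<^bsub>B\<^esub> act g b'"
    and "\<lbrakk>b \<in> carrier B; b' \<in> carrier B\<rbrakk> \<Longrightarrow> act g (b \<otimes>\<^bsub>B\<^esub> b') = act g b \<otimes>\<^bsub>B\<^esub> act g b'"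
    and "\<lbrakk>r \<in> carrier k; b \<in> carrier B\<rbrakk> \<Longrightarrow> act g (r \<odot>\<^bsub>B\<^esub> b) = r \<odot>\<^bsub>B\<^esub> act g b"
    and "act g \<zero>\<^bsub>B\<^esub> = \<zero>\<^bsub>B\<^esub>" and "act g \<one>\<^bsub>B\<^esub> = \<one>\<^bsub>B\<^esub>"
proof -
  interpret k_algebra_hom k B B "act g" using assms by (rule act_hom)
  show "b \<in> carrier B \<Longrightarrow> act g b \<in> carrier B"
    and "\<lbrakk>b \<in> carrier B; b' \<in> carrier B\<rbrakk> \<Longrightarrow> act g (b \<oplus>\<^bsub>B\<^esub> b') = act g b \<oplus>\<^bsub>B\<^esub> act g b'"
    and "\<lbrakk>b \<in> carrier B; b' \<in> carrier B\<rbrakk> \<Longrightarrow> act g (b \<otimes>\<^bsub>B\<^esub> b') = act g b \<otimes>\<^bsub>B\<^esub> act g b'"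
    and "\<lbrakk>r \<in> carrier k; b \<in> carrier B\<rbrakk> \<Longrightarrow> act g (r \<odot>\<^bsub>B\<^esub> b) = r \<odot>\<^bsub>B\<^esub> act g b"
    and "act g \<zero>\<^bsub>B\<^esub> = \<zero>\<^bsub>B\<^esub>" and "act g \<one>\<^bsub>B\<^esub> = \<one>\<^bsub>B\<^esub>"
    by (fact hom_closed hom_add hom_mult hom_smult hom_zero hom_one)+
qed

lemma carrier_iff:
  "f \<in> carrier S \<longleftrightarrow> (\<forall>x. f x \<in> carrier B) \<and> supp f \<subseteq> carrier G \<and> finite (supp f)"
  by (auto simp: skew_algebra_def)

lemma carrierD:
  assumes "f \<in> carrier S"
  shows "f x \<in> carrier B" "supp f \<subseteq> carrier G" "finite (supp f)"
  using assms by (simp_all add: carrier_iff)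

lemma carrierI:
  assumes "\<And>x. f x \<in> carrier B" "\<And>x. f x \<noteq> \<zero>\<^bsub>B\<^esub> \<Longrightarrow> x \<in> X" "finite X" "X \<subseteq> carrier G"
  shows "f \<in> carrier S"
proof -
  have "supp f \<subseteq> X" using assms(2) by blast
  then show ?thesis using assms by (auto simp: carrier_iff intro: finite_subset)
qed

lemma skew_simps:
  "\<zero>\<^bsub>S\<^esub> = (\<lambda>x. \<zero>\<^bsub>B\<^esub>)" "f \<oplus>\<^bsub>S\<^esub> g = (\<lambda>x. f x \<oplus>\<^bsub>B\<^esub> g x)" "r \<odot>\<^bsub>S\<^esub> f = (\<lambda>x. r \<odot>\<^bsub>B\<^esub> f x)"
  "\<one>\<^bsub>S\<^esub> = single B \<one>\<^bsub>G\<^esub> \<one>\<^bsub>B\<^esub>"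
  by (simp_all add: skew_algebra_def single_def)

lemma single_closed: "\<lbrakk>g \<in> carrier G; b \<in> carrier B\<rbrakk> \<Longrightarrow> single B g b \<in> carrier S"
  by (rule carrierI[of _ "{g}"]) (auto simp: single_def split: if_splits)

lemma zero_closed: "\<zero>\<^bsub>S\<^esub> \<in> carrier S"
  by (simp add: carrier_iff skew_simps)

lemma add_closed: "\<lbrakk>f \<in> carrier S; g \<in> carrier S\<rbrakk> \<Longrightarrow> f \<oplus>\<^bsub>S\<^esub> g \<in> carrier S"
  by (rule carrierI[of _ "supp f \<union> supp g"]) (auto simp: skew_simps carrierD dest: carrierD)

lemma smult_closed: "\<lbrakk>r \<in> carrier k; f \<in> carrier S\<rbrakk> \<Longrightarrow> r \<odot>\<^bsub>S\<^esub> f \<in> carrier S"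
  by (rule carrierI[of _ "supp f"]) (auto simp: skew_simps carrierD dest: carrierD)

lemma module_S: "module k S"
proof (rule moduleI)
  show "abelian_group S"
  proof (rule abelian_groupI)
    fix f assume f: "f \<in> carrier S"
    have "(\<lambda>x. \<ominus>\<^bsub>B\<^esub> f x) \<in> carrier S"
      by (rule carrierI[of _ "supp f"]) (use f in \<open>auto simp: carrierD dest: carrierD\<close>)
    moreover have "(\<lambda>x. \<ominus>\<^bsub>B\<^esub> f x) \<oplus>\<^bsub>S\<^esub> f = \<zero>\<^bsub>S\<^esub>"
      using f by (simp add: skew_simps carrierD B.M.l_neg)
    ultimately show "\<exists>g\<in>carrier S. g \<oplus>\<^bsub>S\<^esub> f = \<zero>\<^bsub>S\<^esub>" by blast
  qed (auto simp: zero_closed add_closed, auto simp: skew_simps carrierD B.M.a_ac)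
  show "cring k" ..
qed (auto simp: smult_closed, auto simp: skew_simps carrierD B.smult_l_distr B.smult_r_distr B.smult_assoc1)

text \<open>
  The defining sum runs over the supports, which change under addition.  Over fixed finite sets that
  contain the supports in question, biadditivity can be read off term by term.
\<close>

lemma mult_eval:
  assumes f: "f \<in> carrier S" and g: "g \<in> carrier S"
    and X: "finite X" "supp f \<subseteq> X" "X \<subseteq> carrier G"
    and Y: "finite Y" "supp g \<subseteq> Y" "Y \<subseteq> carrier G"
  shows "(f \<otimes>\<^bsub>S\<^esub> g) z = (\<Oplus>\<^bsub>B\<^esub>p\<in>{p \<in> X \<times> Y. fst p \<otimes>\<^bsub>G\<^esub> snd p = z}.
    f (fst p) \<otimes>\<^bsub>B\<^esub> act (fst p) (g (snd p)))"
proof -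
  let ?t = "\<lambda>p. f (fst p) \<otimes>\<^bsub>B\<^esub> act (fst p) (g (snd p))"
  have "(f \<otimes>\<^bsub>S\<^esub> g) z = (\<Oplus>\<^bsub>B\<^esub>p\<in>{p \<in> supp f \<times> supp g. fst p \<otimes>\<^bsub>G\<^esub> snd p = z}. ?t p)"
    by (simp add: skew_algebra_def)
  also have "\<dots> = (\<Oplus>\<^bsub>B\<^esub>p\<in>{p \<in> X \<times> Y. fst p \<otimes>\<^bsub>G\<^esub> snd p = z}. ?t p)"
  proof (rule B.M.add.finprod_mono_neutral_cong_left)
    show "finite {p \<in> X \<times> Y. fst p \<otimes>\<^bsub>G\<^esub> snd p = z}" using X Y by simp
    show "?t \<in> {p \<in> X \<times> Y. fst p \<otimes>\<^bsub>G\<^esub> snd p = z} \<rightarrow> carrier B"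
      using X(3) by (auto simp: carrierD[OF f] carrierD[OF g] intro!: B.A.m_closed act_simps(1))
    fix p
    assume p: "p \<in> {p \<in> X \<times> Y. fst p \<otimes>\<^bsub>G\<^esub> snd p = z} - {p \<in> supp f \<times> supp g. fst p \<otimes>\<^bsub>G\<^esub> snd p = z}"
    then have "fst p \<in> carrier G" "f (fst p) = \<zero>\<^bsub>B\<^esub> \<or> g (snd p) = \<zero>\<^bsub>B\<^esub>" using X(3) by auto
    then show "?t p = \<zero>\<^bsub>B\<^esub>"
      by (auto simp: act_simps carrierD[OF f] carrierD[OF g])
  qed (use X Y in auto)
  finally show ?thesis .
qed

lemma term_closed:
  assumes "f \<in> carrier S" "g \<in> carrier S" "X \<subseteq> carrier G"
  shows "(\<lambda>p. f (fst p) \<otimes>\<^bsub>B\<^esub> act (fst p) (g (snd p))) \<in> {p \<in> X \<times> Y. fst p \<otimes>\<^bsub>G\<^esub> snd p = z} \<rightarrow> carrier B"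
  using assms(3) by (auto simp: carrierD[OF assms(1)] carrierD[OF assms(2)] intro!: B.A.m_closed act_simps(1))

lemma mult_closed:
  assumes f: "f \<in> carrier S" and g: "g \<in> carrier S"
  shows "f \<otimes>\<^bsub>S\<^esub> g \<in> carrier S"
proof (rule carrierI[of _ "(\<lambda>p. fst p \<otimes>\<^bsub>G\<^esub> snd p) ` (supp f \<times> supp g)"])
  note D = carrierD[OF f] carrierD[OF g]
  note eval = mult_eval[OF f g D(3) subset_refl D(2) D(6) subset_refl D(5)]
  show "(f \<otimes>\<^bsub>S\<^esub> g) x \<in> carrier B" for x
    unfolding eval by (rule B.M.finsum_closed[OF term_closed[OF f g D(2)]])
  show "x \<in> (\<lambda>p. fst p \<otimes>\<^bsub>G\<^esub> snd p) ` (supp f \<times> supp g)" if "(f \<otimes>\<^bsub>S\<^esub> g) x \<noteq> \<zero>\<^bsub>B\<^esub>" for x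
  proof (rule ccontr)
    assume "x \<notin> (\<lambda>p. fst p \<otimes>\<^bsub>G\<^esub> snd p) ` (supp f \<times> supp g)"
    then have "{p \<in> supp f \<times> supp g. fst p \<otimes>\<^bsub>G\<^esub> snd p = x} = {}" by blast
    then show False using that by (metis (lifting) eval B.M.finsum_empty)
  qed
  show "finite ((\<lambda>p. fst p \<otimes>\<^bsub>G\<^esub> snd p) ` (supp f \<times> supp g))" using D by simp
  show "(\<lambda>p. fst p \<otimes>\<^bsub>G\<^esub> snd p) ` (supp f \<times> supp g) \<subseteq> carrier G" using D(2,5) by (auto intro!: G.m_closed)
qed

lemma mult_add_left:
  assumes f: "f \<in> carrier S" and f': "f' \<in> carrier S" and g: "g \<in> carrier S"
  shows "(f \<oplus>\<^bsub>S\<^esub> f') \<otimes>\<^bsub>S\<^esub> g = f \<otimes>\<^bsub>S\<^esub> g \<oplus>\<^bsub>S\<^esub> f' \<otimes>\<^bsub>S\<^esub> g"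
proof
  fix z
  let ?X = "supp f \<union> supp f'"
  note D = carrierD[OF f] carrierD[OF f'] carrierD[OF g]
  have X: "finite ?X" "?X \<subseteq> carrier G" using D by auto
  have s: "supp (f \<oplus>\<^bsub>S\<^esub> f') \<subseteq> ?X" by (auto simp: skew_simps)
  show "((f \<oplus>\<^bsub>S\<^esub> f') \<otimes>\<^bsub>S\<^esub> g) z = (f \<otimes>\<^bsub>S\<^esub> g \<oplus>\<^bsub>S\<^esub> f' \<otimes>\<^bsub>S\<^esub> g) z"
    unfolding skew_simps(2)[of "f \<otimes>\<^bsub>S\<^esub> g"]
    apply (subst mult_eval[OF add_closed[OF f f'] g X(1) s X(2) D(9) subset_refl D(8)])
    apply (subst mult_eval[OF f g X(1) _ X(2) D(9) subset_refl D(8)], blast)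
    apply (subst mult_eval[OF f' g X(1) _ X(2) D(9) subset_refl D(8)], blast)
    apply (subst B.M.finsum_addf[symmetric, OF term_closed[OF f g X(2)] term_closed[OF f' g X(2)]])
    apply (rule B.M.finsum_cong')
    using X(2) D by (auto simp: skew_simps act_simps B.A.l_distr intro!: B.A.m_closed B.M.a_closed act_simps(1))
qed

lemma mult_add_right:
  assumes f: "f \<in> carrier S" and g: "g \<in> carrier S" and g': "g' \<in> carrier S"
  shows "f \<otimes>\<^bsub>S\<^esub> (g \<oplus>\<^bsub>S\<^esub> g') = f \<otimes>\<^bsub>S\<^esub> g \<oplus>\<^bsub>S\<^esub> f \<otimes>\<^bsub>S\<^esub> g'"
proof
  fix z
  let ?Y = "supp g \<union> supp g'"
  note D = carrierD[OF f] carrierD[OF g] carrierD[OF g']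
  have Y: "finite ?Y" "?Y \<subseteq> carrier G" using D by auto
  have s: "supp (g \<oplus>\<^bsub>S\<^esub> g') \<subseteq> ?Y" by (auto simp: skew_simps)
  show "(f \<otimes>\<^bsub>S\<^esub> (g \<oplus>\<^bsub>S\<^esub> g')) z = (f \<otimes>\<^bsub>S\<^esub> g \<oplus>\<^bsub>S\<^esub> f \<otimes>\<^bsub>S\<^esub> g') z"
    unfolding skew_simps(2)[of "f \<otimes>\<^bsub>S\<^esub> g"]
    apply (subst mult_eval[OF f add_closed[OF g g'] D(3) subset_refl D(2) Y(1) s Y(2)])
    apply (subst mult_eval[OF f g D(3) subset_refl D(2) Y(1) _ Y(2)], blast)
    apply (subst mult_eval[OF f g' D(3) subset_refl D(2) Y(1) _ Y(2)], blast)
    apply (subst B.M.finsum_addf[symmetric, OF term_closed[OF f g D(2)] term_closed[OF f g' D(2)]])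
    apply (rule B.M.finsum_cong')
    using D by (auto simp: skew_simps act_simps B.A.r_distr intro!: B.A.m_closed B.M.a_closed act_simps(1))
qed

lemma smult_mult_left:
  assumes r: "r \<in> carrier k" and f: "f \<in> carrier S" and g: "g \<in> carrier S"
  shows "r \<odot>\<^bsub>S\<^esub> (f \<otimes>\<^bsub>S\<^esub> g) = (r \<odot>\<^bsub>S\<^esub> f) \<otimes>\<^bsub>S\<^esub> g"
proof
  fix z
  note D = carrierD[OF f] carrierD[OF g]
  have s: "supp (r \<odot>\<^bsub>S\<^esub> f) \<subseteq> supp f" using r by (auto simp: skew_simps)
  have fin: "finite {p \<in> supp f \<times> supp g. fst p \<otimes>\<^bsub>G\<^esub> snd p = z}" using D by simp
  show "(r \<odot>\<^bsub>S\<^esub> (f \<otimes>\<^bsub>S\<^esub> g)) z = ((r \<odot>\<^bsub>S\<^esub> f) \<otimes>\<^bsub>S\<^esub> g) z"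
    unfolding skew_simps(3)[of r "f \<otimes>\<^bsub>S\<^esub> g"]
    apply (subst mult_eval[OF f g D(3) subset_refl D(2) D(6) subset_refl D(5)])
    apply (subst mult_eval[OF smult_closed[OF r f] g D(3) s D(2) D(6) subset_refl D(5)])
    apply (subst B.finsum_smult_ldistr[OF fin r term_closed[OF f g D(2)]])
    apply (rule B.M.finsum_cong')
    using D r by (auto simp: skew_simps act_simps B.smult_mult_left intro!: B.A.m_closed act_simps(1) B.smult_closed)
qed

lemma smult_mult_right:
  assumes r: "r \<in> carrier k" and f: "f \<in> carrier S" and g: "g \<in> carrier S"
  shows "r \<odot>\<^bsub>S\<^esub> (f \<otimes>\<^bsub>S\<^esub> g) = f \<otimes>\<^bsub>S\<^esub> (r \<odot>\<^bsub>S\<^esub> g)"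
proof
  fix z
  note D = carrierD[OF f] carrierD[OF g]
  have s: "supp (r \<odot>\<^bsub>S\<^esub> g) \<subseteq> supp g" using r by (auto simp: skew_simps)
  have fin: "finite {p \<in> supp f \<times> supp g. fst p \<otimes>\<^bsub>G\<^esub> snd p = z}" using D by simp
  show "(r \<odot>\<^bsub>S\<^esub> (f \<otimes>\<^bsub>S\<^esub> g)) z = (f \<otimes>\<^bsub>S\<^esub> (r \<odot>\<^bsub>S\<^esub> g)) z"
    unfolding skew_simps(3)[of r "f \<otimes>\<^bsub>S\<^esub> g"]
    apply (subst mult_eval[OF f g D(3) subset_refl D(2) D(6) subset_refl D(5)])
    apply (subst mult_eval[OF f smult_closed[OF r g] D(3) subset_refl D(2) D(6) s D(5)])
    apply (subst B.finsum_smult_ldistr[OF fin r term_closed[OF f g D(2)]])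
    apply (rule B.M.finsum_cong')
    using D r by (auto simp: skew_simps act_simps B.smult_mult_right intro!: B.A.m_closed act_simps(1) B.smult_closed)
qed

lemma single_mult:
  assumes g: "g \<in> carrier G" and h: "h \<in> carrier G" and b: "b \<in> carrier B" and c: "c \<in> carrier B"
  shows "single B g b \<otimes>\<^bsub>S\<^esub> single B h c = single B (g \<otimes>\<^bsub>G\<^esub> h) (b \<otimes>\<^bsub>B\<^esub> act g c)"
proof
  fix z
  have "(single B g b \<otimes>\<^bsub>S\<^esub> single B h c) z = (\<Oplus>\<^bsub>B\<^esub>p\<in>{p \<in> {g} \<times> {h}. fst p \<otimes>\<^bsub>G\<^esub> snd p = z}.
    single B g b (fst p) \<otimes>\<^bsub>B\<^esub> act (fst p) (single B h c (snd p)))"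
    by (rule mult_eval) (use assms single_closed in \<open>auto simp: single_def split: if_splits\<close>)
  also have "{p \<in> {g} \<times> {h}. fst p \<otimes>\<^bsub>G\<^esub> snd p = z} = (if g \<otimes>\<^bsub>G\<^esub> h = z then {(g, h)} else {})" by auto
  finally show "(single B g b \<otimes>\<^bsub>S\<^esub> single B h c) z = single B (g \<otimes>\<^bsub>G\<^esub> h) (b \<otimes>\<^bsub>B\<^esub> act g c) z"
    using assms by (auto simp: single_def act_simps)
qed

text \<open>
  Every element is a finite sum of one-term elements.  Since multiplication is biadditive, the algebra
  laws reduce to one-term elements, where they are those of \<open>B\<close>, \<open>G\<close> and the action.
\<close>

lemma skew_induct [consumes 1, case_names zero add]:
  assumes f: "f \<in> carrier S"
    and zero: "P \<zero>\<^bsub>S\<^esub>"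
    and add: "\<And>g b f. \<lbrakk>g \<in> carrier G; b \<in> carrier B; f \<in> carrier S; P f\<rbrakk> \<Longrightarrow> P (single B g b \<oplus>\<^bsub>S\<^esub> f)"
  shows "P f"
proof -
  have "P f" if "finite X" "f \<in> carrier S" "supp f = X" for X f
    using that
  proof (induction X arbitrary: f rule: finite_induct)
    case empty
    then have "f = \<zero>\<^bsub>S\<^esub>" by (auto simp: skew_simps)
    then show ?case using zero by simp
  next
    case (insert g X)
    let ?f = "f(g := \<zero>\<^bsub>B\<^esub>)"
    have "supp ?f = X" using insert by auto
    moreover have "X \<subseteq> carrier G" using insert.prems carrierD(2)[OF insert.prems(1)] by blast
    ultimately have f': "?f \<in> carrier S" "supp ?f = X"
      using insert.hyps insert.prems by (auto simp: carrier_iff)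
    have "g \<in> carrier G" using insert.prems carrierD(2)[OF insert.prems(1)] by blast
    then have "P (single B g (f g) \<oplus>\<^bsub>S\<^esub> ?f)"
      by (rule add[OF _ carrierD(1)[OF insert.prems(1)] f'(1) insert.IH[OF f']])
    moreover have "single B g (f g) \<oplus>\<^bsub>S\<^esub> ?f = f"
      using carrierD(1)[OF insert.prems(1)] by (auto simp: skew_simps single_def)
    ultimately show ?case by simp
  qed
  from this[OF carrierD(3)[OF f] f refl] show ?thesis .
qed

lemma mult_zero:
  "\<zero>\<^bsub>S\<^esub> \<otimes>\<^bsub>S\<^esub> f = \<zero>\<^bsub>S\<^esub>" "f \<otimes>\<^bsub>S\<^esub> \<zero>\<^bsub>S\<^esub> = \<zero>\<^bsub>S\<^esub>"
  by (simp_all add: skew_algebra_def)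

lemma mult_assoc:
  assumes f: "f \<in> carrier S" and g: "g \<in> carrier S" and h: "h \<in> carrier S"
  shows "f \<otimes>\<^bsub>S\<^esub> g \<otimes>\<^bsub>S\<^esub> h = f \<otimes>\<^bsub>S\<^esub> (g \<otimes>\<^bsub>S\<^esub> h)"
  using f
proof (induction rule: skew_induct)
  case zero
  show ?case using g h by (simp add: mult_zero mult_closed)
next
  case (add x b f)
  have "single B x b \<otimes>\<^bsub>S\<^esub> g \<otimes>\<^bsub>S\<^esub> h = single B x b \<otimes>\<^bsub>S\<^esub> (g \<otimes>\<^bsub>S\<^esub> h)"
    using g
  proof (induction rule: skew_induct)
    case zero
    show ?case using h add by (simp add: mult_zero mult_closed single_closed)
  next
    case (add y c g)
    have "single B x b \<otimes>\<^bsub>S\<^esub> single B y c \<otimes>\<^bsub>S\<^esub> h = single B x b \<otimes>\<^bsub>S\<^esub> (single B y c \<otimes>\<^bsub>S\<^esub> h)"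
      using h
    proof (induction rule: skew_induct)
      case zero
      show ?case using add \<open>x \<in> carrier G\<close> \<open>b \<in> carrier B\<close>
        by (simp add: mult_zero mult_closed single_closed)
    next
      case (add z d h)
      then show ?case using \<open>x \<in> carrier G\<close> \<open>b \<in> carrier B\<close> \<open>y \<in> carrier G\<close> \<open>c \<in> carrier B\<close>
        by (simp add: mult_add_right mult_closed single_closed single_mult G.m_assoc B.A.m_assoc
            act_simps act_mult)
    qed
    then show ?case using add h \<open>x \<in> carrier G\<close> \<open>b \<in> carrier B\<close>
      by (simp add: mult_add_right mult_add_left mult_closed single_closed)
  qed
  then show ?case using add g h
    by (simp add: mult_add_left mult_closed single_closed)
qed

lemma one_closed: "\<one>\<^bsub>S\<^esub> \<in> carrier S"
  by (simp add: skew_simps single_closed)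

lemma mult_one:
  assumes f: "f \<in> carrier S"
  shows "\<one>\<^bsub>S\<^esub> \<otimes>\<^bsub>S\<^esub> f = f" "f \<otimes>\<^bsub>S\<^esub> \<one>\<^bsub>S\<^esub> = f"
proof -
  show "\<one>\<^bsub>S\<^esub> \<otimes>\<^bsub>S\<^esub> f = f" using f
  proof (induction rule: skew_induct)
    case zero
    show ?case by (simp add: mult_zero one_closed)
  next
    case (add g b f)
    have "\<one>\<^bsub>S\<^esub> \<otimes>\<^bsub>S\<^esub> single B g b = single B g b"
      unfolding skew_simps(4) using add by (simp add: single_mult act_one)
    with add show ?case by (simp add: mult_add_right single_closed one_closed)
  qed
  show "f \<otimes>\<^bsub>S\<^esub> \<one>\<^bsub>S\<^esub> = f" using f
  proof (induction rule: skew_induct)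
    case zero
    show ?case by (simp add: mult_zero one_closed)
  next
    case (add g b f)
    have "single B g b \<otimes>\<^bsub>S\<^esub> \<one>\<^bsub>S\<^esub> = single B g b"
      unfolding skew_simps(4) using add by (simp add: single_mult act_simps)
    with add show ?case by (simp add: mult_add_left single_closed one_closed)
  qed
qed

theorem skew_k_algebra: "k_algebra k S"
proof -
  interpret S: module k S by (rule module_S)
  have "Group.monoid S"
    by (rule monoidI) (simp_all add: mult_closed mult_assoc one_closed mult_one)
  then have "ring S"
    by (rule ringI[OF S.abelian_group_axioms]) (simp_all add: mult_add_left mult_add_right)
  then show ?thesis
    by (intro k_algebra.intro module_S k_algebra_axioms.intro smult_mult_left smult_mult_right)
qed

end

lemma (in skew_action) linear_eqI:
  assumes "linear_map k S M h" "linear_map k S M h'"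
    and "\<And>g b. \<lbrakk>g \<in> carrier G; b \<in> carrier B\<rbrakk> \<Longrightarrow> h (single B g b) = h' (single B g b)"
    and "f \<in> carrier S"
  shows "h f = h' f"
proof -
  interpret h: linear_map k S M h by fact
  interpret h': linear_map k S M h' by fact
  show ?thesis using assms(4)
    by (induction rule: skew_induct)
      (simp_all add: h.hom_zero h'.hom_zero h.hom_add h'.hom_add single_closed assms(3))
qed

lemma (in skew_action) hom_from_singles:
  assumes "linear_map k S C h" "k_algebra k C"
    and m: "\<And>g b g' b'. \<lbrakk>g \<in> carrier G; b \<in> carrier B; g' \<in> carrier G; b' \<in> carrier B\<rbrakk>
      \<Longrightarrow> h (single B g b \<otimes>\<^bsub>S\<^esub> single B g' b') = h (single B g b) \<otimes>\<^bsub>C\<^esub> h (single B g' b')"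
    and one: "h \<one>\<^bsub>S\<^esub> = \<one>\<^bsub>C\<^esub>"
  shows "k_algebra_hom k S C h"
proof -
  interpret h: linear_map k S C h by fact
  interpret C: k_algebra k C by fact
  interpret S: k_algebra k S by (rule skew_k_algebra)
  have *: "h (single B g b \<otimes>\<^bsub>S\<^esub> y) = h (single B g b) \<otimes>\<^bsub>C\<^esub> h y"
    if "g \<in> carrier G" "b \<in> carrier B" "y \<in> carrier S" for g b y
    using that(3)
    by (induction rule: skew_induct)
      (simp_all add: that mult_zero single_closed h.hom_zero h.hom_closed S.A.r_distr C.A.r_distr h.hom_add m)
  have "h (x \<otimes>\<^bsub>S\<^esub> y) = h x \<otimes>\<^bsub>C\<^esub> h y" if "x \<in> carrier S" "y \<in> carrier S" for x y
    using that(1)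
    by (induction rule: skew_induct)
      (simp_all add: that mult_zero single_closed h.hom_zero h.hom_closed S.A.l_distr C.A.l_distr h.hom_add *)
  with one show ?thesis by unfold_locales
qed

section \<open>Monoid algebras\<close>

lemma self_k_algebra:
  assumes "cring k"
  shows "k_algebra k (self_algebra k)"
proof -
  interpret k: cring k by fact
  have r: "ring (self_algebra k)"
    by (rule ring_cong[OF k.ring_axioms]) (simp_all add: self_algebra_def)
  interpret s: ring "self_algebra k" by (rule r)
  show ?thesis
    by (intro k_algebra.intro k_algebra_axioms.intro moduleI assms s.abelian_group_axioms r)
      (auto simp: self_algebra_def k.l_distr k.r_distr k.m_ac)
qed

text \<open>
  This is the sum in the definition of \<open>tensor_map\<close>, with the target and the values \<open>\<phi>\<close> on the basis as
  parameters.
\<close>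

definition lin_ext ::
  "('k, 'x) ring_scheme \<Rightarrow> ('k, 'b, 'z) module_scheme \<Rightarrow> ('g \<Rightarrow> 'b) \<Rightarrow> ('g \<Rightarrow> 'k) \<Rightarrow> 'b"
  where "lin_ext k M \<phi> u = (\<Oplus>\<^bsub>M\<^esub>p\<in>{p. u p \<noteq> \<zero>\<^bsub>k\<^esub>}. u p \<odot>\<^bsub>M\<^esub> \<phi> p)"

locale monoid_alg = k: cring k + G: Group.monoid G
  for k :: "('k, 'x) ring_scheme" (structure) and G :: "('g, 'z) monoid_scheme"
begin

abbreviation "F \<equiv> monoid_algebra k G"
abbreviation "e \<equiv> basis_elem k"

lemma trivial_action: "skew_action k (self_algebra k) G (\<lambda>_ b. b)"
proof -
  interpret B: k_algebra k "self_algebra k" by (rule self_k_algebra[OF k.cring_axioms])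
  show ?thesis
    by (intro skew_action.intro skew_action_axioms.intro B.k_algebra_axioms B.id_hom)
      (auto intro: G.monoid_axioms)
qed

sublocale sk: skew_action k "self_algebra k" G "\<lambda>_ b. b"
  by (rule trivial_action)

lemma F_def: "F = skew_algebra (self_algebra k) G (\<lambda>_ b. b)"
  by (simp add: monoid_algebra_def)

lemma F_k_algebra: "k_algebra k F"
  using sk.skew_k_algebra by (simp add: F_def)

sublocale F: k_algebra k F
  by (rule F_k_algebra)

lemma basis_eq: "e g = single (self_algebra k) g \<one>\<^bsub>k\<^esub>"
  by (simp add: basis_elem_def single_def self_algebra_def fun_eq_iff)

lemma smult_basis: "r \<in> carrier k \<Longrightarrow> r \<odot>\<^bsub>F\<^esub> e g = single (self_algebra k) g r"
  by (simp add: F_def sk.skew_simps fun_eq_iff) (simp add: basis_elem_def single_def self_algebra_def)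

lemma basis_closed: "g \<in> carrier G \<Longrightarrow> e g \<in> carrier F"
  using sk.single_closed[of g "\<one>\<^bsub>k\<^esub>"] by (simp add: F_def basis_eq) (simp add: self_algebra_def)

lemma basis_mult: "\<lbrakk>g \<in> carrier G; h \<in> carrier G\<rbrakk> \<Longrightarrow> e g \<otimes>\<^bsub>F\<^esub> e h = e (g \<otimes>\<^bsub>G\<^esub> h)"
  using sk.single_mult[of g h "\<one>\<^bsub>k\<^esub>" "\<one>\<^bsub>k\<^esub>"] by (simp add: F_def basis_eq) (simp add: self_algebra_def)

lemma basis_one: "\<one>\<^bsub>F\<^esub> = e \<one>\<^bsub>G\<^esub>"
  using sk.skew_simps(4) by (simp add: F_def basis_eq) (simp add: self_algebra_def)

lemma F_induct [consumes 1, case_names zero add]: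
  assumes "f \<in> carrier F"
    and "P \<zero>\<^bsub>F\<^esub>"
    and "\<And>g r f. \<lbrakk>g \<in> carrier G; r \<in> carrier k; f \<in> carrier F; P f\<rbrakk> \<Longrightarrow> P (r \<odot>\<^bsub>F\<^esub> e g \<oplus>\<^bsub>F\<^esub> f)"
  shows "P f"
  using assms(1) unfolding F_def
proof (induction rule: sk.skew_induct)
  case zero
  then show ?case using assms(2) by (simp add: F_def)
next
  case (add g b f)
  then have "b \<in> carrier k" by (simp add: self_algebra_def)
  with assms(3)[of g b f] add show ?case by (simp add: smult_basis) (simp add: F_def)
qed

lemma linear_eq_on_basis:
  assumes "linear_map k F M h" "linear_map k F M h'"
    and "\<And>g. g \<in> carrier G \<Longrightarrow> h (e g) = h' (e g)" and "f \<in> carrier F"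
  shows "h f = h' f"
proof -
  interpret h: linear_map k F M h by fact
  interpret h': linear_map k F M h' by fact
  show ?thesis using assms(4)
    by (induction rule: F_induct)
      (simp_all add: h.hom_zero h'.hom_zero h.hom_add h'.hom_add h.hom_smult h'.hom_smult
        basis_closed assms(3))
qed

lemma carrier_F:
  assumes "f \<in> carrier F"
  shows "f x \<in> carrier k" "{x. f x \<noteq> \<zero>\<^bsub>k\<^esub>} \<subseteq> carrier G" "finite {x. f x \<noteq> \<zero>\<^bsub>k\<^esub>}"
  using assms unfolding F_def sk.carrier_iff by (simp_all add: self_algebra_def)

lemma lin_ext_eval:
  assumes "module k M" "\<And>g. g \<in> carrier G \<Longrightarrow> \<phi> g \<in> carrier M" "f \<in> carrier F"
    and X: "finite X" "{x. f x \<noteq> \<zero>\<^bsub>k\<^esub>} \<subseteq> X" "X \<subseteq> carrier G"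
  shows "lin_ext k M \<phi> f = (\<Oplus>\<^bsub>M\<^esub>p\<in>X. f p \<odot>\<^bsub>M\<^esub> \<phi> p)"
proof -
  interpret M: module k M by fact
  have t: "f p \<odot>\<^bsub>M\<^esub> \<phi> p \<in> carrier M" if "p \<in> X" for p
    using that X(3) assms(2) carrier_F(1)[OF assms(3)] by (intro M.smult_closed) auto
  show ?thesis unfolding lin_ext_def
  proof (rule M.add.finprod_mono_neutral_cong_left[OF X(1,2)])
    show "f p \<odot>\<^bsub>M\<^esub> \<phi> p = \<zero>\<^bsub>M\<^esub>" if "p \<in> X - {x. f x \<noteq> \<zero>\<^bsub>k\<^esub>}" for p
      using that X(3) assms(2) by auto
    show "(\<lambda>p. f p \<odot>\<^bsub>M\<^esub> \<phi> p) \<in> X \<rightarrow> carrier M" using t by blast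
  qed simp
qed

lemma lin_ext_linear:
  assumes M: "module k M" and \<phi>: "\<And>g. g \<in> carrier G \<Longrightarrow> \<phi> g \<in> carrier M"
  shows "linear_map k F M (lin_ext k M \<phi>)"
proof -
  interpret M: module k M by fact
  note eval = lin_ext_eval[OF M \<phi>]
  have t: "(\<lambda>p. f p \<odot>\<^bsub>M\<^esub> \<phi> p) \<in> X \<rightarrow> carrier M" if "f \<in> carrier F" "X \<subseteq> carrier G" for f X
    using that \<phi> carrier_F(1)[OF that(1)] by (auto intro!: M.smult_closed)
  show ?thesis
  proof unfold_locales
    fix f assume f: "f \<in> carrier F"
    note D = carrier_F[OF f]
    show "lin_ext k M \<phi> f \<in> carrier M"
      using eval[OF _ f D(3) subset_refl D(2)] M.finsum_closed[OF t[OF f D(2)]] by simp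
    show "lin_ext k M \<phi> (r \<odot>\<^bsub>F\<^esub> f) = r \<odot>\<^bsub>M\<^esub> lin_ext k M \<phi> f" if r: "r \<in> carrier k" for r
    proof -
      have rf: "(r \<odot>\<^bsub>F\<^esub> f) x = r \<otimes>\<^bsub>k\<^esub> f x" for x
        by (simp add: F_def sk.skew_simps) (simp add: self_algebra_def)
      then have s: "{x. (r \<odot>\<^bsub>F\<^esub> f) x \<noteq> \<zero>\<^bsub>k\<^esub>} \<subseteq> {x. f x \<noteq> \<zero>\<^bsub>k\<^esub>}" using r by auto
      show ?thesis
        apply (subst eval[OF _ F.smult_closed[OF r f] D(3) s D(2)], assumption)
        apply (subst eval[OF _ f D(3) subset_refl D(2)], assumption)
        apply (subst M.finsum_smult_ldistr[OF D(3) r t[OF f D(2)]])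
        apply (rule M.M.finsum_cong')
        using D r \<phi> by (auto simp: rf M.smult_assoc1 intro!: M.smult_closed)
    qed
    fix g assume g: "g \<in> carrier F"
    note D' = carrier_F[OF g]
    let ?X = "{x. f x \<noteq> \<zero>\<^bsub>k\<^esub>} \<union> {x. g x \<noteq> \<zero>\<^bsub>k\<^esub>}"
    have fg: "(f \<oplus>\<^bsub>F\<^esub> g) x = f x \<oplus>\<^bsub>k\<^esub> g x" for x
      by (simp add: F_def sk.skew_simps) (simp add: self_algebra_def)
    have X: "finite ?X" "?X \<subseteq> carrier G" using D D' by auto
    have s: "{x. (f \<oplus>\<^bsub>F\<^esub> g) x \<noteq> \<zero>\<^bsub>k\<^esub>} \<subseteq> ?X" by (auto simp: fg)
    show "lin_ext k M \<phi> (f \<oplus>\<^bsub>F\<^esub> g) = lin_ext k M \<phi> f \<oplus>\<^bsub>M\<^esub> lin_ext k M \<phi> g"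
      apply (subst eval[OF _ F.a_closed[OF f g] X(1) s X(2)], assumption)
      apply (subst eval[OF _ f X(1) _ X(2)], assumption, blast)
      apply (subst eval[OF _ g X(1) _ X(2)], assumption, blast)
      apply (subst M.M.finsum_addf[symmetric, OF t[OF f X(2)] t[OF g X(2)]])
      apply (rule M.M.finsum_cong')
      using X(2) D D' \<phi> by (auto simp: fg M.smult_l_distr intro!: M.smult_closed M.M.a_closed)
  qed
qed

lemma lin_ext_basis:
  assumes M: "module k M" and \<phi>: "\<And>g. g \<in> carrier G \<Longrightarrow> \<phi> g \<in> carrier M" and g: "g \<in> carrier G"
  shows "lin_ext k M \<phi> (e g) = \<phi> g"
proof -
  interpret M: module k M by fact
  have "lin_ext k M \<phi> (e g) = (\<Oplus>\<^bsub>M\<^esub>p\<in>{g}. e g p \<odot>\<^bsub>M\<^esub> \<phi> p)"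
    by (rule lin_ext_eval[OF M \<phi> basis_closed[OF g]])
      (use g in \<open>auto simp: basis_elem_def split: if_splits\<close>)
  also have "\<dots> = \<phi> g" using g \<phi> by (simp add: basis_elem_def)
  finally show ?thesis .
qed

lemma lin_ext_hom:
  assumes C: "k_algebra k C" and \<phi>: "\<And>g. g \<in> carrier G \<Longrightarrow> \<phi> g \<in> carrier C"
    and mult: "\<And>g h. \<lbrakk>g \<in> carrier G; h \<in> carrier G\<rbrakk> \<Longrightarrow> \<phi> (g \<otimes>\<^bsub>G\<^esub> h) = \<phi> g \<otimes>\<^bsub>C\<^esub> \<phi> h"
    and one: "\<phi> \<one>\<^bsub>G\<^esub> = \<one>\<^bsub>C\<^esub>"
  shows "k_algebra_hom k F C (lin_ext k C \<phi>)"
proof -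
  interpret C: k_algebra k C by fact
  have M: "module k C" ..
  note b = lin_ext_basis[OF M \<phi>]
  interpret h: linear_map k F C "lin_ext k C \<phi>"
    by (rule lin_ext_linear[OF M \<phi>])
  show ?thesis unfolding F_def
  proof (rule sk.hom_from_singles[OF _ C])
    show "linear_map k (skew_algebra (self_algebra k) G (\<lambda>_ b. b)) C (lin_ext k C \<phi>)"
      using h.linear_map_axioms by (simp add: F_def)
    show "lin_ext k C \<phi> \<one>\<^bsub>skew_algebra (self_algebra k) G (\<lambda>_ b. b)\<^esub> = \<one>\<^bsub>C\<^esub>"
      using b[OF _ G.one_closed] \<phi> basis_one one by (simp add: F_def)
    fix g r g' r'
    assume a: "g \<in> carrier G" "r \<in> carrier (self_algebra k)" "g' \<in> carrier G" "r' \<in> carrier (self_algebra k)"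
    then have r: "r \<in> carrier k" "r' \<in> carrier k" by (simp_all add: self_algebra_def)
    have prod: "single (self_algebra k) g r \<otimes>\<^bsub>F\<^esub> single (self_algebra k) g' r' = (r \<otimes>\<^bsub>k\<^esub> r') \<odot>\<^bsub>F\<^esub> e (g \<otimes>\<^bsub>G\<^esub> g')"
      using sk.single_mult[of g g' r r'] a r by (simp add: smult_basis) (simp add: F_def self_algebra_def)
    then have "lin_ext k C \<phi> (single (self_algebra k) g r \<otimes>\<^bsub>F\<^esub> single (self_algebra k) g' r')
      = lin_ext k C \<phi> (single (self_algebra k) g r) \<otimes>\<^bsub>C\<^esub> lin_ext k C \<phi> (single (self_algebra k) g' r')"
    proof -
      have "(r \<odot>\<^bsub>C\<^esub> \<phi> g) \<otimes>\<^bsub>C\<^esub> (r' \<odot>\<^bsub>C\<^esub> \<phi> g') = r \<odot>\<^bsub>C\<^esub> (r' \<odot>\<^bsub>C\<^esub> (\<phi> g \<otimes>\<^bsub>C\<^esub> \<phi> g'))"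
        using C.smult_mult_left[of r "\<phi> g" "r' \<odot>\<^bsub>C\<^esub> \<phi> g'"] C.smult_mult_right[of r' "\<phi> g" "\<phi> g'"]
          a r \<phi> by simp
      moreover have "lin_ext k C \<phi> (single (self_algebra k) g r) = r \<odot>\<^bsub>C\<^esub> \<phi> g"
        "lin_ext k C \<phi> (single (self_algebra k) g' r') = r' \<odot>\<^bsub>C\<^esub> \<phi> g'"
        using a r by (simp_all add: smult_basis[symmetric] h.hom_smult basis_closed b)
      moreover have "lin_ext k C \<phi> ((r \<otimes>\<^bsub>k\<^esub> r') \<odot>\<^bsub>F\<^esub> e (g \<otimes>\<^bsub>G\<^esub> g')) = r \<odot>\<^bsub>C\<^esub> (r' \<odot>\<^bsub>C\<^esub> (\<phi> g \<otimes>\<^bsub>C\<^esub> \<phi> g'))"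
        using a r \<phi> by (simp add: h.hom_smult basis_closed b mult C.smult_assoc1)
      ultimately show ?thesis
        unfolding prod by (simp only:)
    qed
    then show "lin_ext k C \<phi> (single (self_algebra k) g r \<otimes>\<^bsub>skew_algebra (self_algebra k) G (\<lambda>_ b. b)\<^esub> single (self_algebra k) g' r')
      = lin_ext k C \<phi> (single (self_algebra k) g r) \<otimes>\<^bsub>C\<^esub> lin_ext k C \<phi> (single (self_algebra k) g' r')"
      by (simp add: F_def)
  qed
qed

text \<open>
  Multiplication by a fixed element is linear, and linear maps send spans into spans; so stability
  need only be tested on generators of the span and on basis elements of the algebra.
\<close>

lemma span_ideal:
  assumes S: "S \<subseteq> carrier F"
    and l: "\<And>s g. \<lbrakk>s \<in> S; g \<in> carrier G\<rbrakk> \<Longrightarrow> e g \<otimes>\<^bsub>F\<^esub> s \<in> module_span k F S"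
    and r: "\<And>s g. \<lbrakk>s \<in> S; g \<in> carrier G\<rbrakk> \<Longrightarrow> s \<otimes>\<^bsub>F\<^esub> e g \<in> module_span k F S"
  shows "algebra_ideal k F (module_span k F S)"
proof -
  let ?N = "module_span k F S"
  have N: "submodule ?N k F" by (rule F.span_submodule[OF S])
  interpret N: submodule ?N k F by (rule N)
  note E = F.submoduleE[OF N]
  have z: "\<zero>\<^bsub>F\<^esub> \<in> ?N" using N.one_closed by simp
  have l': "e g \<otimes>\<^bsub>F\<^esub> x \<in> ?N" and r': "x \<otimes>\<^bsub>F\<^esub> e g \<in> ?N" if "g \<in> carrier G" "x \<in> ?N" for g x
    using linear_map.maps_span[OF F.left_mult_linear[OF basis_closed[OF that(1)]] S N l that(2)]
      linear_map.maps_span[OF F.right_mult_linear[OF basis_closed[OF that(1)]] S N r that(2)] that(1) by auto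
  have "y \<otimes>\<^bsub>F\<^esub> x \<in> ?N \<and> x \<otimes>\<^bsub>F\<^esub> y \<in> ?N" if x: "x \<in> ?N" and y: "y \<in> carrier F" for x y
    using y
  proof (induction rule: F_induct)
    case zero
    have "x \<in> carrier F" using x E(1) by blast
    then show ?case using z by simp
  next
    case (add g c f)
    have xc: "x \<in> carrier F" using x E(1) by blast
    then show ?case
      using add l'[OF add(1) x] r'[OF add(1) x]
      by (simp add: F.A.l_distr F.A.r_distr basis_closed E(4,5)
        F.smult_mult_left[symmetric] F.smult_mult_right[symmetric])
  qed
  moreover have "subgroup ?N (add_monoid F)" ..
  ultimately have "ideal ?N F"
    by (intro idealI F.A.ring_axioms) auto
  then show ?thesis by (intro algebra_ideal.intro F_k_algebra)
qed

lemma linear_eq_on_quotient: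
  assumes N: "algebra_ideal k F N"
    and "linear_map k (quotient_algebra F N) M h" "linear_map k (quotient_algebra F N) M h'"
    and "\<And>g. g \<in> carrier G \<Longrightarrow> h (N +>\<^bsub>F\<^esub> e g) = h' (N +>\<^bsub>F\<^esub> e g)"
    and "Y \<in> carrier (quotient_algebra F N)"
  shows "h Y = h' Y"
proof -
  interpret N: algebra_ideal k F N by fact
  interpret p: k_algebra_hom k F N.Q N.proj by (rule N.proj_hom)
  interpret h: linear_map k N.Q M h by fact
  interpret h': linear_map k N.Q M h' by fact
  obtain f where f: "f \<in> carrier F" "Y = N.proj f" using assms(5) by (auto simp: N.quotient_carrier)
  have "linear_map k F M (\<lambda>f. h (N.proj f))" "linear_map k F M (\<lambda>f. h' (N.proj f))"
    by (unfold_locales; simp add: p.hom_closed p.hom_add p.hom_smult h.hom_closed h.hom_add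
        h.hom_smult h'.hom_closed h'.hom_add h'.hom_smult)+
  from linear_eq_on_basis[OF this assms(4) f(1)] f(2) show ?thesis by simp
qed

end

section \<open>Tensor products of algebras\<close>

locale tensor_pair = A: k_algebra k A + B: k_algebra k B
  for k :: "('k, 'x) ring_scheme" (structure)
    and A :: "('k, 'a, 'y) module_scheme" and B :: "('k, 'b, 'z) module_scheme"
begin

sublocale X: monoid_alg k "A \<times>\<times> B"
  by (intro monoid_alg.intro DirProd_monoid A.R.cring_axioms A.A.monoid_axioms B.A.monoid_axioms)

abbreviation "pure \<equiv> pure_tensor k A B"
abbreviation "T \<equiv> tensor_algebra k A B"

lemma rel_intros:
  "\<lbrakk>a \<in> carrier A; a' \<in> carrier A; b \<in> carrier B\<rbrakk>
    \<Longrightarrow> X.e (a \<oplus>\<^bsub>A\<^esub> a', b) \<ominus>\<^bsub>X.F\<^esub> (X.e (a, b) \<oplus>\<^bsub>X.F\<^esub> X.e (a', b)) \<in> tensor_rels k A B"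
  "\<lbrakk>a \<in> carrier A; b \<in> carrier B; b' \<in> carrier B\<rbrakk>
    \<Longrightarrow> X.e (a, b \<oplus>\<^bsub>B\<^esub> b') \<ominus>\<^bsub>X.F\<^esub> (X.e (a, b) \<oplus>\<^bsub>X.F\<^esub> X.e (a, b')) \<in> tensor_rels k A B"
  "\<lbrakk>r \<in> carrier k; a \<in> carrier A; b \<in> carrier B\<rbrakk>
    \<Longrightarrow> X.e (r \<odot>\<^bsub>A\<^esub> a, b) \<ominus>\<^bsub>X.F\<^esub> r \<odot>\<^bsub>X.F\<^esub> X.e (a, b) \<in> tensor_rels k A B"
  "\<lbrakk>r \<in> carrier k; a \<in> carrier A; b \<in> carrier B\<rbrakk>
    \<Longrightarrow> X.e (a, r \<odot>\<^bsub>B\<^esub> b) \<ominus>\<^bsub>X.F\<^esub> r \<odot>\<^bsub>X.F\<^esub> X.e (a, b) \<in> tensor_rels k A B"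
  unfolding tensor_rels_def Let_def by blast+

lemma rel_cases:
  assumes "s \<in> tensor_rels k A B"
  obtains a a' b where "a \<in> carrier A" "a' \<in> carrier A" "b \<in> carrier B"
      "s = X.e (a \<oplus>\<^bsub>A\<^esub> a', b) \<ominus>\<^bsub>X.F\<^esub> (X.e (a, b) \<oplus>\<^bsub>X.F\<^esub> X.e (a', b))"
    | a b b' where "a \<in> carrier A" "b \<in> carrier B" "b' \<in> carrier B"
      "s = X.e (a, b \<oplus>\<^bsub>B\<^esub> b') \<ominus>\<^bsub>X.F\<^esub> (X.e (a, b) \<oplus>\<^bsub>X.F\<^esub> X.e (a, b'))"
    | r a b where "r \<in> carrier k" "a \<in> carrier A" "b \<in> carrier B"
      "s = X.e (r \<odot>\<^bsub>A\<^esub> a, b) \<ominus>\<^bsub>X.F\<^esub> r \<odot>\<^bsub>X.F\<^esub> X.e (a, b)"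
    | r a b where "r \<in> carrier k" "a \<in> carrier A" "b \<in> carrier B"
      "s = X.e (a, r \<odot>\<^bsub>B\<^esub> b) \<ominus>\<^bsub>X.F\<^esub> r \<odot>\<^bsub>X.F\<^esub> X.e (a, b)"
  using assms unfolding tensor_rels_def Let_def
  by (elim UnE CollectE exE conjE) (rule that; assumption)+

lemma e_closed: "\<lbrakk>a \<in> carrier A; b \<in> carrier B\<rbrakk> \<Longrightarrow> X.e (a, b) \<in> carrier X.F"
  by (rule X.basis_closed) simp

lemma rels_closed: "tensor_rels k A B \<subseteq> carrier X.F"
  by (rule subsetI, erule rel_cases) (simp_all add: e_closed X.F.M.minus_closed)

lemma e_mult:
  "\<lbrakk>a \<in> carrier A; b \<in> carrier B; a' \<in> carrier A; b' \<in> carrier B\<rbrakk>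
    \<Longrightarrow> X.e (a, b) \<otimes>\<^bsub>X.F\<^esub> X.e (a', b') = X.e (a \<otimes>\<^bsub>A\<^esub> a', b \<otimes>\<^bsub>B\<^esub> b')"
  using X.basis_mult[of "(a, b)" "(a', b')"] by simp

text \<open>
  The product of a basis element \<open>(x, y)\<close> with a bilinearity relation is the bilinearity relation
  for the products, by distributivity in \<open>A\<close> and \<open>B\<close>.
\<close>

lemma ker_ideal: "algebra_ideal k X.F (tensor_ker k A B)"
  unfolding tensor_ker_def
proof (rule X.span_ideal[OF rels_closed])
  fix s g assume s: "s \<in> tensor_rels k A B" and g: "g \<in> carrier (A \<times>\<times> B)"
  obtain x y where xy: "g = (x, y)" "x \<in> carrier A" "y \<in> carrier B" using g by auto
  have e: "X.e g \<in> carrier X.F" using xy by (simp add: e_closed)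
  interpret l: linear_map k X.F X.F "\<lambda>u. X.e g \<otimes>\<^bsub>X.F\<^esub> u" by (rule X.F.left_mult_linear[OF e])
  interpret r: linear_map k X.F X.F "\<lambda>u. u \<otimes>\<^bsub>X.F\<^esub> X.e g" by (rule X.F.right_mult_linear[OF e])
  note simps = e_closed e_mult A.A.r_distr A.A.l_distr B.A.r_distr B.A.l_distr rel_intros
    A.smult_mult_left[symmetric] A.smult_mult_right[symmetric]
    B.smult_mult_left[symmetric] B.smult_mult_right[symmetric]
  have "X.e g \<otimes>\<^bsub>X.F\<^esub> s \<in> tensor_rels k A B"
    using s by (cases rule: rel_cases) (simp_all add: l.hom_minus l.hom_add l.hom_smult e_closed, simp_all add: xy simps)
  then show "X.e g \<otimes>\<^bsub>X.F\<^esub> s \<in> module_span k X.F (tensor_rels k A B)"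
    using X.F.span_superset by blast
  have "s \<otimes>\<^bsub>X.F\<^esub> X.e g \<in> tensor_rels k A B"
    using s by (cases rule: rel_cases) (simp_all add: r.hom_minus r.hom_add r.hom_smult e_closed, simp_all add: xy simps)
  then show "s \<otimes>\<^bsub>X.F\<^esub> X.e g \<in> module_span k X.F (tensor_rels k A B)"
    using X.F.span_superset by blast
qed

abbreviation "cls x \<equiv> tensor_ker k A B +>\<^bsub>X.F\<^esub> x"

lemma T_def: "T = quotient_algebra X.F (tensor_ker k A B)"
  by (simp add: tensor_algebra_def)

lemma T_k_algebra: "k_algebra k T"
  unfolding T_def by (rule algebra_ideal.quotient_k_algebra[OF ker_ideal])

sublocale T: k_algebra k T
  by (rule T_k_algebra)

sublocale p: k_algebra_hom k X.F T "\<lambda>x. cls x"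
  unfolding T_def by (rule algebra_ideal.proj_hom[OF ker_ideal])

lemma pure_def: "pure a b = cls (X.e (a, b))"
  by (simp add: pure_tensor_def)

lemma pure_closed: "\<lbrakk>a \<in> carrier A; b \<in> carrier B\<rbrakk> \<Longrightarrow> pure a b \<in> carrier T"
  by (simp add: pure_def p.hom_closed e_closed)

lemma pure_mult:
  "\<lbrakk>a \<in> carrier A; b \<in> carrier B; a' \<in> carrier A; b' \<in> carrier B\<rbrakk>
    \<Longrightarrow> pure a b \<otimes>\<^bsub>T\<^esub> pure a' b' = pure (a \<otimes>\<^bsub>A\<^esub> a') (b \<otimes>\<^bsub>B\<^esub> b')"
  by (simp add: pure_def e_closed e_mult flip: p.hom_mult)

lemma pure_one: "\<one>\<^bsub>T\<^esub> = pure \<one>\<^bsub>A\<^esub> \<one>\<^bsub>B\<^esub>"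
  by (simp add: pure_def p.hom_one[symmetric] X.basis_one)

lemma rel_zero: "s \<in> tensor_rels k A B \<Longrightarrow> cls s = \<zero>\<^bsub>T\<^esub>"
  unfolding T_def
  by (rule algebra_ideal.proj_eq_zero[OF ker_ideal]) (use X.F.span_superset in \<open>auto simp: tensor_ker_def\<close>)

lemma proj_eqI:
  assumes "x \<ominus>\<^bsub>X.F\<^esub> y \<in> tensor_rels k A B" "x \<in> carrier X.F" "y \<in> carrier X.F"
  shows "cls x = cls y"
proof (rule T.M.eq_if_minus_zero[OF _ p.hom_closed p.hom_closed])
  show "cls x \<ominus>\<^bsub>T\<^esub> cls y = \<zero>\<^bsub>T\<^esub>"
    using rel_zero[OF assms(1)] unfolding p.hom_minus[OF assms(2,3)] .
qed fact+

lemma pure_bilinear: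
  "\<lbrakk>a \<in> carrier A; a' \<in> carrier A; b \<in> carrier B\<rbrakk>
    \<Longrightarrow> pure (a \<oplus>\<^bsub>A\<^esub> a') b = pure a b \<oplus>\<^bsub>T\<^esub> pure a' b"
  "\<lbrakk>a \<in> carrier A; b \<in> carrier B; b' \<in> carrier B\<rbrakk>
    \<Longrightarrow> pure a (b \<oplus>\<^bsub>B\<^esub> b') = pure a b \<oplus>\<^bsub>T\<^esub> pure a b'"
  "\<lbrakk>r \<in> carrier k; a \<in> carrier A; b \<in> carrier B\<rbrakk>
    \<Longrightarrow> pure (r \<odot>\<^bsub>A\<^esub> a) b = r \<odot>\<^bsub>T\<^esub> pure a b"
  "\<lbrakk>r \<in> carrier k; a \<in> carrier A; b \<in> carrier B\<rbrakk>
    \<Longrightarrow> pure a (r \<odot>\<^bsub>B\<^esub> b) = r \<odot>\<^bsub>T\<^esub> pure a b"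
  unfolding pure_def
  by (simp_all add: e_closed rel_intros proj_eqI flip: p.hom_add p.hom_smult)

lemma linear_eq_on_pure:
  assumes "linear_map k T M h" "linear_map k T M h'"
    and "\<And>a b. \<lbrakk>a \<in> carrier A; b \<in> carrier B\<rbrakk> \<Longrightarrow> h (pure a b) = h' (pure a b)"
    and "Y \<in> carrier T"
  shows "h Y = h' Y"
  by (rule X.linear_eq_on_quotient[OF ker_ideal])
    (use assms in \<open>auto simp: T_def pure_def\<close>)

text \<open>
  All maps out of tensor products are obtained in this way below: \<open>tensor_map\<close>, and the components of
  the inverse isomorphism.
\<close>

lemma tensor_lift:
  assumes M: "module k M"
    and closed: "\<And>a b. \<lbrakk>a \<in> carrier A; b \<in> carrier B\<rbrakk> \<Longrightarrow> \<beta> a b \<in> carrier M"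
    and add_left: "\<And>a a' b. \<lbrakk>a \<in> carrier A; a' \<in> carrier A; b \<in> carrier B\<rbrakk>
      \<Longrightarrow> \<beta> (a \<oplus>\<^bsub>A\<^esub> a') b = \<beta> a b \<oplus>\<^bsub>M\<^esub> \<beta> a' b"
    and add_right: "\<And>a b b'. \<lbrakk>a \<in> carrier A; b \<in> carrier B; b' \<in> carrier B\<rbrakk>
      \<Longrightarrow> \<beta> a (b \<oplus>\<^bsub>B\<^esub> b') = \<beta> a b \<oplus>\<^bsub>M\<^esub> \<beta> a b'"
    and smult_left: "\<And>r a b. \<lbrakk>r \<in> carrier k; a \<in> carrier A; b \<in> carrier B\<rbrakk>
      \<Longrightarrow> \<beta> (r \<odot>\<^bsub>A\<^esub> a) b = r \<odot>\<^bsub>M\<^esub> \<beta> a b"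
    and smult_right: "\<And>r a b. \<lbrakk>r \<in> carrier k; a \<in> carrier A; b \<in> carrier B\<rbrakk>
      \<Longrightarrow> \<beta> a (r \<odot>\<^bsub>B\<^esub> b) = r \<odot>\<^bsub>M\<^esub> \<beta> a b"
  defines "L \<equiv> \<lambda>Y. the_elem (lin_ext k M (\<lambda>p. \<beta> (fst p) (snd p)) ` Y)"
  shows "linear_map k T M L"
    and "\<And>a b. \<lbrakk>a \<in> carrier A; b \<in> carrier B\<rbrakk> \<Longrightarrow> L (pure a b) = \<beta> a b"
proof -
  interpret M: module k M by fact
  let ?\<phi> = "\<lambda>p. \<beta> (fst p) (snd p)"
  have \<phi>: "?\<phi> p \<in> carrier M" if "p \<in> carrier (A \<times>\<times> B)" for p using that closed by auto
  interpret h: linear_map k X.F M "lin_ext k M ?\<phi>" by (rule X.lin_ext_linear[OF M \<phi>])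
  have b: "lin_ext k M ?\<phi> (X.e (a, b)) = \<beta> a b" if "a \<in> carrier A" "b \<in> carrier B" for a b
    using X.lin_ext_basis[OF M, of ?\<phi> "(a, b)", OF \<phi>] that by simp
  have "lin_ext k M ?\<phi> s = \<zero>\<^bsub>M\<^esub>" if "s \<in> tensor_rels k A B" for s
    using that
    by (cases rule: rel_cases)
      (simp_all add: h.hom_minus h.hom_add h.hom_smult e_closed b closed add_left add_right
        smult_left smult_right, simp_all add: a_minus_def M.M.r_neg closed)
  then have z: "lin_ext k M ?\<phi> x = \<zero>\<^bsub>M\<^esub>" if "x \<in> tensor_ker k A B" for x
    using h.vanishes_on_span[OF rels_closed] that unfolding tensor_ker_def by blast
  show "linear_map k T M L"
    unfolding T_def L_def by (rule algebra_ideal.lift_linear[OF ker_ideal h.linear_map_axioms z])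
  show "L (pure a b) = \<beta> a b" if "a \<in> carrier A" "b \<in> carrier B" for a b
    unfolding L_def pure_def
    by (simp add: algebra_ideal.lift_proj[OF ker_ideal h.linear_map_axioms z] e_closed b that)
qed

lemma tensor_map_hom:
  assumes f: "k_algebra_hom k A A f" and g: "k_algebra_hom k B B g"
  shows "k_algebra_hom k T T (tensor_map k A B f g)"
    and "\<And>a b. \<lbrakk>a \<in> carrier A; b \<in> carrier B\<rbrakk> \<Longrightarrow> tensor_map k A B f g (pure a b) = pure (f a) (g b)"
proof -
  interpret f: k_algebra_hom k A A f by fact
  interpret g: k_algebra_hom k B B g by fact
  have M: "module k T" ..
  have eq: "tensor_map k A B f g = (\<lambda>Y. the_elem (lin_ext k T (\<lambda>p. pure (f (fst p)) (g (snd p))) ` Y))"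
    by (simp add: fun_eq_iff tensor_map_def lin_ext_def Let_def)
  note closed = pure_closed f.hom_closed g.hom_closed
  note homs = f.hom_add g.hom_add f.hom_smult g.hom_smult f.hom_mult g.hom_mult pure_bilinear
  have lin: "linear_map k T T (tensor_map k A B f g)"
    unfolding eq by (rule tensor_lift(1)[OF M]) (simp_all add: closed homs)
  show pure: "tensor_map k A B f g (pure a b) = pure (f a) (g b)"
    if "a \<in> carrier A" "b \<in> carrier B" for a b
    unfolding eq by (rule tensor_lift(2)[OF M]) (simp_all add: closed homs that)
  interpret h: linear_map k T T "tensor_map k A B f g" by (rule lin)
  have m: "tensor_map k A B f g (pure a b \<otimes>\<^bsub>T\<^esub> y) = pure (f a) (g b) \<otimes>\<^bsub>T\<^esub> tensor_map k A B f g y"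
    if ab: "a \<in> carrier A" "b \<in> carrier B" and y: "y \<in> carrier T" for a b y
  proof (rule linear_eq_on_pure[OF _ _ _ y])
    show "linear_map k T T (\<lambda>y. tensor_map k A B f g (pure a b \<otimes>\<^bsub>T\<^esub> y))"
      by (rule linear_map_compose[OF T.left_mult_linear lin]) (simp add: closed ab)
    show "linear_map k T T (\<lambda>y. pure (f a) (g b) \<otimes>\<^bsub>T\<^esub> tensor_map k A B f g y)"
      by (rule linear_map_compose[OF lin T.left_mult_linear]) (simp add: closed ab)
  qed (simp add: pure pure_mult closed ab homs)
  have mult: "tensor_map k A B f g (x \<otimes>\<^bsub>T\<^esub> y) = tensor_map k A B f g x \<otimes>\<^bsub>T\<^esub> tensor_map k A B f g y"
    if x: "x \<in> carrier T" and y: "y \<in> carrier T" for x y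
  proof (rule linear_eq_on_pure[OF _ _ _ x])
    show "linear_map k T T (\<lambda>x. tensor_map k A B f g (x \<otimes>\<^bsub>T\<^esub> y))"
      by (rule linear_map_compose[OF T.right_mult_linear[OF y] lin])
    show "linear_map k T T (\<lambda>x. tensor_map k A B f g x \<otimes>\<^bsub>T\<^esub> tensor_map k A B f g y)"
      by (rule linear_map_compose[OF lin T.right_mult_linear]) (simp add: h.hom_closed y)
  qed (simp add: pure m y)
  have "tensor_map k A B f g \<one>\<^bsub>T\<^esub> = \<one>\<^bsub>T\<^esub>"
    by (simp add: pure_one pure f.hom_one g.hom_one)
  with mult show "k_algebra_hom k T T (tensor_map k A B f g)" by unfold_locales
qed

end

section \<open>Opposite algebras\<close>

lemma op_k_algebra:
  assumes "k_algebra k A"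
  shows "k_algebra k (op_algebra A)"
proof -
  interpret A: k_algebra k A by fact
  have ab: "abelian_group (op_algebra A)"
  proof (rule abelian_groupI)
    fix x assume x: "x \<in> carrier (op_algebra A)"
    then show "\<exists>y\<in>carrier (op_algebra A). y \<oplus>\<^bsub>op_algebra A\<^esub> x = \<zero>\<^bsub>op_algebra A\<^esub>"
      by (intro bexI[of _ "\<ominus>\<^bsub>A\<^esub> x"]) (simp_all add: op_algebra_def A.M.l_neg)
  qed (simp_all add: op_algebra_def A.M.a_ac)
  have "Group.monoid (op_algebra A)"
    by (rule monoidI) (simp_all add: op_algebra_def A.A.m_assoc)
  then have "ring (op_algebra A)"
    by (rule ringI[OF ab]) (simp_all add: op_algebra_def A.A.l_distr A.A.r_distr)
  moreover have "module k (op_algebra A)"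
    by (rule moduleI[OF A.R.cring_axioms ab])
      (simp_all add: op_algebra_def A.smult_l_distr A.smult_r_distr A.smult_assoc1)
  ultimately show ?thesis
    by (intro k_algebra.intro k_algebra_axioms.intro)
      (simp_all add: op_algebra_def A.smult_mult_left A.smult_mult_right[symmetric])
qed

lemma op_hom:
  assumes "k_algebra_hom k A A f"
  shows "k_algebra_hom k (op_algebra A) (op_algebra A) f"
proof -
  interpret f: k_algebra_hom k A A f by fact
  interpret O: k_algebra k "op_algebra A" by (rule op_k_algebra) (rule f.A.k_algebra_axioms)
  show ?thesis
    by unfold_locales
      (simp_all add: op_algebra_def f.hom_closed f.hom_add f.hom_smult f.hom_mult f.hom_one)
qed

section \<open>Flattening trees\<close>

primrec leaves :: "'a ptree \<Rightarrow> 'a option list" where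
  "leaves Hole = [None]"
| "leaves (Leaf a) = [Some a]"
| "leaves (Node ts) = concat (map leaves ts)"

primrec nodes :: "'a ptree \<Rightarrow> nat" where
  "nodes Hole = 0"
| "nodes (Leaf a) = 0"
| "nodes (Node ts) = Suc (sum_list (map nodes ts))"

lemma full_Node: "full_ptree S n (Node ts) \<longleftrightarrow> length ts = n \<and> (\<forall>t\<in>set ts. full_ptree S n t)"
  by (simp add: list_all_iff)

text \<open>
  Replacing a leaf by a vertex adds \<open>m\<close> leaves.  Hence the number of leaves of a full tree is
  \<open>1\<close> modulo \<open>m\<close>; this congruence is what lets powers of \<open>\<sigma>\<close> be counted by leaves.
\<close>

lemma length_leaves: "full_ptree S (Suc m) t \<Longrightarrow> length (leaves t) = 1 + m * nodes t"
proof (induction t)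
  case (Node ts)
  have "length (concat (map leaves ts)) = length ts + m * sum_list (map nodes ts)"
  proof -
    have "\<forall>t\<in>set ts. length (leaves t) = 1 + m * nodes t"
      using Node unfolding full_Node by blast
    then show ?thesis by (induction ts) (simp_all add: algebra_simps)
  qed
  then show ?case using Node.prems by (simp add: algebra_simps)
qed auto

lemma holes_leaves: "holes t = count_list (leaves t) None"
proof (induction t)
  case (Node ts)
  then show ?case by (induction ts) auto
qed auto

lemma leaves_subset: "full_ptree S n t \<Longrightarrow> set (leaves t) \<subseteq> insert None (Some ` S)"
proof (induction t)
  case (Node ts)
  then show ?case unfolding full_Node by auto
qed auto

lemma options_no_hole:
  assumes "set xs \<subseteq> insert None (Some ` S)" "count_list xs None = 0"
  obtains us where "xs = map Some us" "set us \<subseteq> S"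
proof
  have *: "set xs \<subseteq> Some ` S" using assms by (auto simp: count_list_0_iff)
  then show "xs = map Some (map the xs)" by (induction xs) auto
  show "set (map the xs) \<subseteq> S" using * by auto
qed

lemma options_one_hole:
  assumes "set xs \<subseteq> insert None (Some ` S)" "count_list xs None = 1"
  obtains us ws where "xs = map Some us @ None # map Some ws" "set us \<subseteq> S" "set ws \<subseteq> S"
proof -
  have "None \<in> set xs" using assms(2) by (metis count_notin zero_neq_one)
  then obtain ys zs where xs: "xs = ys @ None # zs" by (meson split_list)
  have "set ys \<subseteq> insert None (Some ` S)" "set zs \<subseteq> insert None (Some ` S)"
    "count_list ys None = 0" "count_list zs None = 0"
    using assms by (auto simp: xs)
  then show ?thesis using that xs options_no_hole by metis
qed

lemma leaves_one_hole:
  assumes "t \<in> one_hole_contexts S n"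
  obtains us ws where "leaves t = map Some us @ None # map Some ws" "set us \<subseteq> S" "set ws \<subseteq> S"
  using assms options_one_hole[OF leaves_subset, of S n t]
  by (auto simp: one_hole_contexts_def holes_leaves)

lemma one_hole_split_unique:
  assumes "map Some us @ None # map Some ws = map Some us' @ None # map Some ws'"
  shows "us = us' \<and> ws = ws'"
  using assms
proof (induction us arbitrary: us')
  case Nil
  then show ?case by (cases us') auto
next
  case (Cons a us)
  then show ?case by (cases us') auto
qed

lemma one_hole_Node:
  assumes "holes (Node ts) = 1"
  obtains us s ws where "ts = us @ s # ws" "holes s = 1"
    "\<forall>t\<in>set us. holes t = 0" "\<forall>t\<in>set ws. holes t = 0"
proof -
  have "\<not> (\<forall>s\<in>set ts. holes s = 0)"
    using assms sum_list_eq_0_iff[of "map holes ts"] by auto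
  then obtain s where s: "s \<in> set ts" "holes s \<noteq> 0" by blast
  then obtain us ws where ts: "ts = us @ s # ws" by (meson split_list)
  have "sum_list (map holes us) = 0" "sum_list (map holes ws) = 0" "holes s = 1"
    using assms s(2)
    unfolding ts holes.simps map_append list.map sum_list.append sum_list.Cons by linarith+
  then have "holes s = 1" "\<forall>t\<in>set us. holes t = 0" "\<forall>t\<in>set ws. holes t = 0"
    unfolding sum_list_eq_0_iff by auto
  with ts that show ?thesis by blast
qed

lemma frame_leaves:
  assumes "tree_frame P"
  obtains pre post k where "\<And>t. leaves (P t) = pre @ leaves t @ post" "\<And>t. nodes (P t) = k + nodes t"
proof -
  have "\<exists>pre post k. (\<forall>t. leaves (P t) = pre @ leaves t @ post) \<and> (\<forall>t. nodes (P t) = k + nodes t)"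
    using assms
  proof induction
    case here
    show ?case by (rule exI[of _ "[]"], rule exI[of _ "[]"], rule exI[of _ 0]) simp
  next
    case (below P us ws)
    then obtain pre post k where "\<forall>t. leaves (P t) = pre @ leaves t @ post" "\<forall>t. nodes (P t) = k + nodes t"
      by blast
    then show ?case
      by (intro exI[of _ "concat (map leaves us) @ pre"] exI[of _ "post @ concat (map leaves ws)"]
          exI[of _ "Suc (sum_list (map nodes us) + k + sum_list (map nodes ws))"]) auto
  qed
  then show ?thesis using that by blast
qed

lemma frame_holes:
  assumes "tree_frame P" "holes t = holes t'"
  shows "holes (P t) = holes (P t')"
  using assms by induction auto

lemma frame_full:
  assumes "tree_frame P" "full_ptree S n (P t)" "full_ptree S n t \<Longrightarrow> full_ptree S n t'"
  shows "full_ptree S n (P t')"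
  using assms by induction (auto simp: full_Node simp del: full_ptree.simps)

lemma frame_full_inner:
  assumes "tree_frame P" "full_ptree S n (P t)"
  shows "full_ptree S n t"
  using assms by induction (auto simp: full_Node simp del: full_ptree.simps)

lemma frame_replace:
  assumes "tree_frame P" "P t \<in> one_hole_contexts S n" "full_ptree S n t'" "holes t = holes t'"
  shows "P t' \<in> one_hole_contexts S n"
  using assms frame_full[OF assms(1), of S n t t'] frame_holes[OF assms(1,4)]
  by (auto simp: one_hole_contexts_def)

lemma frame_compose:
  assumes "tree_frame P" "tree_frame Q"
  shows "tree_frame (\<lambda>t. P (Q t))"
  using assms by induction (auto intro: tree_frame.intros)

lemma concat_map_eq:
  assumes "us @ vs @ ws = us' @ vs' @ ws'"
  shows "concat (map f us) @ concat (map f vs) @ concat (map f ws)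
    = concat (map f us') @ concat (map f vs') @ concat (map f ws')"
  using arg_cong[OF assms, of "\<lambda>xs. concat (map f xs)"] by simp

lemma sum_list_map_eq:
  fixes f :: "'a \<Rightarrow> nat"
  assumes "us @ vs @ ws = us' @ vs' @ ws'"
  shows "sum_list (map f us) + (sum_list (map f vs) + sum_list (map f ws))
    = sum_list (map f us') + (sum_list (map f vs') + sum_list (map f ws'))"
  using arg_cong[OF assms, of "\<lambda>xs. sum_list (map f xs)"] by simp

text \<open>Both trees list the same subtrees in the same order and only cut the list at different places.\<close>

lemma rebracket_invariants:
  assumes "rebracket n t t'"
  shows "leaves t = leaves t'" "nodes t = nodes t'" "full_ptree S n t \<Longrightarrow> full_ptree S n t'"
proof -
  from assms obtain P us vs ws us' vs' ws' where P: "tree_frame P"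
    and t: "t = P (Node (us @ Node vs # ws))" "t' = P (Node (us' @ Node vs' # ws'))"
    and len: "length vs = n" "length vs' = n" "length (us' @ Node vs' # ws') = n"
    and eq: "us @ vs @ ws = us' @ vs' @ ws'"
    by (cases rule: rebracket.cases) blast
  obtain pre post k where f: "\<And>t. leaves (P t) = pre @ leaves t @ post" "\<And>t. nodes (P t) = k + nodes t"
    using frame_leaves[OF P] by metis
  show "leaves t = leaves t'" using concat_map_eq[OF eq, of leaves] by (simp add: t f)
  show "nodes t = nodes t'" using sum_list_map_eq[OF eq, of nodes] by (simp add: t f)
  have "set us \<union> set vs \<union> set ws = set us' \<union> set vs' \<union> set ws'"
    using arg_cong[OF eq, of set] by (simp add: Un_assoc)
  then have sub: "set us' \<subseteq> set us \<union> set vs \<union> set ws" "set vs' \<subseteq> set us \<union> set vs \<union> set ws"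
    "set ws' \<subseteq> set us \<union> set vs \<union> set ws" by blast+
  assume "full_ptree S n t"
  then show "full_ptree S n t'" unfolding t
  proof (rule frame_full[OF P])
    assume "full_ptree S n (Node (us @ Node vs # ws))"
    then have all: "\<forall>t\<in>set us \<union> set vs \<union> set ws. full_ptree S n t"
      unfolding full_Node by (auto simp: full_Node simp del: full_ptree.simps)
    then show "full_ptree S n (Node (us' @ Node vs' # ws'))"
      using sub len unfolding full_Node by (auto simp: full_Node simp del: full_ptree.simps)
  qed
qed

lemma rebracket_one_hole:
  assumes "rebracket n t t'" "t \<in> one_hole_contexts S n"
  shows "t' \<in> one_hole_contexts S n"
  using rebracket_invariants(1,2)[OF assms(1)] rebracket_invariants(3)[OF assms(1), of S] assms(2)
  by (simp add: one_hole_contexts_def holes_leaves)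

section \<open>Twisted products\<close>

text \<open>
  The product \<open>x\<^sub>0 \<cdot> \<sigma> x\<^sub>1 \<cdot> \<sigma>\<^sup>2 x\<^sub>2 \<cdots>\<close> of a list of any length.  The point of this form is the rule
  \<open>sp_append\<close>, by which concatenation of lists becomes multiplication up to a power of \<open>\<sigma>\<close>.
\<close>

primrec twisted_prod :: "('a, 'y) ring_scheme \<Rightarrow> ('a \<Rightarrow> 'a) \<Rightarrow> 'a list \<Rightarrow> 'a" where
  "twisted_prod A \<sigma> [] = \<one>\<^bsub>A\<^esub>"
| "twisted_prod A \<sigma> (x # xs) = x \<otimes>\<^bsub>A\<^esub> \<sigma> (twisted_prod A \<sigma> xs)"

text \<open>The last assumption is \<open>\<sigma>\<^sup>m(a) = c a c\<^sup>-\<^sup>1\<close>, multiplied by \<open>c\<close> on the right.\<close>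

locale twisted_algebra = \<sigma>: k_algebra_hom k A A \<sigma>
  for k :: "('k, 'x) ring_scheme" (structure) and A :: "('k, 'a, 'y) module_scheme"
    and \<sigma> :: "'a \<Rightarrow> 'a" +
  fixes m :: nat and c :: 'a
  assumes m_pos: "m > 0"
    and c_unit: "c \<in> Units A"
    and \<sigma>_c: "\<sigma> c = c"
    and \<sigma>_pow_m: "a \<in> carrier A \<Longrightarrow> (\<sigma> ^^ m) a \<otimes>\<^bsub>A\<^esub> c = c \<otimes>\<^bsub>A\<^esub> a"
begin

abbreviation "sp \<equiv> twisted_prod A \<sigma>"

lemma c_closed: "c \<in> carrier A"
  using c_unit by (rule \<sigma>.A.A.Units_closed)

lemma pow_hom: "k_algebra_hom k A A (\<sigma> ^^ n)"
  by (rule k_algebra_hom_funpow[OF \<sigma>.k_algebra_hom_axioms])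

lemmas pow_closed = linear_map.hom_closed[OF k_algebra_hom.axioms(1)[OF pow_hom]]
lemmas pow_add = linear_map.hom_add[OF k_algebra_hom.axioms(1)[OF pow_hom]]
lemmas pow_smult = linear_map.hom_smult[OF k_algebra_hom.axioms(1)[OF pow_hom]]
lemmas pow_mult = k_algebra_hom.hom_mult[OF pow_hom]
lemmas pow_one = k_algebra_hom.hom_one[OF pow_hom]

lemma sp_closed [simp]: "set xs \<subseteq> carrier A \<Longrightarrow> sp xs \<in> carrier A"
  by (induction xs) (simp_all add: \<sigma>.hom_closed)

lemma sp_append:
  "\<lbrakk>set xs \<subseteq> carrier A; set ys \<subseteq> carrier A\<rbrakk>
    \<Longrightarrow> sp (xs @ ys) = sp xs \<otimes>\<^bsub>A\<^esub> (\<sigma> ^^ length xs) (sp ys)"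
  by (induction xs) (simp_all add: \<sigma>.hom_mult \<sigma>.hom_closed pow_closed \<sigma>.A.A.m_assoc)

lemma sp_singleton: "x \<in> carrier A \<Longrightarrow> sp [x] = x"
  by (simp add: \<sigma>.hom_one)

lemma sp_ones: "sp (replicate n \<one>\<^bsub>A\<^esub>) = \<one>\<^bsub>A\<^esub>"
  by (induction n) (simp_all add: \<sigma>.hom_one)

lemma sp_ones_append: "set xs \<subseteq> carrier A \<Longrightarrow> sp (replicate n \<one>\<^bsub>A\<^esub> @ xs) = (\<sigma> ^^ n) (sp xs)"
  by (subst sp_append) (auto simp: sp_ones pow_closed)

lemma sp_append_ones: "set xs \<subseteq> carrier A \<Longrightarrow> sp (xs @ replicate n \<one>\<^bsub>A\<^esub>) = sp xs"
  by (subst sp_append) (auto simp: sp_ones pow_one)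

lemma sp_add:
  assumes "set us \<subseteq> carrier A" "set ws \<subseteq> carrier A" "a \<in> carrier A" "b \<in> carrier A"
  shows "sp (us @ (a \<oplus>\<^bsub>A\<^esub> b) # ws) = sp (us @ a # ws) \<oplus>\<^bsub>A\<^esub> sp (us @ b # ws)"
  using assms by (simp add: sp_append pow_add \<sigma>.A.A.l_distr \<sigma>.A.A.r_distr \<sigma>.hom_closed pow_closed)

lemma sp_smult:
  assumes "set us \<subseteq> carrier A" "set ws \<subseteq> carrier A" "a \<in> carrier A" "r \<in> carrier k"
  shows "sp (us @ (r \<odot>\<^bsub>A\<^esub> a) # ws) = r \<odot>\<^bsub>A\<^esub> sp (us @ a # ws)"
  using assms
  by (simp add: sp_append pow_smult \<sigma>.hom_closed pow_closed
      flip: \<sigma>.A.smult_mult_left \<sigma>.A.smult_mult_right)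

lemma foldr_twisted:
  assumes "set xs \<subseteq> carrier A" "z \<in> carrier A"
  shows "foldr (mult A) (map (\<lambda>i. (\<sigma> ^^ (j + i)) (xs ! i)) [0..<length xs]) z
    = (\<sigma> ^^ j) (sp xs) \<otimes>\<^bsub>A\<^esub> z"
  using assms(1)
proof (induction xs arbitrary: j)
  case Nil
  show ?case using assms(2) by (simp add: pow_one)
next
  case (Cons x xs)
  have "map (\<lambda>i. (\<sigma> ^^ (j + i)) ((x # xs) ! i)) [0..<length (x # xs)]
    = (\<sigma> ^^ j) x # map (\<lambda>i. (\<sigma> ^^ (Suc j + i)) (xs ! i)) [0..<length xs]"
    by (simp add: upt_conv_Cons map_Suc_upt[symmetric] del: upt_Suc)
  then show ?case
    using Cons.IH[of "Suc j"] Cons.prems assms(2)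
    by (simp add: pow_mult \<sigma>.hom_closed pow_closed \<sigma>.A.A.m_assoc funpow_swap1)
qed

text \<open>
  Since \<open>c a = \<sigma>\<^sup>m(a) c\<close>, the factor \<open>c\<close> may be moved to the far right of the \<open>n\<close>-ary product.  What
  stands to its left treats all \<open>m + 1\<close> arguments alike.
\<close>

lemma nary_eq:
  assumes "set as \<subseteq> carrier A" "length as = Suc m"
  shows "nary_mult A m \<sigma> c as = sp as \<otimes>\<^bsub>A\<^esub> c"
proof -
  obtain bs b where as: "as = bs @ [b]" using assms(2) by (metis length_Suc_conv_rev)
  have bs: "length bs = m" "set bs \<subseteq> carrier A" "b \<in> carrier A" using assms as by auto
  have map: "map (\<lambda>i. (\<sigma> ^^ i) (as ! i)) [0..<m] = map (\<lambda>i. (\<sigma> ^^ (0 + i)) (bs ! i)) [0..<length bs]"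
    using bs by (simp add: as nth_append)
  have nth: "as ! m = b" using bs(1) by (metis as nth_append_length)
  have "nary_mult A m \<sigma> c as = sp bs \<otimes>\<^bsub>A\<^esub> (c \<otimes>\<^bsub>A\<^esub> b)"
    unfolding nary_mult_def map nth using foldr_twisted[of bs "c \<otimes>\<^bsub>A\<^esub> b" 0] bs c_closed
    by simp
  also have "\<dots> = sp as \<otimes>\<^bsub>A\<^esub> c"
    using bs c_closed by (simp add: as sp_append sp_singleton \<sigma>.A.A.m_assoc pow_closed \<sigma>_pow_m del: twisted_prod.simps)
  finally show ?thesis .
qed

lemma c_pow_commute:
  assumes "y \<in> carrier A"
  shows "c [^]\<^bsub>A\<^esub> n \<otimes>\<^bsub>A\<^esub> y = (\<sigma> ^^ (m * n)) y \<otimes>\<^bsub>A\<^esub> c [^]\<^bsub>A\<^esub> n"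
  using assms
proof (induction n arbitrary: y)
  case (Suc n)
  note y = Suc.prems
  have "c [^]\<^bsub>A\<^esub> Suc n \<otimes>\<^bsub>A\<^esub> y = c [^]\<^bsub>A\<^esub> n \<otimes>\<^bsub>A\<^esub> ((\<sigma> ^^ m) y \<otimes>\<^bsub>A\<^esub> c)"
    using y c_closed by (simp add: \<sigma>.A.A.m_assoc \<sigma>_pow_m)
  also have "\<dots> = (c [^]\<^bsub>A\<^esub> n \<otimes>\<^bsub>A\<^esub> (\<sigma> ^^ m) y) \<otimes>\<^bsub>A\<^esub> c"
    using y c_closed by (simp add: pow_closed \<sigma>.A.A.m_assoc)
  also have "\<dots> = (\<sigma> ^^ (m * n)) ((\<sigma> ^^ m) y) \<otimes>\<^bsub>A\<^esub> c [^]\<^bsub>A\<^esub> n \<otimes>\<^bsub>A\<^esub> c"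
    using Suc.IH[of "(\<sigma> ^^ m) y"] y by (simp add: pow_closed)
  also have "\<dots> = (\<sigma> ^^ (m * Suc n)) y \<otimes>\<^bsub>A\<^esub> c [^]\<^bsub>A\<^esub> Suc n"
    using y c_closed by (simp add: pow_closed \<sigma>.A.A.m_assoc funpow_add[symmetric, THEN fun_cong, unfolded o_def] add.commute)
  finally show ?case .
qed simp

section \<open>The value of a tree\<close>

text \<open>
  Evaluating a full tree multiplies its leaves in a twisted product and contributes one factor \<open>c\<close> for
  every vertex.  A factor \<open>c\<close> that is pushed to the right twists what it passes by \<open>\<sigma>\<^sup>m\<close>, which makes up
  exactly for the \<open>m\<close> additional leaves of the vertex that it belongs to.
\<close>

definition leaf_values :: "'a \<Rightarrow> 'a ptree \<Rightarrow> 'a list" where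
  "leaf_values x t = map (\<lambda>l. case l of None \<Rightarrow> x | Some a \<Rightarrow> a) (leaves t)"

definition tree_value :: "'a \<Rightarrow> 'a ptree \<Rightarrow> 'a" where
  "tree_value x t = sp (leaf_values x t) \<otimes>\<^bsub>A\<^esub> c [^]\<^bsub>A\<^esub> nodes t"

lemma leaf_values_subset:
  "\<lbrakk>full_ptree (carrier A) n t; x \<in> carrier A\<rbrakk> \<Longrightarrow> set (leaf_values x t) \<subseteq> carrier A"
  using leaves_subset[of "carrier A" n t] by (auto simp: leaf_values_def split: option.splits)

lemma tree_value_closed:
  "\<lbrakk>full_ptree (carrier A) n t; x \<in> carrier A\<rbrakk> \<Longrightarrow> tree_value x t \<in> carrier A"
  using leaf_values_subset[of n t x] c_closed by (simp add: tree_value_def)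

lemma sp_tree_values:
  assumes "\<forall>t\<in>set ts. full_ptree (carrier A) (Suc m) t" "x \<in> carrier A"
  shows "sp (map (tree_value x) ts)
    = sp (concat (map (leaf_values x) ts)) \<otimes>\<^bsub>A\<^esub> c [^]\<^bsub>A\<^esub> sum_list (map nodes ts)"
  using assms(1)
proof (induction ts)
  case (Cons t ts)
  let ?n = "nodes t" and ?N = "sum_list (map nodes ts)"
  let ?u = "sp (leaf_values x t)" and ?v = "sp (concat (map (leaf_values x) ts))"
  have l: "set (leaf_values x t) \<subseteq> carrier A" "set (concat (map (leaf_values x) ts)) \<subseteq> carrier A"
    using Cons.prems assms(2) leaf_values_subset[of "Suc m"] by auto
  then have cl: "?u \<in> carrier A" "?v \<in> carrier A" "\<sigma> ?v \<in> carrier A"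
    "c [^]\<^bsub>A\<^esub> ?n \<in> carrier A" "c [^]\<^bsub>A\<^esub> ?N \<in> carrier A" "(\<sigma> ^^ (m * ?n)) (\<sigma> ?v) \<in> carrier A"
    using c_closed by (simp_all add: \<sigma>.hom_closed pow_closed del: sum_list.Cons)
  have \<sigma>cN: "\<sigma> (c [^]\<^bsub>A\<^esub> ?N) = c [^]\<^bsub>A\<^esub> ?N"
  proof -
    have "\<sigma> (c [^]\<^bsub>A\<^esub> n) = c [^]\<^bsub>A\<^esub> n" for n :: nat
      by (induction n) (simp_all add: \<sigma>.hom_one \<sigma>.hom_mult c_closed \<sigma>_c)
    then show ?thesis .
  qed
  have "sp (map (tree_value x) (t # ts)) = (?u \<otimes>\<^bsub>A\<^esub> c [^]\<^bsub>A\<^esub> ?n) \<otimes>\<^bsub>A\<^esub> \<sigma> (?v \<otimes>\<^bsub>A\<^esub> c [^]\<^bsub>A\<^esub> ?N)"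
  proof -
    have "sp (map (tree_value x) ts) = ?v \<otimes>\<^bsub>A\<^esub> c [^]\<^bsub>A\<^esub> ?N" using Cons by simp
    then show ?thesis by (simp only: list.map twisted_prod.simps tree_value_def)
  qed
  also have "\<dots> = ?u \<otimes>\<^bsub>A\<^esub> (c [^]\<^bsub>A\<^esub> ?n \<otimes>\<^bsub>A\<^esub> \<sigma> ?v) \<otimes>\<^bsub>A\<^esub> c [^]\<^bsub>A\<^esub> ?N"
    using cl by (simp add: \<sigma>.hom_mult \<sigma>cN \<sigma>.A.A.m_assoc)
  also have "\<dots> = ?u \<otimes>\<^bsub>A\<^esub> (\<sigma> ^^ (m * ?n)) (\<sigma> ?v) \<otimes>\<^bsub>A\<^esub> (c [^]\<^bsub>A\<^esub> ?n \<otimes>\<^bsub>A\<^esub> c [^]\<^bsub>A\<^esub> ?N)"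
    unfolding c_pow_commute[OF cl(3)] using cl by (simp add: \<sigma>.A.A.m_assoc)
  also have "(\<sigma> ^^ (m * ?n)) (\<sigma> ?v) = (\<sigma> ^^ length (leaf_values x t)) ?v"
    using length_leaves[of "carrier A" m t] Cons.prems
    by (simp add: leaf_values_def funpow_swap1)
  also have "?u \<otimes>\<^bsub>A\<^esub> \<dots> = sp (concat (map (leaf_values x) (t # ts)))"
    using sp_append[OF l] by simp
  also have "c [^]\<^bsub>A\<^esub> ?n \<otimes>\<^bsub>A\<^esub> c [^]\<^bsub>A\<^esub> ?N = c [^]\<^bsub>A\<^esub> sum_list (map nodes (t # ts))"
    using c_closed by (simp add: \<sigma>.A.A.nat_pow_mult)
  finally show ?case .
qed simp

lemma tree_value_Node:
  assumes "full_ptree (carrier A) (Suc m) (Node ts)" "x \<in> carrier A"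
  shows "nary_mult A m \<sigma> c (map (tree_value x) ts) = tree_value x (Node ts)"
proof -
  have ts: "\<forall>t\<in>set ts. full_ptree (carrier A) (Suc m) t" "length ts = Suc m"
    using assms(1) unfolding full_Node by auto
  have c: "concat (map (leaf_values x) ts) = leaf_values x (Node ts)"
    by (simp add: leaf_values_def[abs_def] map_concat o_def)
  have l: "set (concat (map (leaf_values x) ts)) \<subseteq> carrier A"
    using leaf_values_subset[OF assms] unfolding c .
  have "nary_mult A m \<sigma> c (map (tree_value x) ts) = sp (map (tree_value x) ts) \<otimes>\<^bsub>A\<^esub> c"
    using ts assms(2) by (intro nary_eq) (auto intro: tree_value_closed)
  also have "\<dots> = tree_value x (Node ts)"
    unfolding sp_tree_values[OF ts(1) assms(2)] tree_value_def c[symmetric]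
    using l c_closed by (simp add: \<sigma>.A.A.m_assoc del: set_concat)
  finally show ?thesis .
qed

abbreviation "\<mu> \<equiv> nary_mult A m \<sigma> c"
abbreviation "reg \<equiv> regular_slot A m \<sigma> c"

text \<open>
  In the regular slot module the hole filled with \<open>x\<close> is just one more leaf with label \<open>x\<close>.  Hence
  evaluation depends only on the sequence of leaves and on the number of vertices, and rebracketing
  changes neither.
\<close>

lemma slot_eval_tree_value:
  assumes "full_ptree (carrier A) (Suc m) t" "x \<in> carrier A"
  shows "holes t = 0 \<Longrightarrow> slot_eval \<mu> reg x t = Inl (tree_value x t)"
    and "holes t = 1 \<Longrightarrow> slot_eval \<mu> reg x t = Inr (tree_value x t)"
proof -
  have "(holes t = 0 \<longrightarrow> slot_eval \<mu> reg x t = Inl (tree_value x t)) \<and>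
    (holes t = 1 \<longrightarrow> slot_eval \<mu> reg x t = Inr (tree_value x t))"
    using assms(1)
  proof (induction t)
    case Hole
    show ?case using assms(2) by (simp add: tree_value_def leaf_values_def \<sigma>.hom_one)
  next
    case (Leaf a)
    then show ?case by (simp add: tree_value_def leaf_values_def \<sigma>.hom_one)
  next
    case (Node ts)
    have full: "\<forall>t\<in>set ts. full_ptree (carrier A) (Suc m) t" using Node.prems unfolding full_Node by auto
    have Inl: "slot_eval \<mu> reg x t = Inl (tree_value x t)" if "t \<in> set ts" "holes t = 0" for t
      using Node.IH that full by blast
    have Inr: "slot_eval \<mu> reg x t = Inr (tree_value x t)" if "t \<in> set ts" "holes t = 1" for t
      using Node.IH that full by blast
    note val = tree_value_Node[OF Node.prems assms(2)]
    show ?case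
    proof (intro conjI impI)
      assume "holes (Node ts) = 0"
      then have m: "map (slot_eval \<mu> reg x) ts = map (\<lambda>t. Inl (tree_value x t)) ts"
        using Inl by simp
      have d: "dropWhile isl (map (\<lambda>t. Inl (tree_value x t) :: 'a + 'a) ts) = []"
        by (induction ts) auto
      show "slot_eval \<mu> reg x (Node ts) = Inl (tree_value x (Node ts))"
        unfolding slot_eval.simps(3) m vertex_eval_def d using val by (simp add: o_def)
    next
      assume one: "holes (Node ts) = 1"
      obtain us s ws where ts: "ts = us @ s # ws"
        and h: "holes s = 1" "\<forall>t\<in>set us. holes t = 0" "\<forall>t\<in>set ws. holes t = 0"
        using one_hole_Node[OF one] by metis
      have m: "map (slot_eval \<mu> reg x) ts = map (\<lambda>t. Inl (tree_value x t)) us @ Inr (tree_value x s)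
          # map (\<lambda>t. Inl (tree_value x t)) ws"
        using Inl Inr h unfolding ts by simp
      have d: "dropWhile isl (map (\<lambda>t. Inl (tree_value x t) :: 'a + 'a) us @ Inr y # zs) = Inr y # zs"
        "takeWhile isl (map (\<lambda>t. Inl (tree_value x t) :: 'a + 'a) us @ Inr y # zs)
          = map (\<lambda>t. Inl (tree_value x t)) us" for y zs us
        by (induction us) auto
      show "slot_eval \<mu> reg x (Node ts) = Inr (tree_value x (Node ts))"
        unfolding slot_eval.simps(3) m vertex_eval_def d using val
        by (simp add: o_def regular_slot_def ts)
    qed
  qed
  then show "holes t = 0 \<Longrightarrow> slot_eval \<mu> reg x t = Inl (tree_value x t)"
    and "holes t = 1 \<Longrightarrow> slot_eval \<mu> reg x t = Inr (tree_value x t)" by blast+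
qed

lemma context_action_regular:
  "\<lbrakk>t \<in> one_hole_contexts (carrier A) (Suc m); x \<in> carrier A\<rbrakk>
    \<Longrightarrow> context_action \<mu> reg t x = tree_value x t"
  by (simp add: context_action_def one_hole_contexts_def slot_eval_tree_value(2))

lemma regular_slot_eq:
  "\<lbrakk>set us \<subseteq> carrier A; set ws \<subseteq> carrier A; length us + length ws = m; x \<in> carrier A\<rbrakk>
    \<Longrightarrow> reg us x ws = sp (us @ x # ws) \<otimes>\<^bsub>A\<^esub> c"
  unfolding regular_slot_def by (rule nary_eq) auto

lemma regular_slot_module: "slot_module k A m \<sigma> c A reg"
proof -
  have assoc: "context_action \<mu> reg t x = context_action \<mu> reg t' x"
    if "t \<in> one_hole_contexts (carrier A) (Suc m)" "rebracket (Suc m) t t'" "x \<in> carrier A" for t t' x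
    using that rebracket_one_hole[OF that(2,1)] rebracket_invariants(1,2)[OF that(2)]
    by (simp add: context_action_regular tree_value_def leaf_values_def)
  have l_add: "sp (us @ (a \<oplus>\<^bsub>A\<^esub> b) # vs) \<otimes>\<^bsub>A\<^esub> c
      = sp (us @ a # vs) \<otimes>\<^bsub>A\<^esub> c \<oplus>\<^bsub>A\<^esub> sp (us @ b # vs) \<otimes>\<^bsub>A\<^esub> c"
    and l_smult: "r \<in> carrier k \<Longrightarrow> sp (us @ (r \<odot>\<^bsub>A\<^esub> a) # vs) \<otimes>\<^bsub>A\<^esub> c
      = r \<odot>\<^bsub>A\<^esub> (sp (us @ a # vs) \<otimes>\<^bsub>A\<^esub> c)"
    if "set us \<subseteq> carrier A" "set vs \<subseteq> carrier A" "a \<in> carrier A" "b \<in> carrier A" for us vs a b r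
    using that c_closed
    by (simp_all add: sp_add sp_smult \<sigma>.A.A.l_distr \<sigma>.A.smult_mult_left del: twisted_prod.simps)
  show ?thesis
  proof (unfold_locales, goal_cases)
    case (1 us ws x)
    then show ?case using c_closed by (simp add: regular_slot_eq del: twisted_prod.simps)
  next
    case (2 us ws x y)
    then show ?case by (simp add: regular_slot_eq l_add del: twisted_prod.simps)
  next
    case (3 us ws x r)
    then show ?case by (simp add: regular_slot_eq l_smult del: twisted_prod.simps)
  next
    case (4 us vs ws x a b)
    then show ?case using l_add[of us "vs @ x # ws" a b]
      by (simp add: regular_slot_eq del: twisted_prod.simps)
  next
    case (5 us vs ws x a r)
    then show ?case using l_smult[of us "vs @ x # ws" a a r]
      by (simp add: regular_slot_eq del: twisted_prod.simps)
  next
    case (6 us vs ws x a b)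
    then show ?case using l_add[of "us @ x # vs" ws a b]
      by (simp add: regular_slot_eq del: twisted_prod.simps)
  next
    case (7 us vs ws x a r)
    then show ?case using l_smult[of "us @ x # vs" ws a a r]
      by (simp add: regular_slot_eq del: twisted_prod.simps)
  next
    case (8 t t' x)
    then show ?case by (rule assoc)
  qed
qed

lemma regular_endpoint_anchored:
  "endpoint_anchored A m c A reg"
  unfolding endpoint_anchored_def
proof (intro ballI conjI)
  fix x assume x: "x \<in> carrier A"
  let ?d = "inv\<^bsub>A\<^esub> c"
  have d: "?d \<in> carrier A" "c \<otimes>\<^bsub>A\<^esub> ?d = \<one>\<^bsub>A\<^esub>" "?d \<otimes>\<^bsub>A\<^esub> c = \<one>\<^bsub>A\<^esub>" using c_unit by simp_all
  have "sp (x # replicate (m - 1) \<one>\<^bsub>A\<^esub> @ [?d]) = x \<otimes>\<^bsub>A\<^esub> (\<sigma> ^^ Suc (m - 1)) ?d"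
    using d(1) sp_ones_append[of "[?d]" "m - 1"] by (simp add: \<sigma>.hom_one)
  also have "Suc (m - 1) = m" using m_pos by simp
  finally show "reg [] x (replicate (m - 1) \<one>\<^bsub>A\<^esub> @ [?d]) = x"
    using x d c_closed m_pos
    by (subst regular_slot_eq) (auto simp: pow_closed \<sigma>.A.A.m_assoc \<sigma>_pow_m simp del: twisted_prod.simps)
  have "sp (?d # replicate (m - 1) \<one>\<^bsub>A\<^esub> @ [x]) = ?d \<otimes>\<^bsub>A\<^esub> (\<sigma> ^^ Suc (m - 1)) x"
    using x sp_ones_append[of "[x]" "m - 1"] by (simp add: \<sigma>.hom_one)
  also have "Suc (m - 1) = m" using m_pos by simp
  finally have eq: "sp (?d # replicate (m - 1) \<one>\<^bsub>A\<^esub> @ [x]) = ?d \<otimes>\<^bsub>A\<^esub> (\<sigma> ^^ m) x" .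
  have "reg (?d # replicate (m - 1) \<one>\<^bsub>A\<^esub>) x [] = sp (?d # replicate (m - 1) \<one>\<^bsub>A\<^esub> @ [x]) \<otimes>\<^bsub>A\<^esub> c"
    using x d m_pos by (subst regular_slot_eq) auto
  also have "\<dots> = ?d \<otimes>\<^bsub>A\<^esub> (c \<otimes>\<^bsub>A\<^esub> x)"
    unfolding eq using x d(1) c_closed by (simp add: pow_closed \<sigma>.A.A.m_assoc \<sigma>_pow_m)
  also have "\<dots> = x"
    using x d c_closed by (simp flip: \<sigma>.A.A.m_assoc)
  finally show "reg (?d # replicate (m - 1) \<one>\<^bsub>A\<^esub>) x [] = x" .
qed

lemma unit_context_action:
  assumes "c = \<one>\<^bsub>A\<^esub>" "i \<le> m" "x \<in> carrier A"
  shows "context_action \<mu> reg (unit_context A m i) x = (\<sigma> ^^ i) x"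
proof -
  have "unit_context A m i \<in> one_hole_contexts (carrier A) (Suc m)"
    using assms(2)
    by (auto simp: unit_context_def one_hole_contexts_def full_Node sum_list_replicate
        simp del: full_ptree.simps(3))
  moreover have "leaf_values x (unit_context A m i) = replicate i \<one>\<^bsub>A\<^esub> @ x # replicate (m - i) \<one>\<^bsub>A\<^esub>"
    by (simp add: unit_context_def leaf_values_def map_concat o_def concat_replicate_trivial
        flip: map_replicate_const)
  moreover have "sp (replicate i \<one>\<^bsub>A\<^esub> @ x # replicate (m - i) \<one>\<^bsub>A\<^esub>) = (\<sigma> ^^ i) x"
    using assms(3) by (subst sp_ones_append) (auto simp: sp_ones \<sigma>.hom_one)
  moreover have "c [^]\<^bsub>A\<^esub> n = \<one>\<^bsub>A\<^esub>" for n :: nat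
    unfolding assms(1) by simp
  ultimately show ?thesis
    using assms(3) by (simp add: context_action_regular tree_value_def pow_closed)
qed

end

section \<open>The monoid of one-hole contexts\<close>

lemma graft_full: "\<lbrakk>full_ptree S n t; full_ptree S n s\<rbrakk> \<Longrightarrow> full_ptree S n (graft t s)"
  by (induction t) (auto simp: list_all_iff)

lemma graft_holes: "holes (graft t s) = holes t * holes s"
proof (induction t)
  case (Node ts)
  then show ?case by (induction ts) (auto simp: algebra_simps)
qed auto

lemma graft_assoc: "graft (graft t s) r = graft t (graft s r)"
  by (induction t) auto

lemma graft_Hole: "graft t Hole = t"
  by (induction t) (auto intro: map_idI)

lemma graft_no_hole: "holes t = 0 \<Longrightarrow> graft t s = t"
  by (induction t) (auto intro!: map_idI)

lemma context_monoid: "Group.monoid (context_monoid S n)"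
  by (rule monoidI)
    (auto simp: context_monoid_def one_hole_contexts_def graft_full graft_holes graft_assoc graft_Hole)

text \<open>Subtrees of \<open>t\<close> without hole are unchanged by \<open>graft\<close>; what remains is the path to its one hole.\<close>

lemma graft_left_frame:
  assumes "holes t = 1"
  obtains Q where "tree_frame Q" "\<And>s. graft t s = Q s"
proof -
  have "\<exists>Q. tree_frame Q \<and> (\<forall>s. graft t s = Q s)"
    using assms
  proof (induction t)
    case Hole
    then show ?case by (intro exI[of _ "\<lambda>t. t"]) (auto intro: tree_frame.here)
  next
    case (Leaf a)
    then show ?case by simp
  next
    case (Node ts)
    obtain us s ws where ts: "ts = us @ s # ws" "holes s = 1"
      "\<forall>t\<in>set us. holes t = 0" "\<forall>t\<in>set ws. holes t = 0"
      using one_hole_Node[OF Node.prems] by metis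
    moreover obtain Q where "tree_frame Q" "\<forall>r. graft s r = Q r"
      using Node.IH[of s] ts by auto
    moreover have "map (\<lambda>t. graft t r) us = us" "map (\<lambda>t. graft t r) ws = ws" for r
      using ts by (auto intro!: map_idI graft_no_hole)
    ultimately show ?case
      by (intro exI[of _ "\<lambda>r. Node (us @ Q r # ws)"]) (simp add: tree_frame.below)
  qed
  then show ?thesis using that by blast
qed

text \<open>
  Here the hole may lie in the frame or below it.  In the former case the frame absorbs \<open>s\<close>, and the
  inserted tree is left alone by \<open>graft\<close>.
\<close>

lemma graft_right_frame:
  assumes "tree_frame P"
  obtains Q where "tree_frame Q" "\<And>t. graft (P t) s = Q (graft t s)"
proof -
  have "\<exists>Q. tree_frame Q \<and> (\<forall>t. graft (P t) s = Q (graft t s))"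
    using assms
  proof induction
    case here
    show ?case by (intro exI[of _ "\<lambda>t. t"]) (auto intro: tree_frame.here)
  next
    case (below P us ws)
    then obtain Q where "tree_frame Q" "\<forall>t. graft (P t) s = Q (graft t s)" by blast
    then show ?case
      by (intro exI[of _ "\<lambda>t. Node (map (\<lambda>u. graft u s) us @ Q t # map (\<lambda>u. graft u s) ws)"])
        (simp add: tree_frame.below)
  qed
  then show ?thesis using that by blast
qed

lemma rebracket_in_frame:
  assumes "rebracket n t t'" "tree_frame Q"
  shows "rebracket n (Q t) (Q t')"
  using assms(1)
proof cases
  case (1 P vs vs' us ws us' ws')
  show ?thesis unfolding 1(1,2)
    by (rule rebracket.intros[OF frame_compose[OF assms(2) 1(3)] 1(4-)])
qed

lemma rebracket_graft:
  assumes "rebracket n t t'"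
  shows "rebracket n (graft t s) (graft t' s)"
  using assms
proof cases
  case (1 P vs vs' us ws us' ws')
  obtain Q where Q: "tree_frame Q" "\<And>t. graft (P t) s = Q (graft t s)"
    using graft_right_frame[OF 1(3), of s] by metis
  let ?g = "map (\<lambda>u. graft u s)"
  have "rebracket n (Q (Node (?g us @ Node (?g vs) # ?g ws))) (Q (Node (?g us' @ Node (?g vs') # ?g ws')))"
  proof (rule rebracket.intros[OF Q(1)])
    show "?g us @ ?g vs @ ?g ws = ?g us' @ ?g vs' @ ?g ws'"
      using arg_cong[OF 1(8), of ?g] by simp
  qed (use 1 in auto)
  then show ?thesis unfolding 1(1,2) Q(2) by simp
qed

section \<open>The slot envelope and its anchored quotient\<close>

context twisted_algebra
begin

abbreviation "T \<equiv> one_hole_contexts (carrier A) (Suc m)"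

lemma context_monoid_alg: "monoid_alg k (context_monoid (carrier A) (Suc m))"
  by (intro monoid_alg.intro context_monoid \<sigma>.M.R.cring_axioms)

sublocale C: monoid_alg k "context_monoid (carrier A) (Suc m)"
  by (rule context_monoid_alg)

lemma context_algebra: "context_algebra k A m = C.F"
  by (simp add: context_algebra_def)

lemma context_monoid_simps:
  "carrier (context_monoid S n) = one_hole_contexts S n"
  "mult (context_monoid S n) = graft" "one (context_monoid S n) = Hole"
  by (simp_all add: context_monoid_def)

lemma graft_T: "\<lbrakk>t \<in> T; s \<in> T\<rbrakk> \<Longrightarrow> graft t s \<in> T"
  by (simp add: one_hole_contexts_def graft_full graft_holes)

lemma replace_leaf_T: "\<lbrakk>tree_frame P; P (Leaf a) \<in> T; b \<in> carrier A\<rbrakk> \<Longrightarrow> P (Leaf b) \<in> T"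
  by (erule (1) frame_replace) simp_all

lemma contract_T:
  assumes "tree_frame P" "P (Node (map Leaf as)) \<in> T"
  shows "set as \<subseteq> carrier A" "length as = Suc m" "\<mu> as \<in> carrier A" "P (Leaf (\<mu> as)) \<in> T"
proof -
  have "full_ptree (carrier A) (Suc m) (Node (map Leaf as))"
    using assms(2) frame_full_inner[OF assms(1)] unfolding one_hole_contexts_def by blast
  then show as: "set as \<subseteq> carrier A" "length as = Suc m" unfolding full_Node by auto
  then show m: "\<mu> as \<in> carrier A" by (simp add: nary_eq c_closed)
  show "P (Leaf (\<mu> as)) \<in> T"
    by (rule frame_replace[OF assms]) (simp_all add: m o_def)
qed

lemma e_closed: "t \<in> T \<Longrightarrow> C.e t \<in> carrier C.F"
  by (rule C.basis_closed) (simp add: context_monoid_simps)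

lemma e_mult: "\<lbrakk>s \<in> T; t \<in> T\<rbrakk> \<Longrightarrow> C.e s \<otimes>\<^bsub>C.F\<^esub> C.e t = C.e (graft s t)"
  using C.basis_mult[of s t] by (simp add: context_monoid_simps)

abbreviation "rels \<equiv> envelope_rels k A m \<sigma> c"

lemma rel_intros:
  "\<lbrakk>tree_frame P; a \<in> carrier A; b \<in> carrier A; P (Leaf a) \<in> T\<rbrakk>
    \<Longrightarrow> C.e (P (Leaf (a \<oplus>\<^bsub>A\<^esub> b))) \<ominus>\<^bsub>C.F\<^esub> (C.e (P (Leaf a)) \<oplus>\<^bsub>C.F\<^esub> C.e (P (Leaf b))) \<in> rels"
  "\<lbrakk>tree_frame P; r \<in> carrier k; a \<in> carrier A; P (Leaf a) \<in> T\<rbrakk>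
    \<Longrightarrow> C.e (P (Leaf (r \<odot>\<^bsub>A\<^esub> a))) \<ominus>\<^bsub>C.F\<^esub> r \<odot>\<^bsub>C.F\<^esub> C.e (P (Leaf a)) \<in> rels"
  "\<lbrakk>tree_frame P; P (Node (map Leaf as)) \<in> T\<rbrakk>
    \<Longrightarrow> C.e (P (Node (map Leaf as))) \<ominus>\<^bsub>C.F\<^esub> C.e (P (Leaf (\<mu> as))) \<in> rels"
  "\<lbrakk>t \<in> T; rebracket (Suc m) t t'\<rbrakk> \<Longrightarrow> C.e t \<ominus>\<^bsub>C.F\<^esub> C.e t' \<in> rels"
  unfolding envelope_rels_def Let_def context_algebra by blast+

lemma rel_cases:
  assumes "s \<in> rels"
  obtains P a b where "tree_frame P" "a \<in> carrier A" "b \<in> carrier A" "P (Leaf a) \<in> T"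
      "s = C.e (P (Leaf (a \<oplus>\<^bsub>A\<^esub> b))) \<ominus>\<^bsub>C.F\<^esub> (C.e (P (Leaf a)) \<oplus>\<^bsub>C.F\<^esub> C.e (P (Leaf b)))"
    | P r a where "tree_frame P" "r \<in> carrier k" "a \<in> carrier A" "P (Leaf a) \<in> T"
      "s = C.e (P (Leaf (r \<odot>\<^bsub>A\<^esub> a))) \<ominus>\<^bsub>C.F\<^esub> r \<odot>\<^bsub>C.F\<^esub> C.e (P (Leaf a))"
    | P as where "tree_frame P" "P (Node (map Leaf as)) \<in> T"
      "s = C.e (P (Node (map Leaf as))) \<ominus>\<^bsub>C.F\<^esub> C.e (P (Leaf (\<mu> as)))"
    | t t' where "t \<in> T" "rebracket (Suc m) t t'" "s = C.e t \<ominus>\<^bsub>C.F\<^esub> C.e t'"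
  using assms unfolding envelope_rels_def Let_def context_algebra
  by (elim UnE CollectE exE conjE) (rule that; assumption)+

lemma rels_closed: "rels \<subseteq> carrier C.F"
proof
  fix s assume "s \<in> rels"
  then show "s \<in> carrier C.F"
  proof (cases rule: rel_cases)
    case (1 P a b)
    then show ?thesis using replace_leaf_T[OF 1(1,4)] by (simp add: e_closed C.F.M.minus_closed)
  next
    case (2 P r a)
    then show ?thesis using replace_leaf_T[OF 2(1,4)] by (simp add: e_closed C.F.M.minus_closed)
  next
    case (3 P as)
    then show ?thesis using contract_T[OF 3(1,2)] by (simp add: e_closed C.F.M.minus_closed)
  next
    case (4 t t')
    then show ?thesis using rebracket_one_hole[OF 4(2,1)] by (simp add: e_closed C.F.M.minus_closed)
  qed
qed

text \<open>
  Grafting a context with one hole onto a relation in a frame, from either side, yields the same kind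
  of relation in a larger frame.
\<close>

lemma rels_mult_left:
  assumes s: "s \<in> rels" and g: "g \<in> T"
  shows "C.e g \<otimes>\<^bsub>C.F\<^esub> s \<in> rels"
proof -
  have "holes g = 1" using g by (simp add: one_hole_contexts_def)
  then obtain Q where Q: "tree_frame Q" "\<And>s. graft g s = Q s"
    using graft_left_frame by metis
  interpret l: linear_map k C.F C.F "\<lambda>u. C.e g \<otimes>\<^bsub>C.F\<^esub> u"
    by (rule C.F.left_mult_linear) (rule e_closed[OF g])
  have Q_T: "Q t \<in> T" if "t \<in> T" for t using graft_T[OF g that] by (simp add: Q)
  have Q_e: "C.e g \<otimes>\<^bsub>C.F\<^esub> C.e t = C.e (Q t)" if "t \<in> T" for t using e_mult[OF g that] by (simp add: Q)
  note simps = l.hom_minus l.hom_add l.hom_smult e_closed Q_e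
  from s show ?thesis
  proof (cases rule: rel_cases)
    case (1 P a b)
    then show ?thesis using replace_leaf_T[OF 1(1,4)] rel_intros(1)[OF frame_compose[OF Q(1) 1(1)] 1(2,3)] Q_T
      by (simp add: simps)
  next
    case (2 P r a)
    then show ?thesis using replace_leaf_T[OF 2(1,4)] rel_intros(2)[OF frame_compose[OF Q(1) 2(1)] 2(2,3)] Q_T
      by (simp add: simps)
  next
    case (3 P as)
    then show ?thesis using contract_T[OF 3(1,2)] rel_intros(3)[OF frame_compose[OF Q(1) 3(1)], of as] Q_T
      by (simp add: simps)
  next
    case (4 t t')
    then show ?thesis using rebracket_one_hole[OF 4(2,1)] rel_intros(4)[OF Q_T rebracket_in_frame[OF 4(2) Q(1)]]
      by (simp add: simps)
  qed
qed

lemma rels_mult_right: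
  assumes s: "s \<in> rels" and g: "g \<in> T"
  shows "s \<otimes>\<^bsub>C.F\<^esub> C.e g \<in> rels"
proof -
  interpret r: linear_map k C.F C.F "\<lambda>u. u \<otimes>\<^bsub>C.F\<^esub> C.e g"
    by (rule C.F.right_mult_linear) (rule e_closed[OF g])
  note simps = r.hom_minus r.hom_add r.hom_smult e_closed e_mult g
  from s show ?thesis
  proof (cases rule: rel_cases)
    case (1 P a b)
    obtain Q where Q: "tree_frame Q" "\<And>t. graft (P t) g = Q (graft t g)"
      using graft_right_frame[OF 1(1)] by metis
    have "Q (Leaf a) \<in> T" using graft_T[OF 1(4) g] by (simp add: Q)
    then show ?thesis using replace_leaf_T[OF 1(1,4)] rel_intros(1)[OF Q(1) 1(2,3)] 1
      by (simp add: simps Q)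
  next
    case (2 P r a)
    obtain Q where Q: "tree_frame Q" "\<And>t. graft (P t) g = Q (graft t g)"
      using graft_right_frame[OF 2(1)] by metis
    have "Q (Leaf a) \<in> T" using graft_T[OF 2(4) g] by (simp add: Q)
    then show ?thesis using replace_leaf_T[OF 2(1,4)] rel_intros(2)[OF Q(1) 2(2,3)] 2
      by (simp add: simps Q)
  next
    case (3 P as)
    obtain Q where Q: "tree_frame Q" "\<And>t. graft (P t) g = Q (graft t g)"
      using graft_right_frame[OF 3(1)] by metis
    have l: "graft (Node (map Leaf as)) g = Node (map Leaf as)" by simp
    have "Q (Node (map Leaf as)) \<in> T" using graft_T[OF 3(2) g] unfolding Q(2) l .
    from rel_intros(3)[OF Q(1) this] show ?thesis using contract_T[OF 3(1,2)] 3 l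
      by (simp add: simps Q del: graft.simps(3))
  next
    case (4 t t')
    then show ?thesis using rebracket_one_hole[OF 4(2,1)]
        rel_intros(4)[OF graft_T[OF 4(1) g] rebracket_graft[OF 4(2), of g]]
      by (simp add: simps)
  qed
qed

abbreviation "ker \<equiv> envelope_ker k A m \<sigma> c"
abbreviation "U \<equiv> slot_envelope k A m \<sigma> c"
abbreviation "cls \<equiv> context_class k A m \<sigma> c"

lemma ker_eq: "ker = module_span k C.F rels"
  by (simp add: envelope_ker_def context_algebra)

lemma U_eq: "U = quotient_algebra C.F ker"
  by (simp add: slot_envelope_def context_algebra)

lemma cls_eq: "cls t = ker +>\<^bsub>C.F\<^esub> C.e t"
  by (simp add: context_class_def context_algebra)

lemma ker_ideal: "algebra_ideal k C.F ker"
  unfolding ker_eq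
proof (rule C.span_ideal[OF rels_closed])
  fix s g assume "s \<in> rels" "g \<in> carrier (context_monoid (carrier A) (Suc m))"
  then show "C.e g \<otimes>\<^bsub>C.F\<^esub> s \<in> module_span k C.F rels" "s \<otimes>\<^bsub>C.F\<^esub> C.e g \<in> module_span k C.F rels"
    using rels_mult_left rels_mult_right C.F.span_superset[of rels] by (auto simp: context_monoid_simps)
qed

lemma U_k_algebra: "k_algebra k U"
  unfolding U_eq by (rule algebra_ideal.quotient_k_algebra[OF ker_ideal])

lemma proj_U: "k_algebra_hom k C.F U (\<lambda>x. ker +>\<^bsub>C.F\<^esub> x)"
  unfolding U_eq by (rule algebra_ideal.proj_hom[OF ker_ideal])

abbreviation "left_anchor \<equiv> Node (Hole # replicate (m - 1) (Leaf \<one>\<^bsub>A\<^esub>) @ [Leaf (inv\<^bsub>A\<^esub> c)])"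
abbreviation "right_anchor \<equiv> Node (Leaf (inv\<^bsub>A\<^esub> c) # replicate (m - 1) (Leaf \<one>\<^bsub>A\<^esub>) @ [Hole])"

lemma anchors_T: "left_anchor \<in> T" "right_anchor \<in> T"
  using m_pos c_unit
  by (auto simp: one_hole_contexts_def full_Node sum_list_replicate simp del: full_ptree.simps(3))

lemma cls_closed: "t \<in> T \<Longrightarrow> cls t \<in> carrier U"
proof -
  interpret k_algebra_hom k C.F U "\<lambda>x. ker +>\<^bsub>C.F\<^esub> x" by (rule proj_U)
  show "t \<in> T \<Longrightarrow> cls t \<in> carrier U" unfolding cls_eq by (intro hom_closed e_closed)
qed

abbreviation "anchors \<equiv> anchor_rels k A m \<sigma> c"
abbreviation "V \<equiv> anchored_envelope k A m \<sigma> c"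
abbreviation "anchor_ideal \<equiv> genideal U anchors"

lemma anchors_eq: "anchors = {cls left_anchor \<ominus>\<^bsub>U\<^esub> \<one>\<^bsub>U\<^esub>, cls right_anchor \<ominus>\<^bsub>U\<^esub> \<one>\<^bsub>U\<^esub>}"
  by (simp add: anchor_rels_def Let_def)

lemma anchors_closed: "anchors \<subseteq> carrier U"
proof -
  interpret U: k_algebra k U by (rule U_k_algebra)
  show ?thesis using anchors_T by (simp add: anchors_eq cls_closed U.M.minus_closed)
qed

lemma anchor_ideal: "algebra_ideal k U anchor_ideal"
proof -
  interpret U: k_algebra k U by (rule U_k_algebra)
  show ?thesis
    by (intro algebra_ideal.intro U_k_algebra U.A.genideal_ideal anchors_closed)
qed

lemma V_eq: "V = quotient_algebra U anchor_ideal"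
  by (simp add: anchored_envelope_def)

lemma V_k_algebra: "k_algebra k V"
  unfolding V_eq by (rule algebra_ideal.quotient_k_algebra[OF anchor_ideal])

lemma proj_V: "k_algebra_hom k U V (\<lambda>x. anchor_ideal +>\<^bsub>U\<^esub> x)"
  unfolding V_eq by (rule algebra_ideal.proj_hom[OF anchor_ideal])

abbreviation "acls t \<equiv> anchor_ideal +>\<^bsub>U\<^esub> cls t"

end

text \<open>
  Functions on contexts that satisfy the defining relations of the anchored envelope.  The envelope
  carries the universal one; the other instance of interest is the skew group algebra.  Working with
  an arbitrary representation keeps cosets out of the computations with contexts.
\<close>

locale anchored_rep = twisted_algebra k A \<sigma> m c + R: k_algebra k R
  for k :: "('k, 'x) ring_scheme" (structure) and A :: "('k, 'a, 'y) module_scheme"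
    and \<sigma> :: "'a \<Rightarrow> 'a" and m c and R :: "('k, 'r, 'z) module_scheme" +
  fixes \<rho> :: "'a ptree \<Rightarrow> 'r"
  assumes rho_closed: "t \<in> T \<Longrightarrow> \<rho> t \<in> carrier R"
    and rho_graft: "\<lbrakk>s \<in> T; t \<in> T\<rbrakk> \<Longrightarrow> \<rho> (graft s t) = \<rho> s \<otimes>\<^bsub>R\<^esub> \<rho> t"
    and rho_Hole: "\<rho> Hole = \<one>\<^bsub>R\<^esub>"
    and rho_add: "\<lbrakk>tree_frame P; a \<in> carrier A; b \<in> carrier A; P (Leaf a) \<in> T\<rbrakk>
      \<Longrightarrow> \<rho> (P (Leaf (a \<oplus>\<^bsub>A\<^esub> b))) = \<rho> (P (Leaf a)) \<oplus>\<^bsub>R\<^esub> \<rho> (P (Leaf b))"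
    and rho_smult: "\<lbrakk>tree_frame P; r \<in> carrier k; a \<in> carrier A; P (Leaf a) \<in> T\<rbrakk>
      \<Longrightarrow> \<rho> (P (Leaf (r \<odot>\<^bsub>A\<^esub> a))) = r \<odot>\<^bsub>R\<^esub> \<rho> (P (Leaf a))"
    and rho_contract: "\<lbrakk>tree_frame P; P (Node (map Leaf as)) \<in> T\<rbrakk>
      \<Longrightarrow> \<rho> (P (Node (map Leaf as))) = \<rho> (P (Leaf (\<mu> as)))"
    and rho_rebracket: "\<lbrakk>t \<in> T; rebracket (Suc m) t t'\<rbrakk> \<Longrightarrow> \<rho> t = \<rho> t'"
    and rho_anchors: "\<rho> left_anchor = \<one>\<^bsub>R\<^esub>" "\<rho> right_anchor = \<one>\<^bsub>R\<^esub>"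

lemma (in twisted_algebra) envelope_rep: "anchored_rep k A \<sigma> m c V (\<lambda>t. acls t)"
proof -
  interpret U: k_algebra k U by (rule U_k_algebra)
  interpret V: k_algebra k V by (rule V_k_algebra)
  interpret p: k_algebra_hom k C.F U "\<lambda>x. ker +>\<^bsub>C.F\<^esub> x" by (rule proj_U)
  interpret q: k_algebra_hom k U V "\<lambda>x. anchor_ideal +>\<^bsub>U\<^esub> x" by (rule proj_V)
  let ?p = "\<lambda>x. ker +>\<^bsub>C.F\<^esub> x"
  have rel: "?p x = ?p y" if "x \<ominus>\<^bsub>C.F\<^esub> y \<in> rels" "x \<in> carrier C.F" "y \<in> carrier C.F" for x y
  proof (rule U.M.eq_if_minus_zero[OF _ p.hom_closed[OF that(2)] p.hom_closed[OF that(3)]])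
    have "x \<ominus>\<^bsub>C.F\<^esub> y \<in> ker" unfolding ker_eq using C.F.span_superset that(1) by blast
    then show "?p x \<ominus>\<^bsub>U\<^esub> ?p y = \<zero>\<^bsub>U\<^esub>"
      unfolding p.hom_minus[OF that(2,3), symmetric] unfolding U_eq
      by (rule algebra_ideal.proj_eq_zero[OF ker_ideal])
  qed
  have anchor: "acls t = \<one>\<^bsub>V\<^esub>" if "cls t \<ominus>\<^bsub>U\<^esub> \<one>\<^bsub>U\<^esub> \<in> anchors" "t \<in> T" for t
  proof -
    have "cls t \<ominus>\<^bsub>U\<^esub> \<one>\<^bsub>U\<^esub> \<in> anchor_ideal" using U.A.genideal_self[OF anchors_closed] that(1) by blast
    then have "acls t \<ominus>\<^bsub>V\<^esub> (anchor_ideal +>\<^bsub>U\<^esub> \<one>\<^bsub>U\<^esub>) = \<zero>\<^bsub>V\<^esub>"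
      unfolding q.hom_minus[OF cls_closed[OF that(2)] U.A.one_closed, symmetric] unfolding V_eq
      by (rule algebra_ideal.proj_eq_zero[OF anchor_ideal])
    then show ?thesis
      unfolding q.hom_one by (rule V.M.eq_if_minus_zero) (simp_all add: q.hom_closed cls_closed that(2))
  qed
  show ?thesis
  proof (unfold_locales, goal_cases)
    case (1 t)
    then show ?case by (intro q.hom_closed cls_closed)
  next
    case (2 s t)
    then have "cls (graft s t) = cls s \<otimes>\<^bsub>U\<^esub> cls t"
      unfolding cls_eq by (simp add: e_mult[symmetric] p.hom_mult e_closed)
    then show ?case using 2 by (simp add: q.hom_mult cls_closed)
  next
    case 3
    have "cls Hole = \<one>\<^bsub>U\<^esub>"
      unfolding cls_eq p.hom_one[symmetric] C.basis_one by (simp add: context_monoid_simps)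
    then show ?case by (simp add: q.hom_one)
  next
    case (4 P a b)
    note T = replace_leaf_T[OF 4(1,4)]
    have "cls (P (Leaf (a \<oplus>\<^bsub>A\<^esub> b))) = cls (P (Leaf a)) \<oplus>\<^bsub>U\<^esub> cls (P (Leaf b))"
      unfolding cls_eq using rel[OF rel_intros(1)[OF 4]] 4 T
      by (simp add: e_closed p.hom_add)
    then show ?case using 4 T by (simp add: q.hom_add cls_closed)
  next
    case (5 P r a)
    note T = replace_leaf_T[OF 5(1,4)]
    have "cls (P (Leaf (r \<odot>\<^bsub>A\<^esub> a))) = r \<odot>\<^bsub>U\<^esub> cls (P (Leaf a))"
      unfolding cls_eq using rel[OF rel_intros(2)[OF 5]] 5 T
      by (simp add: e_closed p.hom_smult)
    then show ?case using 5 T by (simp add: q.hom_smult cls_closed)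
  next
    case (6 P as)
    then show ?case
      unfolding cls_eq using rel[OF rel_intros(3)[OF 6]] contract_T[OF 6] by (simp add: e_closed)
  next
    case (7 t t')
    then show ?case
      unfolding cls_eq using rel[OF rel_intros(4)[OF 7]] rebracket_one_hole[OF 7(2,1)] by (simp add: e_closed)
  next
    case 8
    show ?case by (rule anchor[OF _ anchors_T(1)]) (simp add: anchors_eq)
  next
    case 9
    show ?case by (rule anchor[OF _ anchors_T(2)]) (simp add: anchors_eq)
  qed
qed

text \<open>
  The linear extension of \<open>\<rho>\<close> is multiplicative.  It kills the relations between contexts, so it factors
  through the slot envelope; the kernel of the factored map is an ideal containing the anchor
  relations, so it factors once more.
\<close>

theorem (in anchored_rep) anchored_envelope_universal:
  obtains h where "k_algebra_hom k V R h" "\<And>t. t \<in> T \<Longrightarrow> h (acls t) = \<rho> t"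
proof -
  let ?L = "lin_ext k R \<rho>"
  have R: "module k R" ..
  have \<rho>: "\<rho> t \<in> carrier R" if "t \<in> carrier (context_monoid (carrier A) (Suc m))" for t
    using that rho_closed by (simp add: context_monoid_simps)
  interpret L: k_algebra_hom k C.F R ?L
    by (rule C.lin_ext_hom) (use rho_closed rho_graft rho_Hole R.k_algebra_axioms in \<open>auto simp: context_monoid_simps\<close>)
  have L_e: "?L (C.e t) = \<rho> t" if "t \<in> T" for t
    using C.lin_ext_basis[OF R, of \<rho> t, OF \<rho>] that by (simp add: context_monoid_simps)
  have "?L s = \<zero>\<^bsub>R\<^esub>" if "s \<in> rels" for s
    using that
  proof (cases rule: rel_cases)
    case (1 P a b)
    then show ?thesis using replace_leaf_T[OF 1(1,4)]
      by (simp add: L.hom_minus L.hom_add e_closed L_e rho_add rho_closed) (simp add: a_minus_def R.M.r_neg rho_closed)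
  next
    case (2 P r a)
    then show ?thesis using replace_leaf_T[OF 2(1,4)]
      by (simp add: L.hom_minus L.hom_smult e_closed L_e rho_smult rho_closed) (simp add: a_minus_def R.M.r_neg rho_closed)
  next
    case (3 P as)
    then show ?thesis using contract_T[OF 3(1,2)]
      by (simp add: L.hom_minus e_closed L_e rho_contract rho_closed) (simp add: a_minus_def R.M.r_neg rho_closed)
  next
    case (4 t t')
    then show ?thesis using rebracket_one_hole[OF 4(2,1)] rho_rebracket[OF 4(1,2)]
      by (simp add: L.hom_minus e_closed L_e rho_closed) (simp add: a_minus_def R.M.r_neg rho_closed)
  qed
  then have L_ker: "?L x = \<zero>\<^bsub>R\<^esub>" if "x \<in> ker" for x
    using L.vanishes_on_span[OF rels_closed] that unfolding ker_eq by blast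
  define f where "f = (\<lambda>Y. the_elem (?L ` Y))"
  interpret U: k_algebra k U by (rule U_k_algebra)
  interpret f: k_algebra_hom k U R f
    unfolding U_eq f_def by (rule algebra_ideal.lift_hom[OF ker_ideal L.k_algebra_hom_axioms L_ker])
  have f_cls: "f (cls t) = \<rho> t" if "t \<in> T" for t
    using algebra_ideal.lift_proj[OF ker_ideal L.linear_map_axioms L_ker e_closed[OF that]]
    by (simp add: f_def cls_eq L_e that)
  interpret fr: ring_hom_ring U R f
    by (rule ring_hom_ringI2[OF U.A.ring_axioms R.A.ring_axioms f.ring_hom])
  have "f (cls t \<ominus>\<^bsub>U\<^esub> \<one>\<^bsub>U\<^esub>) = \<zero>\<^bsub>R\<^esub>" if "t \<in> T" "\<rho> t = \<one>\<^bsub>R\<^esub>" for t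
    unfolding f.hom_minus[OF cls_closed[OF that(1)] U.A.one_closed] f_cls[OF that(1)] f.hom_one that(2)
    by (simp add: a_minus_def R.M.r_neg)
  from this[OF anchors_T(1) rho_anchors(1)] this[OF anchors_T(2) rho_anchors(2)]
  have "f s = \<zero>\<^bsub>R\<^esub>" if "s \<in> anchors" for s
    using that unfolding anchors_eq by blast
  then have "anchors \<subseteq> a_kernel U R f"
    using anchors_closed unfolding a_kernel_def' by blast
  then have "anchor_ideal \<subseteq> a_kernel U R f"
    by (rule U.A.genideal_minimal[OF fr.kernel_is_ideal])
  then have f_anchor: "f x = \<zero>\<^bsub>R\<^esub>" if "x \<in> anchor_ideal" for x
    using that unfolding a_kernel_def' by blast
  show thesis
  proof
    show "k_algebra_hom k V R (\<lambda>Y. the_elem (f ` Y))"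
      unfolding V_eq by (rule algebra_ideal.lift_hom[OF anchor_ideal f.k_algebra_hom_axioms f_anchor])
    show "the_elem (f ` acls t) = \<rho> t" if "t \<in> T" for t
      using algebra_ideal.lift_proj[OF anchor_ideal f.linear_map_axioms f_anchor cls_closed[OF that]]
      by (simp add: f_cls that)
  qed
qed

lemma (in twisted_algebra) linear_eq_on_classes:
  assumes h: "linear_map k V M h" and h': "linear_map k V M h'"
    and eq: "\<And>t. t \<in> T \<Longrightarrow> h (acls t) = h' (acls t)" and Y: "Y \<in> carrier V"
  shows "h Y = h' Y"
proof -
  interpret q: k_algebra_hom k U V "\<lambda>x. anchor_ideal +>\<^bsub>U\<^esub> x" by (rule proj_V)
  obtain x where x: "x \<in> carrier U" "Y = anchor_ideal +>\<^bsub>U\<^esub> x"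
    using Y algebra_ideal.quotient_carrier[OF anchor_ideal] unfolding V_eq by auto
  have "h (anchor_ideal +>\<^bsub>U\<^esub> x) = h' (anchor_ideal +>\<^bsub>U\<^esub> x)"
  proof (rule C.linear_eq_on_quotient[OF ker_ideal, folded U_eq, OF _ _ _ x(1)])
    show "linear_map k U M (\<lambda>x. h (anchor_ideal +>\<^bsub>U\<^esub> x))"
      by (rule linear_map_compose[OF q.linear_map_axioms h])
    show "linear_map k U M (\<lambda>x. h' (anchor_ideal +>\<^bsub>U\<^esub> x))"
      by (rule linear_map_compose[OF q.linear_map_axioms h'])
  qed (use eq in \<open>simp add: context_monoid_simps cls_eq\<close>)
  then show ?thesis by (simp add: x)
qed

section \<open>Contraction and regrouping in anchored representations\<close>

context anchored_rep
begin

text \<open>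
  Each of the trees \<open>ss\<close> may be replaced by a leaf on its own, its siblings then being part of the frame;
  the induction replaces them from left to right.
\<close>

lemma contract_siblings:
  assumes "\<And>s P. \<lbrakk>s \<in> set ss; tree_frame P; P s \<in> T\<rbrakk> \<Longrightarrow> \<rho> (P s) = \<rho> (P (Leaf (tree_value \<one>\<^bsub>A\<^esub> s)))"
    and "\<And>s. s \<in> set ss \<Longrightarrow> holes s = 0 \<and> full_ptree (carrier A) (Suc m) s"
    and "tree_frame P" "P (Node (xs @ ss @ ys)) \<in> T"
  shows "\<rho> (P (Node (xs @ ss @ ys))) = \<rho> (P (Node (xs @ map Leaf (map (tree_value \<one>\<^bsub>A\<^esub>) ss) @ ys)))
    \<and> P (Node (xs @ map Leaf (map (tree_value \<one>\<^bsub>A\<^esub>) ss) @ ys)) \<in> T"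
  using assms
proof (induction ss arbitrary: xs)
  case (Cons s ss)
  let ?l = "Leaf (tree_value \<one>\<^bsub>A\<^esub> s)"
  let ?Q = "\<lambda>t. P (Node (xs @ t # ss @ ys))"
  have Q: "tree_frame ?Q"
    using frame_compose[OF Cons.prems(3) tree_frame.below[OF tree_frame.here, of xs "ss @ ys"]] .
  have T: "?Q s \<in> T" using Cons.prems(4) by simp
  have s: "holes s = 0" "full_ptree (carrier A) (Suc m) s" using Cons.prems(2) by auto
  have l: "?Q ?l \<in> T"
    using frame_replace[OF Q T, of ?l] s tree_value_closed[OF s(2)] by simp
  have "\<rho> (?Q s) = \<rho> (?Q ?l)" by (rule Cons.prems(1)[OF _ Q T]) simp
  moreover have "\<rho> (P (Node ((xs @ [?l]) @ ss @ ys)))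
      = \<rho> (P (Node ((xs @ [?l]) @ map Leaf (map (tree_value \<one>\<^bsub>A\<^esub>) ss) @ ys)))
    \<and> P (Node ((xs @ [?l]) @ map Leaf (map (tree_value \<one>\<^bsub>A\<^esub>) ss) @ ys)) \<in> T"
  proof (rule Cons.IH)
    show "\<rho> (P' r) = \<rho> (P' (Leaf (tree_value \<one>\<^bsub>A\<^esub> r)))" if "r \<in> set ss" "tree_frame P'" "P' r \<in> T" for r P'
      using Cons.prems(1)[OF _ that(2,3)] that(1) by simp
    show "holes r = 0 \<and> full_ptree (carrier A) (Suc m) r" if "r \<in> set ss" for r
      using Cons.prems(2)[of r] that by simp
  qed (use Cons.prems(3) l in simp_all)
  ultimately show ?case by simp
qed simp

text \<open>
  The argument \<open>1\<close> of \<open>tree_value\<close> is a dummy: it labels a hole, and \<open>s\<close> has none.  The children of a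
  vertex contract first, then the vertex itself.
\<close>

lemma contract_tree:
  assumes "full_ptree (carrier A) (Suc m) s" "holes s = 0" "tree_frame P" "P s \<in> T"
  shows "\<rho> (P s) = \<rho> (P (Leaf (tree_value \<one>\<^bsub>A\<^esub> s)))"
  using assms
proof (induction s arbitrary: P)
  case Hole
  then show ?case by simp
next
  case (Leaf a)
  then show ?case by (simp add: tree_value_def leaf_values_def \<sigma>.hom_one)
next
  case (Node ss)
  let ?v = "map (tree_value \<one>\<^bsub>A\<^esub>) ss"
  have ss: "full_ptree (carrier A) (Suc m) s" "holes s = 0" if "s \<in> set ss" for s
    using Node.prems(1,2) that unfolding full_Node by auto
  have "\<rho> (P (Node ([] @ ss @ []))) = \<rho> (P (Node ([] @ map Leaf ?v @ [])))
    \<and> P (Node ([] @ map Leaf ?v @ [])) \<in> T"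
    by (rule contract_siblings) (use Node ss in auto)
  then have "\<rho> (P (Node ss)) = \<rho> (P (Node (map Leaf ?v)))" "P (Node (map Leaf ?v)) \<in> T" by simp_all
  then show ?case
    using rho_contract[OF Node.prems(3), of ?v] tree_value_Node[OF Node.prems(1) \<sigma>.A.A.one_closed]
    by (simp only:)
qed

definition E :: "'a list \<Rightarrow> 'a list \<Rightarrow> 'a ptree"
  where "E us ws = Node (map Leaf us @ Hole # map Leaf ws)"

lemma E_T: "\<lbrakk>set us \<subseteq> carrier A; set ws \<subseteq> carrier A; length us + length ws = m\<rbrakk> \<Longrightarrow> E us ws \<in> T"
  by (auto simp: E_def one_hole_contexts_def full_Node o_def simp del: full_ptree.simps(3))

lemma E_graft: "graft (E us ws) t = Node (map Leaf us @ t # map Leaf ws)"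
  by (simp add: E_def o_def)

lemma rho_E_mult:
  assumes "set us \<subseteq> carrier A" "set ws \<subseteq> carrier A" "length us + length ws = m"
    and "set us' \<subseteq> carrier A" "set ws' \<subseteq> carrier A" "length us' + length ws' = m"
  shows "\<rho> (E us ws) \<otimes>\<^bsub>R\<^esub> \<rho> (E us' ws')
      = \<rho> (Node (map Leaf us @ Node (map Leaf us' @ Hole # map Leaf ws') # map Leaf ws))"
    and "Node (map Leaf us @ Node (map Leaf us' @ Hole # map Leaf ws') # map Leaf ws) \<in> T"
  using rho_graft[OF E_T E_T] graft_T[OF E_T E_T] assms by (simp_all add: E_graft E_def o_def)

text \<open>
  One rebracketing step at the root leads from any tree with two vertices to any other one with the
  same list of leaves.
\<close>

lemma rho_rebracket_two:
  assumes "Node (us @ Node vs # ws) \<in> T" "length vs' = Suc m" "length us' + length ws' = m"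
    and "us @ vs @ ws = us' @ vs' @ ws'"
  shows "\<rho> (Node (us @ Node vs # ws)) = \<rho> (Node (us' @ Node vs' # ws'))
    \<and> Node (us' @ Node vs' # ws') \<in> T"
proof -
  have "length vs = Suc m" "length (us @ Node vs # ws) = Suc m"
    using assms(1) by (auto simp: one_hole_contexts_def full_Node simp del: full_ptree.simps(3))
  then have "rebracket (Suc m) (Node (us @ Node vs # ws)) (Node (us' @ Node vs' # ws'))"
    using assms by (intro rebracket.intros[OF tree_frame.here]) auto
  then show ?thesis using rho_rebracket assms(1) rebracket_one_hole by blast
qed

text \<open>
  A product of two one-vertex contexts is a context with two vertices, which can be bracketed anew.
  If the hole is again in the inner vertex, the result is another such product.  If the inner vertex
  lies beside the hole, it can be contracted.  These two possibilities, the second one on either side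
  of the hole, produce all relations that are needed for normal forms.
\<close>

lemma rho_E_regroup:
  assumes "set us \<subseteq> carrier A" "set ws \<subseteq> carrier A" "length us + length ws = m"
    and "set us' \<subseteq> carrier A" "set ws' \<subseteq> carrier A" "length us' + length ws' = m"
    and "us @ us' = vs @ vs'" "ws' @ ws = xs' @ xs" "length vs + length xs = m" "length vs' + length xs' = m"
  shows "\<rho> (E us ws) \<otimes>\<^bsub>R\<^esub> \<rho> (E us' ws') = \<rho> (E vs xs) \<otimes>\<^bsub>R\<^esub> \<rho> (E vs' xs')"
proof -
  have "set vs \<union> set vs' \<subseteq> carrier A" "set xs \<union> set xs' \<subseteq> carrier A"
    using arg_cong[OF assms(7), of set] arg_cong[OF assms(8), of set] assms(1,2,4,5) by auto
  then have s: "set vs \<subseteq> carrier A" "set vs' \<subseteq> carrier A" "set xs \<subseteq> carrier A" "set xs' \<subseteq> carrier A"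
    by auto
  have eq: "map Leaf us @ (map Leaf us' @ Hole # map Leaf ws') @ map Leaf ws
    = map Leaf vs @ (map Leaf vs' @ Hole # map Leaf xs') @ map Leaf xs"
    using arg_cong[OF assms(7), of "map Leaf"] arg_cong[OF assms(8), of "map Leaf"] by simp
  show ?thesis
    unfolding rho_E_mult(1)[OF assms(1-6)] rho_E_mult(1)[OF s(1,3) assms(9) s(2,4) assms(10)]
    using rho_rebracket_two[OF rho_E_mult(2)[OF assms(1-6)] _ _ eq] assms(9,10) by simp
qed

lemma rho_E_contract_left:
  assumes "set us \<subseteq> carrier A" "set ws \<subseteq> carrier A" "length us + length ws = m"
    and "set us' \<subseteq> carrier A" "set ws' \<subseteq> carrier A" "length us' + length ws' = m"
    and "us @ us' = ps @ vs @ qs" "length vs = Suc m"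
  shows "\<rho> (E us ws) \<otimes>\<^bsub>R\<^esub> \<rho> (E us' ws') = \<rho> (E (ps @ \<mu> vs # qs) (ws' @ ws))"
proof -
  have len: "length ps + length qs + length ws' + length ws + 1 = m"
    using arg_cong[OF assms(7), of length] assms(3,6,8) by simp
  have eq: "map Leaf us @ (map Leaf us' @ Hole # map Leaf ws') @ map Leaf ws
    = map Leaf ps @ map Leaf vs @ (map Leaf qs @ Hole # map Leaf (ws' @ ws))"
    using arg_cong[OF assms(7), of "map Leaf"] by simp
  let ?P = "\<lambda>t. Node (map Leaf ps @ t # map Leaf qs @ Hole # map Leaf (ws' @ ws))"
  have P: "tree_frame ?P" by (rule tree_frame.below[OF tree_frame.here])
  have "\<rho> (E us ws) \<otimes>\<^bsub>R\<^esub> \<rho> (E us' ws') = \<rho> (?P (Node (map Leaf vs))) \<and> ?P (Node (map Leaf vs)) \<in> T"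
    unfolding rho_E_mult(1)[OF assms(1-6)]
    by (rule rho_rebracket_two[OF rho_E_mult(2)[OF assms(1-6)] _ _ eq]) (use len assms(8) in simp_all)
  then show ?thesis using rho_contract[OF P, of vs] by (simp add: E_def)
qed

lemma rho_E_contract_right:
  assumes "set us \<subseteq> carrier A" "set ws \<subseteq> carrier A" "length us + length ws = m"
    and "set us' \<subseteq> carrier A" "set ws' \<subseteq> carrier A" "length us' + length ws' = m"
    and "ws' @ ws = ps @ vs @ qs" "length vs = Suc m"
  shows "\<rho> (E us ws) \<otimes>\<^bsub>R\<^esub> \<rho> (E us' ws') = \<rho> (E (us @ us') (ps @ \<mu> vs # qs))"
proof -
  have len: "length ps + length qs + length us' + length us + 1 = m"
    using arg_cong[OF assms(7), of length] assms(3,6,8) by simp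
  have eq: "map Leaf us @ (map Leaf us' @ Hole # map Leaf ws') @ map Leaf ws
    = (map Leaf (us @ us') @ Hole # map Leaf ps) @ map Leaf vs @ map Leaf qs"
    using arg_cong[OF assms(7), of "map Leaf"] by simp
  let ?P = "\<lambda>t. Node ((map Leaf (us @ us') @ Hole # map Leaf ps) @ t # map Leaf qs)"
  have P: "tree_frame ?P" by (rule tree_frame.below[OF tree_frame.here])
  have "\<rho> (E us ws) \<otimes>\<^bsub>R\<^esub> \<rho> (E us' ws') = \<rho> (?P (Node (map Leaf vs))) \<and> ?P (Node (map Leaf vs)) \<in> T"
    unfolding rho_E_mult(1)[OF assms(1-6)]
    by (rule rho_rebracket_two[OF rho_E_mult(2)[OF assms(1-6)] _ _ eq]) (use len assms(8) in simp_all)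
  then show ?thesis using rho_contract[OF P, of vs] by (simp add: E_def)
qed

end

text \<open>For \<open>c = 1\<close> the condition on \<open>\<sigma>\<close> says that \<open>\<sigma>\<^sup>m = 1\<close>, so exponents of \<open>\<sigma>\<close> matter only modulo \<open>m\<close>.\<close>

locale periodic_algebra = twisted_algebra k A \<sigma> m c
  for k :: "('k, 'x) ring_scheme" (structure) and A :: "('k, 'a, 'y) module_scheme"
    and \<sigma> :: "'a \<Rightarrow> 'a" and m c +
  assumes c_one: "c = \<one>\<^bsub>A\<^esub>"
begin

lemma mu_eq: "\<lbrakk>set as \<subseteq> carrier A; length as = Suc m\<rbrakk> \<Longrightarrow> \<mu> as = sp as"
  by (simp add: nary_eq) (simp add: c_one)

lemma pow_m: "a \<in> carrier A \<Longrightarrow> (\<sigma> ^^ m) a = a"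
  using \<sigma>_pow_m[of a] pow_closed[of a m] by (simp add: c_one)

lemma pow_add_m: "a \<in> carrier A \<Longrightarrow> (\<sigma> ^^ (n + m)) a = (\<sigma> ^^ n) a"
  by (simp add: funpow_add pow_m)

lemma pow_mod: "a \<in> carrier A \<Longrightarrow> (\<sigma> ^^ (n mod m)) a = (\<sigma> ^^ n) a"
proof (induction n rule: less_induct)
  case (less n)
  show ?case
  proof (cases "n < m")
    case False
    then have "(\<sigma> ^^ n) a = (\<sigma> ^^ (n - m)) a" using pow_add_m[OF less.prems, of "n - m"] by simp
    then show ?thesis using less m_pos False by (simp add: le_mod_geq)
  qed simp
qed

lemma pow_cong: "\<lbrakk>n mod m = n' mod m; a \<in> carrier A\<rbrakk> \<Longrightarrow> (\<sigma> ^^ n) a = (\<sigma> ^^ n') a"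
  using pow_mod[of a n] pow_mod[of a n'] by simp

text \<open>
  Grafting a context with leaf labels \<open>us'\<close> and \<open>ws'\<close> around its hole into one with labels \<open>us\<close> and \<open>ws\<close>
  yields the labels \<open>us @ us'\<close> and \<open>ws' @ ws\<close>.  With the hole, the grafted context has
  \<open>length us' + 1 + length ws'\<close> leaves, which is \<open>1\<close> modulo \<open>m\<close>; so the labels \<open>ws\<close> are
  twisted as if nothing had been inserted.
\<close>

lemma graft_data:
  assumes us: "set us \<subseteq> carrier A" "set ws \<subseteq> carrier A" "set us' \<subseteq> carrier A" "set ws' \<subseteq> carrier A"
    and len: "(length us' + length ws') mod m = 0"
  shows "sp (us @ us') = sp us \<otimes>\<^bsub>A\<^esub> (\<sigma> ^^ (length us mod m)) (sp us')"
    and "(\<sigma> ^^ Suc (length (us @ us'))) (sp (ws' @ ws))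
      = (\<sigma> ^^ (length us mod m)) ((\<sigma> ^^ Suc (length us')) (sp ws')) \<otimes>\<^bsub>A\<^esub> (\<sigma> ^^ Suc (length us)) (sp ws)"
proof -
  show "sp (us @ us') = sp us \<otimes>\<^bsub>A\<^esub> (\<sigma> ^^ (length us mod m)) (sp us')"
    using us by (simp add: sp_append pow_mod)
  have "(\<sigma> ^^ Suc (length (us @ us'))) (sp (ws' @ ws))
    = (\<sigma> ^^ Suc (length (us @ us'))) (sp ws')
      \<otimes>\<^bsub>A\<^esub> (\<sigma> ^^ Suc (length (us @ us'))) ((\<sigma> ^^ length ws') (sp ws))"
    unfolding sp_append[OF us(4,2)] using us by (intro pow_mult) (simp_all add: pow_closed)
  also have "(\<sigma> ^^ Suc (length (us @ us'))) ((\<sigma> ^^ length ws') (sp ws)) = (\<sigma> ^^ Suc (length us)) (sp ws)"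
  proof -
    have "(Suc (length (us @ us')) + length ws') mod m = (Suc (length us) + (length us' + length ws')) mod m"
      by (simp add: add.assoc)
    also have "\<dots> = Suc (length us) mod m"
      using len by (metis add.right_neutral mod_add_right_eq)
    finally have "(\<sigma> ^^ (Suc (length (us @ us')) + length ws')) (sp ws) = (\<sigma> ^^ Suc (length us)) (sp ws)"
      using us by (intro pow_cong) simp_all
    then show ?thesis unfolding funpow_add by simp
  qed
  also have "(\<sigma> ^^ Suc (length (us @ us'))) (sp ws')
    = (\<sigma> ^^ (length us mod m)) ((\<sigma> ^^ Suc (length us')) (sp ws'))"
  proof -
    have "Suc (length (us @ us')) = length us + Suc (length us')" by simp
    then have "(\<sigma> ^^ Suc (length (us @ us'))) (sp ws') = (\<sigma> ^^ length us) ((\<sigma> ^^ Suc (length us')) (sp ws'))"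
      by (simp only: funpow_add o_apply)
    then show ?thesis using us by (simp add: pow_mod pow_closed \<sigma>.hom_closed)
  qed
  finally show "(\<sigma> ^^ Suc (length (us @ us'))) (sp (ws' @ ws))
      = (\<sigma> ^^ (length us mod m)) ((\<sigma> ^^ Suc (length us')) (sp ws')) \<otimes>\<^bsub>A\<^esub> (\<sigma> ^^ Suc (length us)) (sp ws)" .
qed

text \<open>
  Suppose that \<open>N a b i\<close> stands for the operator \<open>x \<mapsto> a \<cdot> \<sigma>\<^sup>i(x) \<cdot> b\<close>.  A context with leaf labels
  \<open>us\<close> before and \<open>ws\<close> after the hole sends \<open>x\<close> to the twisted product of \<open>us\<close>, \<open>x\<close> and \<open>ws\<close>, and
  is therefore this operator.
\<close>

definition normal_form :: "('a \<Rightarrow> 'a \<Rightarrow> nat \<Rightarrow> 'e) \<Rightarrow> 'a list \<Rightarrow> 'a list \<Rightarrow> 'e"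
  where "normal_form N us ws = N (sp us) ((\<sigma> ^^ Suc (length us)) (sp ws)) (length us mod m)"

lemma normal_form_graft:
  assumes N: "\<And>a b a' b' i j. \<lbrakk>a \<in> carrier A; b \<in> carrier A; a' \<in> carrier A; b' \<in> carrier A; i < m; j < m\<rbrakk>
      \<Longrightarrow> mul (N a b i) (N a' b' j)
        = N (a \<otimes>\<^bsub>A\<^esub> (\<sigma> ^^ i) a') ((\<sigma> ^^ i) b' \<otimes>\<^bsub>A\<^esub> b) ((i + j) mod m)"
    and us: "set us \<subseteq> carrier A" "set ws \<subseteq> carrier A" "set us' \<subseteq> carrier A" "set ws' \<subseteq> carrier A"
    and len: "(length us' + length ws') mod m = 0"
  shows "mul (normal_form N us ws) (normal_form N us' ws') = normal_form N (us @ us') (ws' @ ws)"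
proof -
  have "mul (normal_form N us ws) (normal_form N us' ws')
    = N (sp us \<otimes>\<^bsub>A\<^esub> (\<sigma> ^^ (length us mod m)) (sp us'))
        ((\<sigma> ^^ (length us mod m)) ((\<sigma> ^^ Suc (length us')) (sp ws')) \<otimes>\<^bsub>A\<^esub> (\<sigma> ^^ Suc (length us)) (sp ws))
        ((length us mod m + length us' mod m) mod m)"
    unfolding normal_form_def
    by (rule N) (use us m_pos in \<open>auto intro!: pow_closed simp del: funpow.simps\<close>)
  also have "(length us mod m + length us' mod m) mod m = length (us @ us') mod m"
    by (simp add: mod_add_eq)
  finally show ?thesis unfolding graft_data[OF us len, symmetric] normal_form_def .
qed

end

section \<open>Normal forms of contexts\<close>

locale periodic_rep = anchored_rep k A \<sigma> m c R \<rho> + periodic_algebra k A \<sigma> m c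
  for k :: "('k, 'x) ring_scheme" (structure) and A :: "('k, 'a, 'y) module_scheme"
    and \<sigma> :: "'a \<Rightarrow> 'a" and m c and R :: "('k, 'r, 'z) module_scheme" and \<rho> :: "'a ptree \<Rightarrow> 'r"
begin

text \<open>
  On the regular slot module, the contexts behind \<open>L a\<close> and \<open>B b\<close> act as left and right multiplication,
  and the unit context behind \<open>Sh i\<close> acts as \<open>\<sigma>\<^sup>i\<close>.  The relations below between these three kinds of
  elements are those between the corresponding operators.
\<close>

abbreviation "ones n \<equiv> replicate n \<one>\<^bsub>A\<^esub>"
abbreviation "L a \<equiv> \<rho> (E (a # ones (m - 1)) [])"
abbreviation "B b \<equiv> \<rho> (E [] (ones (m - 1) @ [b]))"
abbreviation "Sh i \<equiv> \<rho> (E (ones i) (ones (m - i)))"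

lemma ones_closed [simp]: "set (ones n) \<subseteq> carrier A"
  by auto

lemma inv_c: "inv\<^bsub>A\<^esub> c = \<one>\<^bsub>A\<^esub>"
  by (simp add: c_one)

lemma ones_Suc: "\<one>\<^bsub>A\<^esub> # ones (m - 1) = ones m" "ones (m - 1) @ [\<one>\<^bsub>A\<^esub>] = ones m"
  using m_pos by (cases m; simp add: replicate_append_same)+

lemma L_one: "\<rho> (E (ones m) []) = \<one>\<^bsub>R\<^esub>"
  using rho_anchors(2) by (simp only: inv_c flip: ones_Suc(1)) (simp add: E_def)

lemma B_one: "\<rho> (E [] (ones m)) = \<one>\<^bsub>R\<^esub>"
  using rho_anchors(1) by (simp only: inv_c flip: ones_Suc(2)) (simp add: E_def)

lemma closed:
  assumes "set us \<subseteq> carrier A" "set ws \<subseteq> carrier A" "length us + length ws = m"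
  shows "\<rho> (E us ws) \<in> carrier R"
  by (intro rho_closed E_T assms)

lemma L_closed: "a \<in> carrier A \<Longrightarrow> L a \<in> carrier R"
  using m_pos by (intro closed) auto

lemma B_closed: "b \<in> carrier A \<Longrightarrow> B b \<in> carrier R"
  using m_pos by (intro closed) auto

lemma Sh_closed: "i \<le> m \<Longrightarrow> Sh i \<in> carrier R"
  by (intro closed) auto

lemma ones_add: "ones a @ ones b = ones (a + b)" "ones a @ ones b @ xs = ones (a + b) @ xs"
  by (simp_all add: replicate_add)

lemma sp_ones_left: "b \<in> carrier A \<Longrightarrow> sp (ones n @ [b]) = (\<sigma> ^^ n) b"
  by (simp add: sp_ones_append sp_singleton del: twisted_prod.simps)

lemma sp_ones_right: "a \<in> carrier A \<Longrightarrow> sp (a # ones n) = a"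
  using sp_append_ones[of "[a]" n] by (simp add: sp_singleton del: twisted_prod.simps)

text \<open>
  By the anchor with the hole at the end, \<open>m\<close> entries \<open>1\<close> can be inserted between \<open>us\<close> and the hole.  The labels
  \<open>us\<close> and some of these entries form a word of length \<open>m + 1\<close> with product \<open>sp us\<close>, which contracts to
  one leaf.  The right-hand side contracts to the same context.
\<close>

lemma collect_left:
  assumes us: "set us \<subseteq> carrier A" and ws: "set ws \<subseteq> carrier A" and len: "length us + length ws = m"
  shows "\<rho> (E us ws) = L (sp us) \<otimes>\<^bsub>R\<^esub> \<rho> (E (ones (length us)) ws)"
proof (cases "us = []")
  case True
  then show ?thesis using len ws ones_Suc(1) L_one closed[of "[]" ws] by simp
next
  case False
  let ?i = "length us"
  have i: "?i > 0" using False by simp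
  obtain u us0 where us0: "us = u # us0" using False by (cases us) auto
  have "\<rho> (E us ws) = \<rho> (E us ws) \<otimes>\<^bsub>R\<^esub> \<rho> (E (ones m) [])"
    using closed[OF assms] L_one by simp
  also have "\<dots> = \<rho> (E ([] @ \<mu> (us @ ones (Suc m - ?i)) # ones (?i - 1)) ([] @ ws))"
    by (rule rho_E_contract_left)
      (use assms i in \<open>auto simp: ones_add simp del: replicate_Suc\<close>)
  also have "\<mu> (us @ ones (Suc m - ?i)) = sp us"
    using us len by (subst mu_eq) (auto simp: sp_append_ones)
  finally have 1: "\<rho> (E us ws) = \<rho> (E (sp us # ones (?i - 1)) ws)" by simp
  have "L (sp us) \<otimes>\<^bsub>R\<^esub> \<rho> (E (ones ?i) ws) = \<rho> (E ([] @ \<mu> (sp us # ones m) # ones (?i - 1)) (ws @ []))"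
    by (rule rho_E_contract_left)
      (use assms us0 sp_closed[OF us] in \<open>auto simp: ones_add simp del: replicate_Suc twisted_prod.simps\<close>)
  also have "\<mu> (sp us # ones m) = sp us"
    using us by (subst mu_eq) (auto simp: sp_ones_right simp del: twisted_prod.simps)
  finally show ?thesis using 1 by simp
qed

text \<open>
  The other anchor inserts the entries \<open>1\<close> between the hole and \<open>ws\<close>.  The word to be contracted therefore
  begins with \<open>m + 1 - length ws = length us + 1\<close> of them, and they twist the product of \<open>ws\<close>.
\<close>

lemma collect_right:
  assumes us: "set us \<subseteq> carrier A" and ws: "set ws \<subseteq> carrier A" and len: "length us + length ws = m"
  shows "\<rho> (E us ws) = B ((\<sigma> ^^ Suc (length us)) (sp ws)) \<otimes>\<^bsub>R\<^esub> \<rho> (E us (ones (length ws)))"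
proof (cases "ws = []")
  case True
  then show ?thesis using len us ones_Suc(2) B_one closed[of us "[]"] by (simp add: pow_one \<sigma>.hom_one)
next
  case False
  let ?i = "length us" and ?j = "length ws"
  let ?b = "(\<sigma> ^^ Suc ?i) (sp ws)"
  have b: "?b \<in> carrier A" using ws by (intro pow_closed) simp
  have j: "?j > 0" using False by simp
  obtain w ws0 where ws0: "ws = w # ws0" using False by (cases ws) auto
  have "\<rho> (E us ws) = \<rho> (E us ws) \<otimes>\<^bsub>R\<^esub> \<rho> (E [] (ones m))"
    using closed[OF assms] B_one by simp
  also have "\<dots> = \<rho> (E (us @ []) (ones (?j - 1) @ \<mu> (ones (Suc ?i) @ ws) # []))"
    by (rule rho_E_contract_right)
      (use assms j in \<open>auto simp: ones_add simp del: replicate_Suc\<close>)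
  also have "\<mu> (ones (Suc ?i) @ ws) = ?b"
    using ws len by (subst mu_eq) (auto simp: sp_ones_append simp del: replicate_Suc funpow.simps)
  finally have 1: "\<rho> (E us ws) = \<rho> (E us (ones (?j - 1) @ [?b]))" by simp
  have "B ?b \<otimes>\<^bsub>R\<^esub> \<rho> (E us (ones ?j)) = \<rho> (E ([] @ us) (ones (?j - 1) @ \<mu> (ones m @ [?b]) # []))"
    by (rule rho_E_contract_right)
      (use assms b ws0 in \<open>auto simp: ones_add simp del: replicate_Suc\<close>)
  also have "\<mu> (ones m @ [?b]) = ?b"
    using b by (subst mu_eq) (auto simp: sp_ones_left pow_m simp del: funpow.simps)
  finally show ?thesis using 1 by simp
qed

lemma E_normal:
  assumes us: "set us \<subseteq> carrier A" and ws: "set ws \<subseteq> carrier A" and len: "length us + length ws = m"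
  shows "\<rho> (E us ws) = L (sp us) \<otimes>\<^bsub>R\<^esub> (B ((\<sigma> ^^ Suc (length us)) (sp ws)) \<otimes>\<^bsub>R\<^esub> Sh (length us))"
proof -
  have "length ws = m - length us" using len by simp
  then show ?thesis
    using collect_left[OF assms] collect_right[OF ones_closed[of "length us"] ws] len
    by (simp del: funpow.simps)
qed

lemma L_mult:
  assumes "a \<in> carrier A" "b \<in> carrier A"
  shows "L a \<otimes>\<^bsub>R\<^esub> L b = L (a \<otimes>\<^bsub>A\<^esub> b)"
proof -
  have "L a \<otimes>\<^bsub>R\<^esub> L b = \<rho> (E ([] @ \<mu> (a # ones (m - 1) @ [b]) # ones (m - 1)) ([] @ []))"
    by (rule rho_E_contract_left) (use assms m_pos in auto)
  also have "\<mu> (a # ones (m - 1) @ [b]) = a \<otimes>\<^bsub>A\<^esub> b"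
    using assms m_pos sp_ones_left[of b "m - 1"] pow_m[of b] by (subst mu_eq) (auto simp: gr0_conv_Suc)
  finally show ?thesis by simp
qed

lemma B_mult:
  assumes "b \<in> carrier A" "b' \<in> carrier A"
  shows "B b \<otimes>\<^bsub>R\<^esub> B b' = B (b' \<otimes>\<^bsub>A\<^esub> b)"
proof -
  have "B b \<otimes>\<^bsub>R\<^esub> B b' = \<rho> (E ([] @ []) (ones (m - 1) @ \<mu> (b' # ones (m - 1) @ [b]) # []))"
    by (rule rho_E_contract_right) (use assms m_pos in auto)
  also have "\<mu> (b' # ones (m - 1) @ [b]) = b' \<otimes>\<^bsub>A\<^esub> b"
    using assms m_pos sp_ones_left[of b "m - 1"] pow_m[of b] by (subst mu_eq) (auto simp: gr0_conv_Suc)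
  finally show ?thesis by simp
qed

lemma B_L_commute:
  assumes "a \<in> carrier A" "b \<in> carrier A"
  shows "B b \<otimes>\<^bsub>R\<^esub> L a = L a \<otimes>\<^bsub>R\<^esub> B b"
  by (rule rho_E_regroup) (use assms m_pos in auto)

lemma Sh_zero: "Sh 0 = \<one>\<^bsub>R\<^esub>" "Sh m = \<one>\<^bsub>R\<^esub>"
  using B_one L_one by simp_all

lemma Sh_L:
  assumes i: "i < m" and a: "a \<in> carrier A"
  shows "Sh i \<otimes>\<^bsub>R\<^esub> L a = L ((\<sigma> ^^ i) a) \<otimes>\<^bsub>R\<^esub> Sh i"
proof (cases "i = 0")
  case True
  then show ?thesis using L_closed[OF a] Sh_zero(1) by simp
next
  case False
  let ?a = "(\<sigma> ^^ i) a"
  have a': "?a \<in> carrier A" using a by (rule pow_closed)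
  have "Sh i \<otimes>\<^bsub>R\<^esub> L a = \<rho> (E ([] @ \<mu> (ones i @ a # ones (m - i)) # ones (i - 1)) ([] @ ones (m - i)))"
    by (rule rho_E_contract_left)
      (use a i False m_pos in \<open>auto simp: ones_add simp del: replicate_Suc\<close>)
  also have "\<mu> (ones i @ a # ones (m - i)) = ?a"
    using a i by (subst mu_eq) (auto simp: sp_ones_append sp_ones_right simp del: twisted_prod.simps)
  also have "\<rho> (E ([] @ ?a # ones (i - 1)) ([] @ ones (m - i))) = L ?a \<otimes>\<^bsub>R\<^esub> Sh i"
    using collect_left[of "?a # ones (i - 1)" "ones (m - i)"] a' i False
    by (auto simp: sp_ones_right simp del: twisted_prod.simps replicate_Suc)
  finally show ?thesis .
qed

lemma Sh_B:
  assumes i: "i < m" and b: "b \<in> carrier A"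
  shows "Sh i \<otimes>\<^bsub>R\<^esub> B b = B ((\<sigma> ^^ i) b) \<otimes>\<^bsub>R\<^esub> Sh i"
proof -
  let ?b = "(\<sigma> ^^ (m - 1)) b"
  have b': "?b \<in> carrier A" using b by (rule pow_closed)
  \<comment> \<open>The word has length \<open>m + 1\<close> because it ends with one of the \<open>m - i > 0\<close> entries \<open>1\<close> of \<open>Sh i\<close>.\<close>
  have "Sh i \<otimes>\<^bsub>R\<^esub> B b
    = \<rho> (E (ones i @ []) ([] @ \<mu> (ones (m - 1) @ b # ones 1) # ones (m - i - 1)))"
    by (rule rho_E_contract_right)
      (use b i m_pos in \<open>auto simp: ones_add simp del: replicate_Suc\<close>)
  also have "\<mu> (ones (m - 1) @ b # ones 1) = ?b"
    using b m_pos by (subst mu_eq) (auto simp: sp_ones_append sp_ones_right simp del: twisted_prod.simps replicate_Suc)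
  also have "\<rho> (E (ones i @ []) ([] @ ?b # ones (m - i - 1))) = B ((\<sigma> ^^ Suc i) ?b) \<otimes>\<^bsub>R\<^esub> Sh i"
    using collect_right[of "ones i" "?b # ones (m - i - 1)"] b' i
    by (auto simp: sp_ones_right Suc_diff_Suc simp del: twisted_prod.simps funpow.simps replicate_Suc)
  also have "(\<sigma> ^^ Suc i) ?b = (\<sigma> ^^ (Suc i + (m - 1))) b" by (simp only: funpow_add o_apply)
  also have "Suc i + (m - 1) = i + m" using m_pos by simp
  finally show ?thesis using pow_add_m[OF b, of i] by simp
qed

text \<open>
  Altogether there are \<open>i + j\<close> entries \<open>1\<close> before the hole and \<open>2m - i - j\<close> after it.  One of the two
  blocks has more than \<open>m\<close> of them and contracts, unless both have exactly \<open>m\<close>; then the product is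
  that of the two anchors.
\<close>

lemma Sh_mult:
  assumes i: "i < m" and j: "j < m"
  shows "Sh i \<otimes>\<^bsub>R\<^esub> Sh j = Sh ((i + j) mod m)"
proof -
  have mu: "\<mu> (ones (Suc m)) = \<one>\<^bsub>A\<^esub>"
    by (subst mu_eq) (auto simp: sp_ones simp del: replicate_Suc twisted_prod.simps)
  consider "i + j < m" | "i + j = m" | "i + j > m" by linarith
  then show ?thesis
  proof cases
    case 1
    have "Sh i \<otimes>\<^bsub>R\<^esub> Sh j = \<rho> (E (ones i @ ones j) ([] @ \<mu> (ones (Suc m)) # ones (m - i - j - 1)))"
      by (rule rho_E_contract_right)
        (use i j 1 in \<open>auto simp: ones_add simp del: replicate_Suc\<close>)
    also have "ones i @ ones j = ones (i + j)" by (simp add: replicate_add)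
    also have "[] @ \<mu> (ones (Suc m)) # ones (m - i - j - 1) = ones (m - (i + j))"
      using 1 unfolding mu by (cases "m - (i + j)") auto
    finally show ?thesis using 1 by simp
  next
    case 2
    have "Sh i \<otimes>\<^bsub>R\<^esub> Sh j = \<rho> (E (ones m) []) \<otimes>\<^bsub>R\<^esub> \<rho> (E [] (ones m))"
      by (rule rho_E_regroup) (use i j 2 in \<open>auto simp: ones_add\<close>)
    then show ?thesis using 2 L_one B_one Sh_zero by simp
  next
    case 3
    have "Sh i \<otimes>\<^bsub>R\<^esub> Sh j = \<rho> (E ([] @ \<mu> (ones (Suc m)) # ones (i + j - m - 1)) (ones (m - j) @ ones (m - i)))"
      by (rule rho_E_contract_left)
        (use i j 3 in \<open>auto simp: ones_add simp del: replicate_Suc\<close>)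
    also have "ones (m - j) @ ones (m - i) = ones (m - (i + j - m))"
      using i j 3 by (simp add: replicate_add[symmetric])
    also have "[] @ \<mu> (ones (Suc m)) # ones (i + j - m - 1) = ones (i + j - m)"
      using 3 unfolding mu by (cases "i + j - m") auto
    also have "i + j - m = (i + j) mod m" using i j 3 by (simp add: mod_if)
    finally show ?thesis .
  qed
qed

text \<open>The counterpart of the element \<open>(a \<otimes> b) g\<^sup>i\<close> of the skew group algebra.\<close>

definition N :: "'a \<Rightarrow> 'a \<Rightarrow> nat \<Rightarrow> 'r"
  where "N a b i = L a \<otimes>\<^bsub>R\<^esub> (B b \<otimes>\<^bsub>R\<^esub> Sh i)"

lemma N_closed: "\<lbrakk>a \<in> carrier A; b \<in> carrier A; i < m\<rbrakk> \<Longrightarrow> N a b i \<in> carrier R"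
  unfolding N_def by (intro R.A.m_closed L_closed B_closed Sh_closed) auto

lemma N_one: "N \<one>\<^bsub>A\<^esub> \<one>\<^bsub>A\<^esub> 0 = \<one>\<^bsub>R\<^esub>"
  unfolding N_def ones_Suc Sh_zero by (simp add: L_one B_one)

lemma N_mult:
  assumes ab: "a \<in> carrier A" "b \<in> carrier A" "a' \<in> carrier A" "b' \<in> carrier A"
    and ij: "i < m" "j < m"
  shows "N a b i \<otimes>\<^bsub>R\<^esub> N a' b' j
    = N (a \<otimes>\<^bsub>A\<^esub> (\<sigma> ^^ i) a') ((\<sigma> ^^ i) b' \<otimes>\<^bsub>A\<^esub> b) ((i + j) mod m)"
proof -
  let ?a = "(\<sigma> ^^ i) a'" and ?b = "(\<sigma> ^^ i) b'"
  have s: "?a \<in> carrier A" "?b \<in> carrier A" using ab by (simp_all add: pow_closed)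
  note cl = L_closed[OF ab(1)] L_closed[OF ab(3)] L_closed[OF s(1)] B_closed[OF ab(2)]
    B_closed[OF ab(4)] B_closed[OF s(2)] Sh_closed[OF less_imp_le[OF ij(1)]] Sh_closed[OF less_imp_le[OF ij(2)]]
  have "N a b i \<otimes>\<^bsub>R\<^esub> N a' b' j
    = L a \<otimes>\<^bsub>R\<^esub> (B b \<otimes>\<^bsub>R\<^esub> ((Sh i \<otimes>\<^bsub>R\<^esub> L a') \<otimes>\<^bsub>R\<^esub> (B b' \<otimes>\<^bsub>R\<^esub> Sh j)))"
    unfolding N_def using cl by (simp only: R.A.m_assoc R.A.m_closed)
  also have "\<dots> = L a \<otimes>\<^bsub>R\<^esub> ((B b \<otimes>\<^bsub>R\<^esub> L ?a) \<otimes>\<^bsub>R\<^esub> ((Sh i \<otimes>\<^bsub>R\<^esub> B b') \<otimes>\<^bsub>R\<^esub> Sh j))"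
    unfolding Sh_L[OF ij(1) ab(3)] using cl by (simp only: R.A.m_assoc R.A.m_closed)
  also have "\<dots> = (L a \<otimes>\<^bsub>R\<^esub> L ?a) \<otimes>\<^bsub>R\<^esub> ((B b \<otimes>\<^bsub>R\<^esub> B ?b) \<otimes>\<^bsub>R\<^esub> (Sh i \<otimes>\<^bsub>R\<^esub> Sh j))"
    unfolding Sh_B[OF ij(1) ab(4)] B_L_commute[OF s(1) ab(2)] using cl by (simp only: R.A.m_assoc R.A.m_closed)
  also have "\<dots> = N (a \<otimes>\<^bsub>A\<^esub> ?a) (?b \<otimes>\<^bsub>A\<^esub> b) ((i + j) mod m)"
    unfolding L_mult[OF ab(1) s(1)] B_mult[OF ab(2) s(2)] Sh_mult[OF ij] N_def ..
  finally show ?thesis .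
qed

lemma E_eq_normal:
  assumes "set us \<subseteq> carrier A" "set ws \<subseteq> carrier A" "length us + length ws = m"
  shows "\<rho> (E us ws) = normal_form N us ws"
proof (cases "length us = m")
  case True
  then show ?thesis unfolding normal_form_def N_def E_normal[OF assms] using Sh_zero by simp
next
  case False
  then show ?thesis unfolding normal_form_def N_def E_normal[OF assms] using assms(3) by simp
qed

text \<open>
  In a context other than \<open>Hole\<close>, the hole lies in exactly one of the subtrees of the root.  The other
  subtrees contract to leaves, and then the context is a one-vertex context times that subtree.  The
  contraction changes the number of leaves on either side of the hole, but only by multiples of \<open>m\<close>.
\<close>

theorem rho_eq_normal:
  assumes "t \<in> T" "leaves t = map Some us @ None # map Some ws"
  shows "\<rho> t = normal_form N us ws"
  using assms
proof (induction t arbitrary: us ws)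
  case Hole
  have "us = [] \<and> ws = []" using one_hole_split_unique[of "[]" "[]" us ws] Hole.prems(2) by simp
  then show ?case by (simp add: normal_form_def rho_Hole N_one \<sigma>.hom_one)
next
  case (Leaf a)
  then show ?case by (simp add: one_hole_contexts_def)
next
  case (Node ts)
  let ?v = "map (tree_value \<one>\<^bsub>A\<^esub>)"
  have full: "full_ptree (carrier A) (Suc m) t" if "t \<in> set ts" for t
    using Node.prems(1) that by (auto simp: one_hole_contexts_def full_Node simp del: full_ptree.simps)
  have len: "length ts = Suc m" using Node.prems(1)
    by (auto simp: one_hole_contexts_def full_Node simp del: full_ptree.simps)
  have "holes (Node ts) = 1" using Node.prems(1) by (simp add: one_hole_contexts_def)
  then obtain ps s qs where ts: "ts = ps @ s # qs" "holes s = 1"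
    "\<forall>t\<in>set ps. holes t = 0" "\<forall>t\<in>set qs. holes t = 0"
    by (rule one_hole_Node)
  have sT: "s \<in> T" using full[of s] ts by (simp add: one_hole_contexts_def)
  then obtain us' ws' where s: "leaves s = map Some us' @ None # map Some ws'"
    "set us' \<subseteq> carrier A" "set ws' \<subseteq> carrier A"
    by (rule leaves_one_hole)
  have "length (leaves s) = 1 + m * nodes s" using full[of s] ts by (intro length_leaves) auto
  then have len': "(length us' + length ws') mod m = 0" using s(1) by simp
  \<comment> \<open>Siblings without hole, as a list of trees \<open>rs\<close> and as the list \<open>zs\<close> of all their leaf labels:\<close>
  \<comment> \<open>the twisted products agree, and so do the lengths modulo \<open>m\<close>.\<close>
  have flat: "\<exists>zs. concat (map leaves rs) = map Some zs \<and> set zs \<subseteq> carrier A \<and> sp (?v rs) = sp zs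
      \<and> set (?v rs) \<subseteq> carrier A \<and> length (?v rs) mod m = length zs mod m"
    if rs: "set rs \<subseteq> set ts" "\<forall>t\<in>set rs. holes t = 0" for rs
  proof -
    have lv: "leaves t = map Some (leaf_values \<one>\<^bsub>A\<^esub> t)" if "t \<in> set rs" for t
    proof -
      have tt: "t \<in> set ts" using rs(1) that by blast
      have count: "count_list (leaves t) None = 0" using rs(2) that by (simp add: holes_leaves)
      obtain zs where "leaves t = map Some zs"
        using options_no_hole[OF leaves_subset[OF full[OF tt]] count] by blast
      then show ?thesis by (simp add: leaf_values_def o_def)
    qed
    let ?z = "concat (map (leaf_values \<one>\<^bsub>A\<^esub>) rs)"
    have f: "\<forall>t\<in>set rs. full_ptree (carrier A) (Suc m) t" using full rs(1) by blast
    have z: "set ?z \<subseteq> carrier A" using f leaf_values_subset[of "Suc m"] by fastforce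
    have "c [^]\<^bsub>A\<^esub> n = \<one>\<^bsub>A\<^esub>" for n :: nat by (simp add: c_one)
    then have "sp (?v rs) = sp ?z"
      using sp_tree_values[OF f \<sigma>.A.A.one_closed] sp_closed[OF z] by (simp del: set_concat)
    moreover have "concat (map leaves rs) = map Some ?z"
      using lv by (simp add: map_concat cong: map_cong)
    moreover have "length (?v rs) mod m = length ?z mod m"
    proof -
      have "\<forall>t\<in>set rs. length (leaf_values \<one>\<^bsub>A\<^esub> t) = 1 + m * nodes t"
        unfolding leaf_values_def length_map using f length_leaves by blast
      then have "length ?z = length rs + m * sum_list (map nodes rs)"
        by (induction rs) (auto simp: algebra_simps)
      then show ?thesis by simp
    qed
    moreover have "set (?v rs) \<subseteq> carrier A"
      using f tree_value_closed by auto
    ultimately show ?thesis using z by blast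
  qed
  obtain us0 where us0: "concat (map leaves ps) = map Some us0" "set us0 \<subseteq> carrier A" "sp (?v ps) = sp us0"
    "set (?v ps) \<subseteq> carrier A" "length (?v ps) mod m = length us0 mod m"
    using flat[of ps] ts by auto
  obtain ws0 where ws0: "concat (map leaves qs) = map Some ws0" "set ws0 \<subseteq> carrier A" "sp (?v qs) = sp ws0"
    "set (?v qs) \<subseteq> carrier A"
    using flat[of qs] ts by auto
  have "map Some us @ None # map Some ws = map Some (us0 @ us') @ None # map Some (ws' @ ws0)"
    using Node.prems(2) us0(1) ws0(1) s(1) by (simp add: ts(1))
  from one_hole_split_unique[OF this] have uw: "us = us0 @ us'" "ws = ws' @ ws0" by auto
  have contract: "\<rho> (Node (xs @ rs @ ys)) = \<rho> (Node (xs @ map Leaf (?v rs) @ ys))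
      \<and> Node (xs @ map Leaf (?v rs) @ ys) \<in> T"
    if "set rs \<subseteq> set ts" "\<forall>t\<in>set rs. holes t = 0" "Node (xs @ rs @ ys) \<in> T" for xs rs ys
  proof (rule contract_siblings[OF _ _ tree_frame.here that(3)])
    show "holes r = 0 \<and> full_ptree (carrier A) (Suc m) r" if "r \<in> set rs" for r
      using full \<open>set rs \<subseteq> set ts\<close> \<open>\<forall>t\<in>set rs. holes t = 0\<close> that by blast
    then show "\<rho> (P r) = \<rho> (P (Leaf (tree_value \<one>\<^bsub>A\<^esub> r)))" if "r \<in> set rs" "tree_frame P" "P r \<in> T" for r P
      using contract_tree that by blast
  qed
  have sub: "set ps \<subseteq> set ts" "set qs \<subseteq> set ts" using ts(1) by auto
  have "\<rho> (Node ts) = \<rho> (Node (map Leaf (?v ps) @ s # qs)) \<and> Node (map Leaf (?v ps) @ s # qs) \<in> T"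
    using contract[OF sub(1) ts(3), of "[]" "s # qs"] Node.prems(1) ts(1) by simp
  moreover have "\<rho> (Node ((map Leaf (?v ps) @ [s]) @ qs @ []))
      = \<rho> (Node ((map Leaf (?v ps) @ [s]) @ map Leaf (?v qs) @ []))"
    using contract[OF sub(2) ts(4), of "map Leaf (?v ps) @ [s]" "[]"] calculation by simp
  ultimately have "\<rho> (Node ts) = \<rho> (graft (E (?v ps) (?v qs)) s)"
    by (simp add: E_graft)
  also have "\<dots> = \<rho> (E (?v ps) (?v qs)) \<otimes>\<^bsub>R\<^esub> \<rho> s"
    using len ts us0(4) ws0(4) by (intro rho_graft E_T sT) auto
  also have "\<dots> = normal_form N (?v ps) (?v qs) \<otimes>\<^bsub>R\<^esub> normal_form N us' ws'"
    using E_eq_normal[OF us0(4) ws0(4)] len ts Node.IH[OF _ sT s(1)] by simp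
  also have "\<dots> = normal_form N us0 ws0 \<otimes>\<^bsub>R\<^esub> normal_form N us' ws'"
  proof -
    have "Suc (length (?v ps)) mod m = Suc (length us0) mod m" using us0(5) by (metis mod_Suc_eq)
    then have "(\<sigma> ^^ Suc (length (?v ps))) (sp ws0) = (\<sigma> ^^ Suc (length us0)) (sp ws0)"
      using ws0(2) by (intro pow_cong) simp_all
    then show ?thesis unfolding normal_form_def us0(3) ws0(3) us0(5) by simp
  qed
  also have "\<dots> = normal_form N us ws"
    unfolding uw by (rule normal_form_graft[of "mult R", OF _ us0(2) ws0(2) s(2,3) len']) (rule N_mult)
  finally show ?case .
qed

lemma L_linear:
  "\<lbrakk>a \<in> carrier A; a' \<in> carrier A\<rbrakk> \<Longrightarrow> L (a \<oplus>\<^bsub>A\<^esub> a') = L a \<oplus>\<^bsub>R\<^esub> L a'"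
  "\<lbrakk>r \<in> carrier k; a \<in> carrier A\<rbrakk> \<Longrightarrow> L (r \<odot>\<^bsub>A\<^esub> a) = r \<odot>\<^bsub>R\<^esub> L a"
proof -
  let ?P = "\<lambda>t. Node ([] @ t # map Leaf (ones (m - 1)) @ [Hole])"
  have P: "tree_frame ?P" by (rule tree_frame.below[OF tree_frame.here])
  have eq: "E (a # ones (m - 1)) [] = ?P (Leaf a)" for a by (simp add: E_def)
  have T: "?P (Leaf a) \<in> T" if "a \<in> carrier A" for a
    unfolding eq[symmetric] using that m_pos by (intro E_T) auto
  show "\<lbrakk>a \<in> carrier A; a' \<in> carrier A\<rbrakk> \<Longrightarrow> L (a \<oplus>\<^bsub>A\<^esub> a') = L a \<oplus>\<^bsub>R\<^esub> L a'"
    unfolding eq by (rule rho_add[OF P _ _ T])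
  show "\<lbrakk>r \<in> carrier k; a \<in> carrier A\<rbrakk> \<Longrightarrow> L (r \<odot>\<^bsub>A\<^esub> a) = r \<odot>\<^bsub>R\<^esub> L a"
    unfolding eq by (rule rho_smult[OF P _ _ T])
qed

lemma B_linear:
  "\<lbrakk>b \<in> carrier A; b' \<in> carrier A\<rbrakk> \<Longrightarrow> B (b \<oplus>\<^bsub>A\<^esub> b') = B b \<oplus>\<^bsub>R\<^esub> B b'"
  "\<lbrakk>r \<in> carrier k; b \<in> carrier A\<rbrakk> \<Longrightarrow> B (r \<odot>\<^bsub>A\<^esub> b) = r \<odot>\<^bsub>R\<^esub> B b"
proof -
  let ?P = "\<lambda>t. Node ((Hole # map Leaf (ones (m - 1))) @ t # [])"
  have P: "tree_frame ?P" by (rule tree_frame.below[OF tree_frame.here])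
  have eq: "E [] (ones (m - 1) @ [b]) = ?P (Leaf b)" for b by (simp add: E_def)
  have T: "?P (Leaf b) \<in> T" if "b \<in> carrier A" for b
    unfolding eq[symmetric] using that m_pos by (intro E_T) auto
  show "\<lbrakk>b \<in> carrier A; b' \<in> carrier A\<rbrakk> \<Longrightarrow> B (b \<oplus>\<^bsub>A\<^esub> b') = B b \<oplus>\<^bsub>R\<^esub> B b'"
    unfolding eq by (rule rho_add[OF P _ _ T])
  show "\<lbrakk>r \<in> carrier k; b \<in> carrier A\<rbrakk> \<Longrightarrow> B (r \<odot>\<^bsub>A\<^esub> b) = r \<odot>\<^bsub>R\<^esub> B b"
    unfolding eq by (rule rho_smult[OF P _ _ T])
qed

lemma N_bilinear:
  assumes "i < m"
  shows "\<lbrakk>a \<in> carrier A; a' \<in> carrier A; b \<in> carrier A\<rbrakk> \<Longrightarrow> N (a \<oplus>\<^bsub>A\<^esub> a') b i = N a b i \<oplus>\<^bsub>R\<^esub> N a' b i"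
    and "\<lbrakk>a \<in> carrier A; b \<in> carrier A; b' \<in> carrier A\<rbrakk> \<Longrightarrow> N a (b \<oplus>\<^bsub>A\<^esub> b') i = N a b i \<oplus>\<^bsub>R\<^esub> N a b' i"
    and "\<lbrakk>r \<in> carrier k; a \<in> carrier A; b \<in> carrier A\<rbrakk> \<Longrightarrow> N (r \<odot>\<^bsub>A\<^esub> a) b i = r \<odot>\<^bsub>R\<^esub> N a b i"
    and "\<lbrakk>r \<in> carrier k; a \<in> carrier A; b \<in> carrier A\<rbrakk> \<Longrightarrow> N a (r \<odot>\<^bsub>A\<^esub> b) i = r \<odot>\<^bsub>R\<^esub> N a b i"
  unfolding N_def using assms
  by (simp_all add: L_linear B_linear L_closed B_closed Sh_closed less_imp_le R.A.l_distr R.A.r_distr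
      flip: R.smult_mult_left R.smult_mult_right del: One_nat_def)

end

section \<open>The skew group algebra as an anchored representation\<close>

definition left_labels :: "'a ptree \<Rightarrow> 'a list"
  where "left_labels t = map the (takeWhile (\<lambda>l. l \<noteq> None) (leaves t))"

definition right_labels :: "'a ptree \<Rightarrow> 'a list"
  where "right_labels t = map the (tl (dropWhile (\<lambda>l. l \<noteq> None) (leaves t)))"

lemma labels_eq:
  assumes "leaves t = map Some us @ None # map Some ws"
  shows "left_labels t = us" "right_labels t = ws"
proof -
  have "takeWhile (\<lambda>l. l \<noteq> None) (map Some us @ None # xs) = map Some us"
    "dropWhile (\<lambda>l. l \<noteq> None) (map Some us @ None # xs) = None # xs" for xs :: "'a option list"
    by (induction us) auto
  then show "left_labels t = us" "right_labels t = ws"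
    by (simp_all add: left_labels_def right_labels_def assms o_def)
qed

lemma leaves_graft:
  "leaves (graft t s) = concat (map (\<lambda>l. case l of None \<Rightarrow> leaves s | Some a \<Rightarrow> [Some a]) (leaves t))"
proof (induction t)
  case (Node ts)
  then show ?case by (induction ts) auto
qed auto

text \<open>
  When a subtree without hole is replaced by another one, only the labels on its side of the hole
  change.
\<close>

lemma frame_sides:
  assumes P: "tree_frame P" "P t \<in> one_hole_contexts S n" "holes t = 0"
  obtains ps qs rs where "set ps \<subseteq> S" "set qs \<subseteq> S" "set rs \<subseteq> S"
      "\<And>zs s. leaves s = map Some zs \<Longrightarrow> leaves (P s) = map Some (ps @ zs @ qs) @ None # map Some rs"
    | ps qs rs where "set ps \<subseteq> S" "set qs \<subseteq> S" "set rs \<subseteq> S"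
      "\<And>zs s. leaves s = map Some zs \<Longrightarrow> leaves (P s) = map Some ps @ None # map Some (qs @ zs @ rs)"
proof -
  obtain pre post k where f: "\<And>t. leaves (P t) = pre @ leaves t @ post" "\<And>t. nodes (P t) = k + nodes t"
    using frame_leaves[OF P(1)] by metis
  have "count_list (leaves (P t)) None = 1" "set (leaves (P t)) \<subseteq> insert None (Some ` S)"
    using P(2) leaves_subset by (auto simp: one_hole_contexts_def holes_leaves[symmetric])
  then have c: "count_list pre None + count_list post None = 1"
    and s: "set pre \<subseteq> insert None (Some ` S)" "set post \<subseteq> insert None (Some ` S)"
    using P(3) by (auto simp: f holes_leaves)
  consider "count_list pre None = 0" "count_list post None = 1"
    | "count_list pre None = 1" "count_list post None = 0" using c by linarith
  then show thesis
  proof cases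
    case 1
    obtain ps where ps: "pre = map Some ps" "set ps \<subseteq> S" using options_no_hole[OF s(1) 1(1)] .
    obtain qs rs where "post = map Some qs @ None # map Some rs" "set qs \<subseteq> S" "set rs \<subseteq> S"
      using options_one_hole[OF s(2) 1(2)] .
    with ps show thesis by (intro that(1)) (auto simp: f)
  next
    case 2
    obtain rs where rs: "post = map Some rs" "set rs \<subseteq> S" using options_no_hole[OF s(2) 2(2)] .
    obtain ps qs where "pre = map Some ps @ None # map Some qs" "set ps \<subseteq> S" "set qs \<subseteq> S"
      using options_one_hole[OF s(1) 2(1)] .
    with rs show thesis by (intro that(2)) (auto simp: f)
  qed
qed

lemma (in skew_action) single_add:
  "\<lbrakk>b \<in> carrier B; b' \<in> carrier B\<rbrakk> \<Longrightarrow> single B g (b \<oplus>\<^bsub>B\<^esub> b') = single B g b \<oplus>\<^bsub>S\<^esub> single B g b'"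
  by (auto simp: skew_simps single_def)

lemma (in skew_action) single_smult:
  "\<lbrakk>r \<in> carrier k; b \<in> carrier B\<rbrakk> \<Longrightarrow> single B g (r \<odot>\<^bsub>B\<^esub> b) = r \<odot>\<^bsub>S\<^esub> single B g b"
  by (auto simp: skew_simps single_def)

context periodic_algebra
begin

lemma enveloping_pair: "tensor_pair k A (op_algebra A)"
  by (intro tensor_pair.intro \<sigma>.A.k_algebra_axioms op_k_algebra)

sublocale Ae: tensor_pair k A "op_algebra A"
  by (rule enveloping_pair)

abbreviation "Ae \<equiv> enveloping_algebra k A"
abbreviation "\<tau> \<equiv> enveloping_map k A \<sigma>"
abbreviation "C\<^sub>m \<equiv> integer_mod_group m"
abbreviation "W \<equiv> cyclic_skew_algebra Ae \<tau> m"
abbreviation "pure \<equiv> pure_tensor k A (op_algebra A)"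

lemma Ae_eq: "Ae = Ae.T"
  by (simp add: enveloping_algebra_def)

lemma op_simps:
  "carrier (op_algebra A) = carrier A" "x \<otimes>\<^bsub>op_algebra A\<^esub> y = y \<otimes>\<^bsub>A\<^esub> x" "\<one>\<^bsub>op_algebra A\<^esub> = \<one>\<^bsub>A\<^esub>"
  "x \<oplus>\<^bsub>op_algebra A\<^esub> y = x \<oplus>\<^bsub>A\<^esub> y" "r \<odot>\<^bsub>op_algebra A\<^esub> x = r \<odot>\<^bsub>A\<^esub> x"
  by (simp_all add: op_algebra_def)

lemma \<tau>_hom: "k_algebra_hom k Ae Ae \<tau>"
  unfolding enveloping_map_def Ae_eq
  by (rule Ae.tensor_map_hom(1)[OF \<sigma>.k_algebra_hom_axioms op_hom[OF \<sigma>.k_algebra_hom_axioms]])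

lemma \<tau>_pure: "\<lbrakk>a \<in> carrier A; b \<in> carrier A\<rbrakk> \<Longrightarrow> \<tau> (pure a b) = pure (\<sigma> a) (\<sigma> b)"
  unfolding enveloping_map_def
  using Ae.tensor_map_hom(2)[OF \<sigma>.k_algebra_hom_axioms op_hom[OF \<sigma>.k_algebra_hom_axioms]]
  by (simp add: op_simps)

lemma \<tau>_pow_hom: "k_algebra_hom k Ae Ae (\<tau> ^^ n)"
  by (rule k_algebra_hom_funpow[OF \<tau>_hom])

lemma \<tau>_pow_pure:
  "\<lbrakk>a \<in> carrier A; b \<in> carrier A\<rbrakk> \<Longrightarrow> (\<tau> ^^ n) (pure a b) = pure ((\<sigma> ^^ n) a) ((\<sigma> ^^ n) b)"
  by (induction n) (simp_all add: \<tau>_pure pow_closed)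

lemma Ae_linear_eq:
  assumes "linear_map k Ae M h" "linear_map k Ae M h'"
    and "\<And>a b. \<lbrakk>a \<in> carrier A; b \<in> carrier A\<rbrakk> \<Longrightarrow> h (pure a b) = h' (pure a b)"
    and "Y \<in> carrier Ae"
  shows "h Y = h' Y"
  using Ae.linear_eq_on_pure[OF assms(1,2)[unfolded Ae_eq]] assms(3,4) by (simp add: op_simps Ae_eq)

lemma \<tau>_pow_mod: "y \<in> carrier Ae \<Longrightarrow> (\<tau> ^^ (n mod m)) y = (\<tau> ^^ n) y"
  by (rule Ae_linear_eq[OF k_algebra_hom.axioms(1)[OF \<tau>_pow_hom] k_algebra_hom.axioms(1)[OF \<tau>_pow_hom]])
    (simp_all add: \<tau>_pow_pure pow_mod)

lemma cyclic_carrier: "carrier C\<^sub>m = {0..<int m}"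
  using m_pos by (simp add: carrier_integer_mod_group)

lemma cyclic_action: "skew_action k Ae C\<^sub>m (\<lambda>i. \<tau> ^^ nat i)"
proof (intro skew_action.intro skew_action_axioms.intro)
  show "k_algebra k Ae" unfolding Ae_eq by (rule Ae.T_k_algebra)
  show "Group.monoid C\<^sub>m" by (rule group.is_monoid) simp
  show "k_algebra_hom k Ae Ae (\<tau> ^^ nat g)" for g by (rule \<tau>_pow_hom)
  show "(\<tau> ^^ nat \<one>\<^bsub>C\<^sub>m\<^esub>) b = b" for b by simp
  fix g h b assume "g \<in> carrier C\<^sub>m" "h \<in> carrier C\<^sub>m" "b \<in> carrier Ae"
  moreover from this have "nat (g \<otimes>\<^bsub>C\<^sub>m\<^esub> h) = (nat g + nat h) mod m"
    by (simp add: cyclic_carrier nat_mod_distrib nat_add_distrib)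
  ultimately show "(\<tau> ^^ nat (g \<otimes>\<^bsub>C\<^sub>m\<^esub> h)) b = (\<tau> ^^ nat g) ((\<tau> ^^ nat h) b)"
    by (simp only: \<tau>_pow_mod funpow_add o_apply)
qed

sublocale W: skew_action k Ae "C\<^sub>m" "\<lambda>i. \<tau> ^^ nat i"
  by (rule cyclic_action)

lemma W_eq: "W = W.S"
  by (simp add: cyclic_skew_algebra_def)

lemma W_k_algebra: "k_algebra k W"
  unfolding W_eq by (rule W.skew_k_algebra)

text \<open>The element \<open>(a \<otimes> b) g\<^sup>i\<close>, where \<open>g\<close> is the generator \<open>1\<close> of the cyclic group.\<close>

definition skew_term :: "'a \<Rightarrow> 'a \<Rightarrow> nat \<Rightarrow> int \<Rightarrow> ('a \<times> 'a \<Rightarrow> 'k) set"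
  where "skew_term a b i = single Ae (int i) (pure a b)"

lemma pure_closed: "\<lbrakk>a \<in> carrier A; b \<in> carrier A\<rbrakk> \<Longrightarrow> pure a b \<in> carrier Ae"
  unfolding Ae_eq by (rule Ae.pure_closed) (simp_all add: op_simps)

lemma skew_term_closed: "\<lbrakk>a \<in> carrier A; b \<in> carrier A; i < m\<rbrakk> \<Longrightarrow> skew_term a b i \<in> carrier W"
  unfolding skew_term_def W_eq by (rule W.single_closed) (simp_all add: cyclic_carrier pure_closed)

lemma skew_term_one: "\<one>\<^bsub>W\<^esub> = skew_term \<one>\<^bsub>A\<^esub> \<one>\<^bsub>A\<^esub> 0"
  unfolding skew_term_def W_eq W.skew_simps(4) using Ae.pure_one by (simp add: Ae_eq op_simps)

lemma skew_term_mult: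
  assumes ab: "a \<in> carrier A" "b \<in> carrier A" "a' \<in> carrier A" "b' \<in> carrier A"
    and ij: "i < m" "j < m"
  shows "skew_term a b i \<otimes>\<^bsub>W\<^esub> skew_term a' b' j
    = skew_term (a \<otimes>\<^bsub>A\<^esub> (\<sigma> ^^ i) a') ((\<sigma> ^^ i) b' \<otimes>\<^bsub>A\<^esub> b) ((i + j) mod m)"
proof -
  have "skew_term a b i \<otimes>\<^bsub>W\<^esub> skew_term a' b' j
    = single Ae (int i \<otimes>\<^bsub>C\<^sub>m\<^esub> int j) (pure a b \<otimes>\<^bsub>Ae\<^esub> (\<tau> ^^ nat (int i)) (pure a' b'))"
    unfolding skew_term_def W_eq using assms by (intro W.single_mult) (simp_all add: cyclic_carrier pure_closed)
  also have "int i \<otimes>\<^bsub>C\<^sub>m\<^esub> int j = int ((i + j) mod m)" by (simp add: zmod_int)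
  also have "pure a b \<otimes>\<^bsub>Ae\<^esub> (\<tau> ^^ nat (int i)) (pure a' b') = pure (a \<otimes>\<^bsub>A\<^esub> (\<sigma> ^^ i) a') ((\<sigma> ^^ i) b' \<otimes>\<^bsub>A\<^esub> b)"
    using ab Ae.pure_mult[of a b "(\<sigma> ^^ i) a'" "(\<sigma> ^^ i) b'"]
    by (simp add: \<tau>_pow_pure pow_closed op_simps Ae_eq)
  finally show ?thesis by (simp add: skew_term_def)
qed

lemma skew_term_bilinear:
  "\<lbrakk>a \<in> carrier A; a' \<in> carrier A; b \<in> carrier A\<rbrakk> \<Longrightarrow> skew_term (a \<oplus>\<^bsub>A\<^esub> a') b i = skew_term a b i \<oplus>\<^bsub>W\<^esub> skew_term a' b i"
  "\<lbrakk>a \<in> carrier A; b \<in> carrier A; b' \<in> carrier A\<rbrakk> \<Longrightarrow> skew_term a (b \<oplus>\<^bsub>A\<^esub> b') i = skew_term a b i \<oplus>\<^bsub>W\<^esub> skew_term a b' i"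
  "\<lbrakk>r \<in> carrier k; a \<in> carrier A; b \<in> carrier A\<rbrakk> \<Longrightarrow> skew_term (r \<odot>\<^bsub>A\<^esub> a) b i = r \<odot>\<^bsub>W\<^esub> skew_term a b i"
  "\<lbrakk>r \<in> carrier k; a \<in> carrier A; b \<in> carrier A\<rbrakk> \<Longrightarrow> skew_term a (r \<odot>\<^bsub>A\<^esub> b) i = r \<odot>\<^bsub>W\<^esub> skew_term a b i"
  unfolding skew_term_def W_eq
  using Ae.pure_bilinear[unfolded op_simps] W.single_add[OF pure_closed pure_closed] W.single_smult[OF _ pure_closed]
  by (simp_all add: Ae_eq)

abbreviation "normal_skew \<equiv> normal_form skew_term"

lemma normal_skew_closed:
  "\<lbrakk>set us \<subseteq> carrier A; set ws \<subseteq> carrier A\<rbrakk> \<Longrightarrow> normal_skew us ws \<in> carrier W"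
  unfolding normal_form_def using m_pos by (intro skew_term_closed) (auto intro!: pow_closed simp del: funpow.simps)

text \<open>Multiplying \<open>m + 1\<close> entries moves the later ones \<open>m\<close> places to the left, and \<open>\<sigma>\<^sup>m = 1\<close>.\<close>

lemma sp_contract:
  assumes "set ps \<subseteq> carrier A" "set as \<subseteq> carrier A" "set qs \<subseteq> carrier A" "length as = Suc m"
  shows "sp (ps @ as @ qs) = sp (ps @ sp as # qs)"
proof -
  have "(\<sigma> ^^ Suc m) (sp qs) = \<sigma> (sp qs)" using pow_m[of "sp qs"] assms(3) by simp
  then show ?thesis using assms by (simp add: sp_append pow_closed \<sigma>.hom_closed del: funpow.simps)
qed

definition \<rho>\<^sub>W :: "'a ptree \<Rightarrow> int \<Rightarrow> ('a \<times> 'a \<Rightarrow> 'k) set"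
  where "\<rho>\<^sub>W t = normal_skew (left_labels t) (right_labels t)"

lemma rho_W: "leaves t = map Some us @ None # map Some ws \<Longrightarrow> \<rho>\<^sub>W t = normal_skew us ws"
  by (simp add: \<rho>\<^sub>W_def labels_eq)

lemma normal_skew_add:
  assumes "set ps \<subseteq> carrier A" "set qs \<subseteq> carrier A" "set rs \<subseteq> carrier A" "a \<in> carrier A" "b \<in> carrier A"
  shows "normal_skew (ps @ (a \<oplus>\<^bsub>A\<^esub> b) # qs) rs = normal_skew (ps @ a # qs) rs \<oplus>\<^bsub>W\<^esub> normal_skew (ps @ b # qs) rs"
    and "normal_skew rs (ps @ (a \<oplus>\<^bsub>A\<^esub> b) # qs) = normal_skew rs (ps @ a # qs) \<oplus>\<^bsub>W\<^esub> normal_skew rs (ps @ b # qs)"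
  unfolding normal_form_def using assms
  by (simp_all add: sp_add skew_term_bilinear pow_add pow_closed del: funpow.simps twisted_prod.simps)

lemma normal_skew_smult:
  assumes "set ps \<subseteq> carrier A" "set qs \<subseteq> carrier A" "set rs \<subseteq> carrier A" "a \<in> carrier A" "r \<in> carrier k"
  shows "normal_skew (ps @ (r \<odot>\<^bsub>A\<^esub> a) # qs) rs = r \<odot>\<^bsub>W\<^esub> normal_skew (ps @ a # qs) rs"
    and "normal_skew rs (ps @ (r \<odot>\<^bsub>A\<^esub> a) # qs) = r \<odot>\<^bsub>W\<^esub> normal_skew rs (ps @ a # qs)"
  unfolding normal_form_def using assms
  by (simp_all add: sp_smult skew_term_bilinear pow_smult pow_closed del: funpow.simps twisted_prod.simps)

text \<open>
  Multilinearity holds because \<open>sp\<close> and \<open>\<otimes>\<close> are multilinear, contraction by \<open>sp_contract\<close>,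
  rebracketing because only the sequence of leaves enters, and grafting by \<open>graft_data\<close>.  At the
  anchors all labels are \<open>1\<close> and the position of the hole is \<open>0\<close> or \<open>m\<close>, which is \<open>0\<close> modulo \<open>m\<close>.
\<close>

lemma skew_rep: "anchored_rep k A \<sigma> m c W \<rho>\<^sub>W"
proof -
  interpret W': k_algebra k W by (rule W_k_algebra)
  show ?thesis
  proof (unfold_locales, goal_cases)
    case (1 t)
    obtain us ws where u: "leaves t = map Some us @ None # map Some ws"
      "set us \<subseteq> carrier A" "set ws \<subseteq> carrier A" using 1 by (rule leaves_one_hole)
    then show ?case by (simp add: rho_W normal_skew_closed)
  next
    case (2 s t)
    obtain us ws where u: "leaves s = map Some us @ None # map Some ws"
      "set us \<subseteq> carrier A" "set ws \<subseteq> carrier A" using 2(1) by (rule leaves_one_hole)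
    obtain us' ws' where u': "leaves t = map Some us' @ None # map Some ws'"
      "set us' \<subseteq> carrier A" "set ws' \<subseteq> carrier A" using 2(2) by (rule leaves_one_hole)
    have "length (leaves t) = 1 + m * nodes t"
      using 2(2) by (intro length_leaves) (auto simp: one_hole_contexts_def)
    then have len: "(length us' + length ws') mod m = 0" by (simp add: u'(1))
    have "concat (map (\<lambda>l. case l of None \<Rightarrow> leaves t | Some a \<Rightarrow> [Some a]) (map Some xs)) = map Some xs" for xs
      by (induction xs) auto
    then have "leaves (graft s t) = map Some (us @ us') @ None # map Some (ws' @ ws)"
      by (simp add: leaves_graft u(1) u'(1))
    moreover have "normal_skew us ws \<otimes>\<^bsub>W\<^esub> normal_skew us' ws' = normal_skew (us @ us') (ws' @ ws)"
      by (rule normal_form_graft[of "mult W", OF _ u(2,3) u'(2,3) len]) (rule skew_term_mult)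
    ultimately show ?case using u(1) u'(1) by (simp only: rho_W)
  next
    case 3
    have "\<rho>\<^sub>W Hole = normal_skew [] []" by (rule rho_W) simp
    then show ?case by (simp add: normal_form_def skew_term_one \<sigma>.hom_one)
  next
    case (4 P a b)
    from 4(1,4) have "holes (Leaf a :: 'a ptree) = 0" by simp
    from frame_sides[OF 4(1,4) this] show ?case
    proof cases
      case (1 ps qs rs)
      have "\<rho>\<^sub>W (P (Leaf x)) = normal_skew (ps @ x # qs) rs" for x
        using 1(4)[of "Leaf x" "[x]"] by (intro rho_W) simp
      then show ?thesis using 1 4 by (simp add: normal_skew_add)
    next
      case (2 ps qs rs)
      have "\<rho>\<^sub>W (P (Leaf x)) = normal_skew ps (qs @ x # rs)" for x
        using 2(4)[of "Leaf x" "[x]"] by (intro rho_W) simp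
      then show ?thesis using 2 4 by (simp add: normal_skew_add)
    qed
  next
    case (5 P r a)
    from 5(1,4) have "holes (Leaf a :: 'a ptree) = 0" by simp
    from frame_sides[OF 5(1,4) this] show ?case
    proof cases
      case (1 ps qs rs)
      have "\<rho>\<^sub>W (P (Leaf x)) = normal_skew (ps @ x # qs) rs" for x
        using 1(4)[of "Leaf x" "[x]"] by (intro rho_W) simp
      then show ?thesis using 1 5 by (simp add: normal_skew_smult)
    next
      case (2 ps qs rs)
      have "\<rho>\<^sub>W (P (Leaf x)) = normal_skew ps (qs @ x # rs)" for x
        using 2(4)[of "Leaf x" "[x]"] by (intro rho_W) simp
      then show ?thesis using 2 5 by (simp add: normal_skew_smult)
    qed
  next
    case (6 P as)
    note as = contract_T[OF 6]
    have h: "holes (Node (map Leaf as) :: 'a ptree) = 0" by (simp add: o_def)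
    have l: "leaves (Node (map Leaf as) :: 'a ptree) = map Some as" by (induction as) auto
    from frame_sides[OF 6 h] show ?case
    proof cases
      case (1 ps qs rs)
      have "\<rho>\<^sub>W (P (Node (map Leaf as))) = normal_skew (ps @ as @ qs) rs"
        by (rule rho_W[OF 1(4)[OF l]])
      moreover have "\<rho>\<^sub>W (P (Leaf (\<mu> as))) = normal_skew (ps @ sp as # qs) rs"
        using 1(4)[of "Leaf (\<mu> as)" "[\<mu> as]"] as by (intro rho_W) (simp add: mu_eq)
      moreover have "normal_skew (ps @ as @ qs) rs = normal_skew (ps @ sp as # qs) rs"
      proof -
        have len: "length (ps @ as @ qs) = length (ps @ sp as # qs) + m" using as(2) by simp
        then have "Suc (length (ps @ as @ qs)) = Suc (length (ps @ sp as # qs)) + m" by simp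
        then have "(\<sigma> ^^ Suc (length (ps @ as @ qs))) (sp rs) = (\<sigma> ^^ Suc (length (ps @ sp as # qs))) (sp rs)"
          using pow_add_m[of "sp rs"] 1(3) by (simp only: sp_closed)
        then show ?thesis
          unfolding normal_form_def len mod_add_self2
          using sp_contract[OF 1(1) as(1) 1(2) as(2)] by (simp only: len)
      qed
      ultimately show ?thesis by simp
    next
      case (2 ps qs rs)
      have "\<rho>\<^sub>W (P (Node (map Leaf as))) = normal_skew ps (qs @ as @ rs)"
        by (rule rho_W[OF 2(4)[OF l]])
      moreover have "\<rho>\<^sub>W (P (Leaf (\<mu> as))) = normal_skew ps (qs @ sp as # rs)"
        using 2(4)[of "Leaf (\<mu> as)" "[\<mu> as]"] as by (intro rho_W) (simp add: mu_eq)
      ultimately show ?thesis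
        using sp_contract[OF 2(2) as(1) 2(3) as(2)] by (simp add: normal_form_def)
    qed
  next
    case (7 t t')
    then show ?case
      by (simp add: \<rho>\<^sub>W_def left_labels_def right_labels_def rebracket_invariants(1)[OF 7(2)])
  next
    case 8
    have c: "inv\<^bsub>A\<^esub> c = \<one>\<^bsub>A\<^esub>" by (simp add: c_one)
    have "\<rho>\<^sub>W left_anchor = normal_skew [] (replicate (m - 1) \<one>\<^bsub>A\<^esub> @ [\<one>\<^bsub>A\<^esub>])"
      by (rule rho_W) (simp add: c concat_replicate_trivial map_replicate)
    then show ?case
      by (simp add: normal_form_def skew_term_one sp_ones_append \<sigma>.hom_one pow_one)
  next
    case 9
    have c: "inv\<^bsub>A\<^esub> c = \<one>\<^bsub>A\<^esub>" by (simp add: c_one)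
    have "\<rho>\<^sub>W right_anchor = normal_skew (replicate m \<one>\<^bsub>A\<^esub>) []"
      using m_pos by (intro rho_W) (cases m, simp_all add: c concat_replicate_trivial map_replicate)
    then show ?case
      by (simp add: normal_form_def skew_term_one sp_ones \<sigma>.hom_one pow_one)
  qed
qed

end

section \<open>The isomorphism\<close>

context periodic_algebra
begin

theorem envelope_iso: "alg_isomorphic k V W"
proof -
  interpret V: k_algebra k V by (rule V_k_algebra)
  interpret W': k_algebra k W by (rule W_k_algebra)
  interpret vr: periodic_rep k A \<sigma> m c V "\<lambda>t. acls t"
    by (intro periodic_rep.intro envelope_rep periodic_algebra_axioms)
  obtain \<Phi> where hom: "k_algebra_hom k V W \<Phi>" and \<Phi>: "\<And>t. t \<in> T \<Longrightarrow> \<Phi> (acls t) = \<rho>\<^sub>W t"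
    using anchored_rep.anchored_envelope_universal[OF skew_rep] by metis
  interpret \<Phi>: k_algebra_hom k V W \<Phi> by (rule hom)
  have V: "module k V" ..

  \<comment> \<open>The inverse \<open>\<Psi>\<close> treats the \<open>m\<close> components of an element separately; \<open>\<Lambda> i\<close> is the map on the\<close>
  \<comment> \<open>\<open>i\<close>-th one, induced from the bilinear map that sends \<open>a\<close> and \<open>b\<close> to \<open>N a b i\<close>.\<close>
  define \<Lambda> where "\<Lambda> i = (\<lambda>Y. the_elem (lin_ext k V (\<lambda>p. vr.N (fst p) (snd p) i) ` Y))" for i
  have \<Lambda>: "linear_map k Ae V (\<Lambda> i)" "\<And>a b. \<lbrakk>a \<in> carrier A; b \<in> carrier A\<rbrakk> \<Longrightarrow> \<Lambda> i (pure a b) = vr.N a b i"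
    if "i < m" for i
    using Ae.tensor_lift[OF V, of "\<lambda>a b. vr.N a b i"] that
    by (simp_all add: \<Lambda>_def Ae_eq op_simps vr.N_closed vr.N_bilinear)
  define \<Psi> where "\<Psi> f = (\<Oplus>\<^bsub>V\<^esub>j\<in>{0..<int m}. \<Lambda> (nat j) (f j))" for f
  have \<Lambda>_lin: "linear_map k Ae V (\<Lambda> (nat j))" if "j \<in> {0..<int m}" for j
    using that by (intro \<Lambda>) auto
  have \<Lambda>_closed: "(\<lambda>j. \<Lambda> (nat j) (f j)) \<in> {0..<int m} \<rightarrow> carrier V" if "f \<in> carrier W" for f
    using that linear_map.hom_closed[OF \<Lambda>_lin] W.carrierD(1) by (auto simp: W_eq)
  have \<Psi>_lin: "linear_map k W V \<Psi>"
  proof unfold_locales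
    show "\<Psi> f \<in> carrier V" if "f \<in> carrier W" for f
      unfolding \<Psi>_def by (rule V.M.finsum_closed[OF \<Lambda>_closed[OF that]])
    show "\<Psi> (f \<oplus>\<^bsub>W\<^esub> g) = \<Psi> f \<oplus>\<^bsub>V\<^esub> \<Psi> g" if fg: "f \<in> carrier W" "g \<in> carrier W" for f g
    proof -
      have "\<Psi> (f \<oplus>\<^bsub>W\<^esub> g) = (\<Oplus>\<^bsub>V\<^esub>j\<in>{0..<int m}. \<Lambda> (nat j) (f j) \<oplus>\<^bsub>V\<^esub> \<Lambda> (nat j) (g j))"
        unfolding \<Psi>_def
      proof (rule V.M.finsum_cong')
        show "\<Lambda> (nat j) ((f \<oplus>\<^bsub>W\<^esub> g) j) = \<Lambda> (nat j) (f j) \<oplus>\<^bsub>V\<^esub> \<Lambda> (nat j) (g j)"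
          if "j \<in> {0..<int m}" for j
          using linear_map.hom_add[OF \<Lambda>_lin[OF that]] fg W.carrierD(1)
          by (simp add: W_eq W.skew_simps)
      qed (use \<Lambda>_closed[OF fg(1)] \<Lambda>_closed[OF fg(2)] in auto)
      then show ?thesis
        unfolding \<Psi>_def using V.M.finsum_addf[OF \<Lambda>_closed[OF fg(1)] \<Lambda>_closed[OF fg(2)]] by simp
    qed
    show "\<Psi> (r \<odot>\<^bsub>W\<^esub> f) = r \<odot>\<^bsub>V\<^esub> \<Psi> f" if r: "r \<in> carrier k" and f: "f \<in> carrier W" for r f
    proof -
      have "\<Psi> (r \<odot>\<^bsub>W\<^esub> f) = (\<Oplus>\<^bsub>V\<^esub>j\<in>{0..<int m}. r \<odot>\<^bsub>V\<^esub> \<Lambda> (nat j) (f j))"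
        unfolding \<Psi>_def
      proof (rule V.M.finsum_cong')
        show "\<Lambda> (nat j) ((r \<odot>\<^bsub>W\<^esub> f) j) = r \<odot>\<^bsub>V\<^esub> \<Lambda> (nat j) (f j)" if "j \<in> {0..<int m}" for j
          using linear_map.hom_smult[OF \<Lambda>_lin[OF that] r] f W.carrierD(1)
          by (simp add: W_eq W.skew_simps)
      qed (use \<Lambda>_closed[OF f] r in auto)
      then show ?thesis
        unfolding \<Psi>_def using V.finsum_smult_ldistr[OF _ r \<Lambda>_closed[OF f]] by simp
    qed
  qed
  interpret \<Psi>: linear_map k W V \<Psi> by (rule \<Psi>_lin)

  have \<Psi>_term: "\<Psi> (skew_term a b i) = vr.N a b i"
    if ab: "a \<in> carrier A" "b \<in> carrier A" and i: "i < m" for a b i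
  proof -
    have "\<Psi> (skew_term a b i)
      = (\<Oplus>\<^bsub>V\<^esub>j\<in>{0..<int m}. if int i = j then \<Lambda> i (pure a b) else \<zero>\<^bsub>V\<^esub>)"
      unfolding \<Psi>_def
    proof (rule V.M.finsum_cong')
      show "\<Lambda> (nat j) (skew_term a b i j) = (if int i = j then \<Lambda> i (pure a b) else \<zero>\<^bsub>V\<^esub>)"
        if "j \<in> {0..<int m}" for j
        using linear_map.hom_zero[OF \<Lambda>_lin[OF that]] by (auto simp: skew_term_def single_def)
    qed (use \<Lambda>(2)[OF i ab] vr.N_closed[OF ab i] in auto)
    also have "\<dots> = \<Lambda> i (pure a b)"
      by (rule V.M.finsum_singleton) (use i \<Lambda>(2)[OF i ab] vr.N_closed[OF ab i] in auto)
    finally show ?thesis using \<Lambda>(2)[OF i ab] by simp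
  qed

  \<comment> \<open>Contexts span the envelope, and the class of each one is its normal form.\<close>
  have \<Psi>\<Phi>: "\<Psi> (\<Phi> y) = y" if y: "y \<in> carrier V" for y
  proof (rule linear_eq_on_classes[OF linear_map_compose[OF \<Phi>.linear_map_axioms \<Psi>_lin] _ _ y])
    show "linear_map k V V (\<lambda>y. y)" by unfold_locales simp_all
    fix t assume t: "t \<in> T"
    obtain us ws where u: "leaves t = map Some us @ None # map Some ws"
      "set us \<subseteq> carrier A" "set ws \<subseteq> carrier A" using t by (rule leaves_one_hole)
    have "\<Psi> (\<Phi> (acls t)) = normal_form vr.N us ws"
      unfolding \<Phi>[OF t] rho_W[OF u(1)] normal_form_def
      using u m_pos by (intro \<Psi>_term) (auto intro!: pow_closed simp del: funpow.simps)
    then show "\<Psi> (\<Phi> (acls t)) = acls t" using vr.rho_eq_normal[OF t u(1)] by simp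
  qed

  have \<Phi>_E: "\<Phi> (acls (vr.E us ws)) = normal_skew us ws"
    if "set us \<subseteq> carrier A" "set ws \<subseteq> carrier A" "length us + length ws = m" for us ws
    unfolding \<Phi>[OF vr.E_T[OF that]]
    by (rule rho_W) (simp add: vr.E_def o_def concat_map_singleton)
  have \<Phi>_N: "\<Phi> (vr.N a b i) = skew_term a b i"
    if ab: "a \<in> carrier A" "b \<in> carrier A" and i: "i < m" for a b i
  proof -
    have "\<Phi> (vr.L a) = skew_term a \<one>\<^bsub>A\<^esub> 0"
      using ab m_pos sp_append_ones[of "[a]" "m - 1"]
      by (subst \<Phi>_E) (auto simp: normal_form_def sp_singleton \<sigma>.hom_one pow_one simp del: twisted_prod.simps(2))
    moreover have "\<Phi> (vr.B b) = skew_term \<one>\<^bsub>A\<^esub> b 0"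
      using ab m_pos pow_m[of b]
      by (subst \<Phi>_E) (auto simp: normal_form_def sp_ones_append sp_singleton gr0_conv_Suc simp del: twisted_prod.simps(2))
    moreover have "\<Phi> (vr.Sh i) = skew_term \<one>\<^bsub>A\<^esub> \<one>\<^bsub>A\<^esub> i"
      using i by (subst \<Phi>_E) (auto simp: normal_form_def sp_ones \<sigma>.hom_one pow_one)
    ultimately show ?thesis
      unfolding vr.N_def using ab i m_pos
      by (simp add: \<Phi>.hom_mult vr.L_closed vr.B_closed vr.Sh_closed less_imp_le skew_term_mult pow_one
          del: One_nat_def)
  qed
  have \<Phi>\<Psi>: "\<Phi> (\<Psi> x) = x" if x: "x \<in> carrier W" for x
  proof (rule W.linear_eqI[folded W_eq, OF linear_map_compose[OF \<Psi>_lin \<Phi>.linear_map_axioms] _ _ x])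
    show "linear_map k W W (\<lambda>x. x)" by unfold_locales simp_all
    fix g b assume g: "g \<in> carrier C\<^sub>m" and b: "b \<in> carrier Ae"
    obtain i where i: "g = int i" "i < m" using g by (auto simp: cyclic_carrier dest: zero_le_imp_eq_int)
    have Ae: "module k Ae" by (rule k_algebra.axioms(1)[OF k_algebra_hom.axioms(2)[OF \<tau>_hom]])
    have s: "linear_map k Ae W (single Ae g)"
      by (intro linear_map.intro linear_map_axioms.intro Ae)
        (use W'.module_axioms g in \<open>simp_all add: W_eq W.single_closed W.single_add W.single_smult\<close>)
    show "\<Phi> (\<Psi> (single Ae g b)) = single Ae g b"
    proof (rule Ae_linear_eq[OF _ s _ b])
      show "linear_map k Ae W (\<lambda>b. \<Phi> (\<Psi> (single Ae g b)))"
        by (rule linear_map_compose[OF linear_map_compose[OF s \<Psi>_lin] \<Phi>.linear_map_axioms])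
      show "\<Phi> (\<Psi> (single Ae g (pure a b))) = single Ae g (pure a b)"
        if "a \<in> carrier A" "b \<in> carrier A" for a b
        using \<Phi>_N[OF that i(2)] \<Psi>_term[OF that i(2)] by (simp add: skew_term_def i(1))
    qed
  qed

  have "bij_betw \<Phi> (carrier V) (carrier W)"
    by (rule bij_betw_byWitness[of _ \<Psi>]) (use \<Psi>\<Phi> \<Phi>\<Psi> \<Phi>.hom_closed \<Psi>.hom_closed in auto)
  then have "\<Phi> \<in> alg_iso k V W"
    using \<Phi>.ring_hom \<Phi>.hom_smult by (simp add: alg_iso_def ring_iso_def)
  then show ?thesis
    unfolding alg_isomorphic_def using V_k_algebra W_k_algebra by blast
qed

end

theorem corollary3p4:
  fixes k :: "('k, 'x) ring_scheme" and A :: "('k, 'a, 'y) module_scheme"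
    and m :: nat and \<sigma> :: "'a \<Rightarrow> 'a" and c :: 'a
  assumes "k_algebra k A"
    and "m \<ge> 2"
    and "c \<in> Units A"
    and "\<sigma> \<in> alg_aut k A"
    and "\<sigma> c = c"
    and "\<forall>a\<in>carrier A. (\<sigma> ^^ m) a = c \<otimes>\<^bsub>A\<^esub> a \<otimes>\<^bsub>A\<^esub> inv\<^bsub>A\<^esub> c"
  shows "slot_module k A m \<sigma> c A (regular_slot A m \<sigma> c)
    \<and> endpoint_anchored A m c A (regular_slot A m \<sigma> c)
    \<and> (c = \<one>\<^bsub>A\<^esub> \<longrightarrow>
        (\<forall>a\<in>carrier A. (\<sigma> ^^ m) a = a)
        \<and> alg_isomorphic k (anchored_envelope k A m \<sigma> c)
            (cyclic_skew_algebra (enveloping_algebra k A) (enveloping_map k A \<sigma>) m)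
        \<and> (\<forall>i\<in>{1..<m}. \<forall>x\<in>carrier A.
            context_action (nary_mult A m \<sigma> c) (regular_slot A m \<sigma> c) (unit_context A m i) x
              = (\<sigma> ^^ i) x))"
proof -
  interpret A: k_algebra k A by fact
  have "twisted_algebra k A \<sigma> m c"
  proof (intro twisted_algebra.intro twisted_algebra_axioms.intro)
    show "k_algebra_hom k A A \<sigma>" by (rule alg_iso_hom[OF assms(1,1,4)])
    fix a assume "a \<in> carrier A"
    then show "(\<sigma> ^^ m) a \<otimes>\<^bsub>A\<^esub> c = c \<otimes>\<^bsub>A\<^esub> a"
      using assms(3,6) A.A.Units_closed[OF assms(3)] by (simp add: A.A.m_assoc)
  qed (use assms in auto)
  then interpret twisted_algebra k A \<sigma> m c .
  have "(\<forall>a\<in>carrier A. (\<sigma> ^^ m) a = a) \<and> alg_isomorphic k V (cyclic_skew_algebra (enveloping_algebra k A) (enveloping_map k A \<sigma>) m)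
    \<and> (\<forall>i\<in>{1..<m}. \<forall>x\<in>carrier A. context_action \<mu> reg (unit_context A m i) x = (\<sigma> ^^ i) x)"
    if one: "c = \<one>\<^bsub>A\<^esub>"
  proof -
    interpret periodic_algebra k A \<sigma> m c by unfold_locales (rule one)
    show ?thesis using pow_m envelope_iso unit_context_action[OF one] by auto
  qed
  then show ?thesis using regular_slot_module regular_endpoint_anchored by blast
qed

end
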